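(* Let $D$ and $B$ be non-negative nuclear operators on $E$ whose eigenvectors are the basis vectors of $\mathcal E$, with all eigenvalues of $B$ positive. If the operator $DB^{-1}$ is nuclear, then the generator of the semigroup $\widehat{\mathcal U}_{tD}$, $t\ge0$, is the closure of the semi-bounded operator $\Lambda_D:\widehat C_B^\infty\to\mathcal H_{\mathcal E}$ acting as $$\Lambda_Df=-(Dx,x)f,\qquad f\in\widehat C_B^\infty.$$
   Context: $E$ is an infinite-dimensional real separable Hilbert space with orthonormal basis $\mathcal E=\{e_k\}_{k\in\mathbb N}$; $x_k=(x,e_k)$. A block is a set $\Pi_{a,b}=\{x\in E: x_j\in[a_j,b_j)\ \forall j\}$ with $a,b\in\ell_\infty$, $a_j<b_j$; it is absolutely measurable if it is empty or $\sum_j\max\{0,\ln(b_j-a_j)\}<\infty$. Put $\lambda_{\mathcal E}(\Pi_{a,b})=\prod_j(b_j-a_j)$ if $\Pi_{a,b}\ne\emptyset$ (value $0$ if the product diverges to $0$), and $\lambda_{\mathcal E}(\emptyset)=0$. It is known that $\lambda_{\mathcal E}$ extends uniquely to a finitely additive shift-invariant measure on the ring generated by absolutely measurable blocks, and then to the completion $\mathcal R_{\mathcal E}$ of this ring. $\mathcal H_{\mathcal E}$ is the complex Hilbert space obtained by completing (modulo the null space) the space of finite sums $\sum c_k\chi_{B_k}$, $c_k\in\mathbb C$, $B_k\in\mathcal R_{\mathcal E}$ pairwise disjoint, in the norm $(\sum|c_k|^2\lambda_{\mathcal E}(B_k))^{1/2}$. For each $k$, $\mathcal H_{\mathcal E}=L_2(\mathbb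 R)\otimes\mathcal H_{\mathcal E\setminus\{e_k\}}$ with first factor the variable $x_k$; multiplication by $x_k$ acts on the first factor. For a nuclear diagonal operator $D\ge0$ ($De_k=d_ke_k$, $\sum d_k<\infty$), $\widehat{\mathcal U}_{tD}$, $t\ge0$, is multiplication by $\exp(-t(Dx,x))$, defined as the strong limit as $N\to\infty$ of multiplication by $\exp(-t\sum_{k\le N}d_kx_k^2)$. $\widehat C_B^\infty=\mathrm{span}\{\widehat{\mathcal U}_{tB}u:u\in\mathcal H_{\mathcal E},t>0\}$. $(Dx,x)f=\sum_kd_kx_k^2f$ (series in $\mathcal H_{\mathcal E}$). *)

theory Defs
  imports "HOL-Analysis.Analysis"
begin

text \<open>The inner product is linear in its first argument.\<close>

class complex_hilbert = banach +
  fixes scaleC :: "complex \<Rightarrow> 'a \<Rightarrow> 'a" (infixr "*\<^sub>C" 75)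
    and cinner :: "'a \<Rightarrow> 'a \<Rightarrow> complex"
  assumes scaleC_add_right: "c *\<^sub>C (x + y) = c *\<^sub>C x + c *\<^sub>C y"
    and scaleC_add_left: "(c + d) *\<^sub>C x = c *\<^sub>C x + d *\<^sub>C x"
    and scaleC_scaleC: "c *\<^sub>C (d *\<^sub>C x) = (c * d) *\<^sub>C x"
    and scaleC_of_real: "complex_of_real r *\<^sub>C x = r *\<^sub>R x"
    and cinner_commute: "cinner x y = cnj (cinner y x)"
    and cinner_add_left: "cinner (x + y) z = cinner x z + cinner y z"
    and cinner_scaleC_left: "cinner (c *\<^sub>C x) y = c * cinner x y"
    and cinner_self: "cinner x x = complex_of_real ((norm x)\<^sup>2)"

global_interpretation complex_vector:
  vector_space "scaleC :: complex \<Rightarrow> 'a \<Rightarrow> 'a::complex_hilbert"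
  defines cspan = "complex_vector.span"
proof
  show "1 *\<^sub>C x = x" for x :: 'a
    using scaleC_of_real[of 1 x] by simp
qed (simp_all add: scaleC_add_right scaleC_add_left scaleC_scaleC)

definition orthonormal_basis :: "(nat \<Rightarrow> 'a::real_inner) \<Rightarrow> bool" where
  "orthonormal_basis e \<longleftrightarrow>
     (\<forall>i j. e i \<bullet> e j = (if i = j then 1 else 0)) \<and> closure (span (range e)) = UNIV"

definition nuclear :: "('a::real_inner \<Rightarrow> 'a) \<Rightarrow> bool" where
  "nuclear T \<longleftrightarrow>
     (\<exists>x y :: nat \<Rightarrow> 'a. summable (\<lambda>n. norm (x n) * norm (y n)) \<and>
        (\<forall>z. (\<lambda>n. (z \<bullet> x n) *\<^sub>R y n) sums T z))"

text \<open>
  Everything is done for the closed span of a subfamily \<open>(e j)\<close>, \<open>j \<in> J\<close>, of the basis: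
  \<open>J = UNIV\<close> gives the whole space and \<open>J = UNIV - {k}\<close> the orthogonal complement
  of \<open>e k\<close> with the basis from which \<open>e k\<close> has been removed.
\<close>

definition subspace_of :: "(nat \<Rightarrow> 'a::real_inner) \<Rightarrow> nat set \<Rightarrow> 'a set" where
  "subspace_of e J = closure (span (e ` J))"

definition block :: "(nat \<Rightarrow> 'a::real_inner) \<Rightarrow> nat set \<Rightarrow> (nat \<Rightarrow> real) \<Rightarrow> (nat \<Rightarrow> real) \<Rightarrow> 'a set" where
  "block e J a b = {x \<in> subspace_of e J. \<forall>j\<in>J. a j \<le> x \<bullet> e j \<and> x \<bullet> e j < b j}"

definition abs_measurable ::
    "(nat \<Rightarrow> 'a::real_inner) \<Rightarrow> nat set \<Rightarrow> (nat \<Rightarrow> real) \<Rightarrow> (nat \<Rightarrow> real) \<Rightarrow> bool" where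
  "abs_measurable e J a b \<longleftrightarrow>
     bounded (a ` J) \<and> bounded (b ` J) \<and> (\<forall>j\<in>J. a j < b j) \<and>
     (block e J a b = {} \<or> (\<lambda>j. max 0 (ln (b j - a j))) summable_on J)"

text \<open>For an absolutely measurable non-empty block the partial products converge,
  possibly to \<open>0\<close>.\<close>

definition block_measure ::
    "(nat \<Rightarrow> 'a::real_inner) \<Rightarrow> nat set \<Rightarrow> (nat \<Rightarrow> real) \<Rightarrow> (nat \<Rightarrow> real) \<Rightarrow> real" where
  "block_measure e J a b =
     (if block e J a b = {} then 0 else lim (\<lambda>n. \<Prod>j\<in>{j\<in>J. j < n}. b j - a j))"

definition block_ring :: "(nat \<Rightarrow> 'a::real_inner) \<Rightarrow> nat set \<Rightarrow> 'a set set" where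
  "block_ring e J =
     \<Inter>{M. ring_of_sets (subspace_of e J) M \<and> {block e J a b | a b. abs_measurable e J a b} \<subseteq> M}"

definition block_extension ::
    "(nat \<Rightarrow> 'a::real_inner) \<Rightarrow> nat set \<Rightarrow> ('a set \<Rightarrow> real) \<Rightarrow> bool" where
  "block_extension e J m \<longleftrightarrow>
     (\<forall>A\<in>block_ring e J. 0 \<le> m A) \<and>
     (\<forall>A\<in>block_ring e J. \<forall>B\<in>block_ring e J. A \<inter> B = {} \<longrightarrow> m (A \<union> B) = m A + m B) \<and>
     (\<forall>A\<in>block_ring e J. \<forall>h\<in>subspace_of e J. m ((+) h ` A) = m A) \<and>
     (\<forall>a b. abs_measurable e J a b \<longrightarrow> m (block e J a b) = block_measure e J a b)"

text \<open>The value \<open>0\<close> outside the ring is a convention that makes the extension unique as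
  a total function.\<close>

definition ring_measure :: "(nat \<Rightarrow> 'a::real_inner) \<Rightarrow> nat set \<Rightarrow> 'a set \<Rightarrow> real" where
  "ring_measure e J =
     (THE m. block_extension e J m \<and> (\<forall>A. A \<notin> block_ring e J \<longrightarrow> m A = 0))"

text \<open>Completion of a ring with a finitely additive measure: the sets whose inner and outer
  measures are finite and equal.\<close>

definition complete_ring :: "(nat \<Rightarrow> 'a::real_inner) \<Rightarrow> nat set \<Rightarrow> 'a set set" where
  "complete_ring e J =
     {A. \<forall>\<epsilon>>0. \<exists>B\<in>block_ring e J. \<exists>C\<in>block_ring e J.
        B \<subseteq> A \<and> A \<subseteq> C \<and> ring_measure e J (C - B) < \<epsilon>}"

definition shift_measure :: "(nat \<Rightarrow> 'a::real_inner) \<Rightarrow> nat set \<Rightarrow> 'a set \<Rightarrow> real" where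
  "shift_measure e J A = Inf {ring_measure e J C | C. C \<in> block_ring e J \<and> A \<subseteq> C}"

definition step_fun :: "nat \<Rightarrow> (nat \<Rightarrow> complex) \<Rightarrow> (nat \<Rightarrow> 'a set) \<Rightarrow> 'a \<Rightarrow> complex" where
  "step_fun n c B x = (\<Sum>i<n. c i * indicator (B i) x)"

definition step_funs :: "(nat \<Rightarrow> 'a::real_inner) \<Rightarrow> nat set \<Rightarrow> ('a \<Rightarrow> complex) set" where
  "step_funs e J =
     {step_fun n c B | n c B. (\<forall>i<n. B i \<in> complete_ring e J) \<and> disjoint_family_on B {..<n}}"

text \<open>
  \<open>l2_completion e J \<iota>\<close>: the complete space \<open>'h\<close>, with the map \<open>\<iota>\<close> that sends a step
  function to its class, is the completion of the step functions modulo null functions.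
  This determines \<open>('h, \<iota>)\<close> up to a unique isometric isomorphism. The values of \<open>\<iota>\<close> outside
  the step functions are irrelevant.
\<close>

definition l2_completion ::
    "(nat \<Rightarrow> 'a::real_inner) \<Rightarrow> nat set \<Rightarrow> (('a \<Rightarrow> complex) \<Rightarrow> 'h::complex_hilbert) \<Rightarrow> bool" where
  "l2_completion e J \<iota> \<longleftrightarrow>
     (\<forall>f\<in>step_funs e J. \<forall>g\<in>step_funs e J. \<iota> (\<lambda>x. f x + g x) = \<iota> f + \<iota> g) \<and>
     (\<forall>f\<in>step_funs e J. \<forall>c. \<iota> (\<lambda>x. c * f x) = c *\<^sub>C \<iota> f) \<and>
     (\<forall>n c B. (\<forall>i<n. B i \<in> complete_ring e J) \<and> disjoint_family_on B {..<n} \<longrightarrow>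
        norm (\<iota> (step_fun n c B)) = sqrt (\<Sum>i<n. (cmod (c i))\<^sup>2 * shift_measure e J (B i))) \<and>
     closure (\<iota> ` step_funs e J) = UNIV"

definition L2_real :: "(real \<Rightarrow> complex) set" where
  "L2_real = {u \<in> borel_measurable lborel. integrable lborel (\<lambda>s. (cmod (u s))\<^sup>2)}"

text \<open>
  \<open>coord_splitting e k \<iota> \<iota>' \<tau>\<close>: the map \<open>\<tau> u v\<close>, read \<open>u \<otimes> v\<close>, exhibits \<open>'h\<close> as the Hilbert
  tensor product of \<open>L\<^sub>2\<close> of the real line (given by representatives) and the space \<open>'g\<close>
  belonging to the complement of \<open>e k\<close>; the first factor is the \<open>k\<close>-th coordinate, by the last
  clause. These conditions determine \<open>\<tau>\<close> on \<open>L2_real\<close>.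
\<close>

definition coord_splitting ::
    "(nat \<Rightarrow> 'a::real_inner) \<Rightarrow> nat \<Rightarrow> (('a \<Rightarrow> complex) \<Rightarrow> 'h::complex_hilbert) \<Rightarrow>
     (('a \<Rightarrow> complex) \<Rightarrow> 'g::complex_hilbert) \<Rightarrow> ((real \<Rightarrow> complex) \<Rightarrow> 'g \<Rightarrow> 'h) \<Rightarrow> bool" where
  "coord_splitting e k \<iota> \<iota>' \<tau> \<longleftrightarrow>
     (\<forall>u\<in>L2_real. \<forall>u'\<in>L2_real. \<forall>v. \<tau> (\<lambda>s. u s + u' s) v = \<tau> u v + \<tau> u' v) \<and>
     (\<forall>u\<in>L2_real. \<forall>c v. \<tau> (\<lambda>s. c * u s) v = c *\<^sub>C \<tau> u v) \<and>
     (\<forall>u\<in>L2_real. \<forall>v v'. \<tau> u (v + v') = \<tau> u v + \<tau> u v') \<and>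
     (\<forall>u\<in>L2_real. \<forall>c v. \<tau> u (c *\<^sub>C v) = c *\<^sub>C \<tau> u v) \<and>
     (\<forall>u\<in>L2_real. \<forall>u'\<in>L2_real. \<forall>v v'.
        cinner (\<tau> u v) (\<tau> u' v') = (\<integral>s. u s * cnj (u' s) \<partial>lborel) * cinner v v') \<and>
     closure (cspan {\<tau> u v | u v. u \<in> L2_real}) = UNIV \<and>
     (\<forall>\<alpha> \<beta>. \<forall>B\<in>complete_ring e (UNIV - {k}). \<alpha> < \<beta> \<longrightarrow>
        \<tau> (indicator {\<alpha>..<\<beta>}) (\<iota>' (indicator B)) =
        \<iota> (indicator {x. x \<bullet> e k \<in> {\<alpha>..<\<beta>} \<and> x - (x \<bullet> e k) *\<^sub>R e k \<in> B}))"

text \<open>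
  Graph of multiplication by \<open>\<phi>(x\<^sub>k)\<close>, that is, of the closure of the operator
  \<open>u \<otimes> v \<mapsto> (\<phi> u) \<otimes> v\<close> on the algebraic tensor product of its domain in \<open>L\<^sub>2\<close> with \<open>'g\<close>.
  The set of generating pairs is stable under complex scalars, so its real span is a complex
  subspace of \<open>'h \<times> 'h\<close>.
\<close>

definition coord_mult_graph ::
    "((real \<Rightarrow> complex) \<Rightarrow> 'g \<Rightarrow> 'h::complex_hilbert) \<Rightarrow> (real \<Rightarrow> real) \<Rightarrow> ('h \<times> 'h) set" where
  "coord_mult_graph \<tau> \<phi> =
     closure (span {(\<tau> u v, \<tau> (\<lambda>s. complex_of_real (\<phi> s) * u s) v) | u v.
       u \<in> L2_real \<and> (\<lambda>s. complex_of_real (\<phi> s) * u s) \<in> L2_real})"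

definition coord_mult_dom ::
    "((real \<Rightarrow> complex) \<Rightarrow> 'g \<Rightarrow> 'h::complex_hilbert) \<Rightarrow> (real \<Rightarrow> real) \<Rightarrow> 'h set" where
  "coord_mult_dom \<tau> \<phi> = Domain (coord_mult_graph \<tau> \<phi>)"

definition coord_mult ::
    "((real \<Rightarrow> complex) \<Rightarrow> 'g \<Rightarrow> 'h::complex_hilbert) \<Rightarrow> (real \<Rightarrow> real) \<Rightarrow> 'h \<Rightarrow> 'h" where
  "coord_mult \<tau> \<phi> f = (THE g. (f, g) \<in> coord_mult_graph \<tau> \<phi>)"

text \<open>A diagonal operator enters through its eigenvalues \<open>d\<close>. Multiplication by
  \<open>exp (- t * (\<Sum>k\<le>N. d k * x\<^sub>k\<^sup>2))\<close> is the composition of the multiplications by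
  \<open>exp (- t * d k * x\<^sub>k\<^sup>2)\<close>, each of which acts in a single coordinate.\<close>

definition gauss_trunc ::
    "(nat \<Rightarrow> (real \<Rightarrow> complex) \<Rightarrow> 'g \<Rightarrow> 'h::complex_hilbert) \<Rightarrow> (nat \<Rightarrow> real) \<Rightarrow> nat \<Rightarrow> real \<Rightarrow> 'h \<Rightarrow> 'h" where
  "gauss_trunc \<tau> d N t = fold (\<lambda>k. coord_mult (\<tau> k) (\<lambda>s. exp (- t * d k * s\<^sup>2))) [0..<Suc N]"

definition gauss_semigroup ::
    "(nat \<Rightarrow> (real \<Rightarrow> complex) \<Rightarrow> 'g \<Rightarrow> 'h::complex_hilbert) \<Rightarrow> (nat \<Rightarrow> real) \<Rightarrow> real \<Rightarrow> 'h \<Rightarrow> 'h" where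
  "gauss_semigroup \<tau> d t f = lim (\<lambda>N. gauss_trunc \<tau> d N t f)"

definition C_inf ::
    "(nat \<Rightarrow> (real \<Rightarrow> complex) \<Rightarrow> 'g \<Rightarrow> 'h::complex_hilbert) \<Rightarrow> (nat \<Rightarrow> real) \<Rightarrow> 'h set" where
  "C_inf \<tau> b = cspan {gauss_semigroup \<tau> b t u | t u. t > 0}"

definition quad_defined ::
    "(nat \<Rightarrow> (real \<Rightarrow> complex) \<Rightarrow> 'g \<Rightarrow> 'h::complex_hilbert) \<Rightarrow> (nat \<Rightarrow> real) \<Rightarrow> 'h \<Rightarrow> bool" where
  "quad_defined \<tau> d f \<longleftrightarrow>
     (\<forall>k. f \<in> coord_mult_dom (\<tau> k) (\<lambda>s. s\<^sup>2)) \<and>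
     summable (\<lambda>k. d k *\<^sub>R coord_mult (\<tau> k) (\<lambda>s. s\<^sup>2) f)"

definition quad_mult ::
    "(nat \<Rightarrow> (real \<Rightarrow> complex) \<Rightarrow> 'g \<Rightarrow> 'h::complex_hilbert) \<Rightarrow> (nat \<Rightarrow> real) \<Rightarrow> 'h \<Rightarrow> 'h" where
  "quad_mult \<tau> d f = (\<Sum>k. d k *\<^sub>R coord_mult (\<tau> k) (\<lambda>s. s\<^sup>2) f)"

definition generator_graph :: "(real \<Rightarrow> 'h \<Rightarrow> 'h::real_normed_vector) \<Rightarrow> ('h \<times> 'h) set" where
  "generator_graph U = {(f, g). ((\<lambda>t. (U t f - f) /\<^sub>R t) \<longlongrightarrow> g) (at_right 0)}"

definition operator_graph :: "'h set \<Rightarrow> ('h \<Rightarrow> 'h) \<Rightarrow> ('h \<times> 'h) set" where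
  "operator_graph S L = (\<lambda>f. (f, L f)) ` S"

text \<open>On a complex Hilbert space, reality of the quadratic form is symmetry of the operator.\<close>

definition semibounded_above :: "'h::complex_hilbert set \<Rightarrow> ('h \<Rightarrow> 'h) \<Rightarrow> bool" where
  "semibounded_above S L \<longleftrightarrow>
     (\<exists>c. \<forall>f\<in>S. cinner (L f) f \<in> \<real> \<and> Re (cinner (L f) f) \<le> c * (norm f)\<^sup>2)"

end

theory Submission
  imports Defs "HOL-Probability.Probability"
begin

text \<open>
  Multiplications by bounded functions of one coordinate are contractions up to a constant, and
  those belonging to different coordinates commute because they do so on indicator functions of
  blocks, which span a dense subspace. The latter requires the finitely additive extension of the
  block measure to exist: if a linear combination of indicators of blocks is non-negative on
  \<open>\<ell>\<^sub>2\<close>, it is non-negative on all sequences, and inside a single block it can be integrated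
  against a product probability measure.

  On the indicator of a block all coordinates are bounded by one constant, so that the infinite
  product of the Gaussian factors converges and is strongly continuous in \<open>t\<close>. A vector
  \<open>U\<^sub>B s u\<close> with \<open>s > 0\<close> has the factor \<open>exp (- s * b k * x\<^sub>k\<^sup>2)\<close> for each \<open>k\<close>, which bounds
  \<open>d k * x\<^sub>k\<^sup>2\<close> by a multiple of \<open>d k / b k\<close>; nuclearity of \<open>D B\<^sup>-\<^sup>1\<close> and Tannery's theorem then
  give the generator on \<open>U\<^sub>B s u\<close>. As \<open>U\<^sub>B\<close> commutes with \<open>U\<^sub>D\<close>, every \<open>(f, g)\<close> in the graph of the
  generator is the limit of the points \<open>(U\<^sub>B s f, U\<^sub>B s g)\<close>.
\<close>

section \<open>Complex Hilbert spaces\<close>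

text \<open>A vector of the completion is not a function, and the only access to the variable
  \<open>x_k\<close> is the map \<open>\<tau> k\<close>. Operators in one coordinate therefore live
  on graphs, and no pointwise argument links two coordinates; this is why commutation has to be
  tested on blocks. Blocks in turn are reached through \<open>ring_measure\<close>, a definite
  description about which nothing is known until the extension is shown to exist and to be unique.
  The obstacle to existence is that the integration takes place where the Hilbert space is
  invisible: if infinitely many edges have a product converging to a positive number, the edges tend
  to 1, so almost no sequence of the product measure is square-summable. Positivity must thus be
  carried from the Hilbert space to all sequences before it is integrated, and the boxes must first
  be confined to one box of positive measure, because only there can the product be normalized. The
  domination in the generator argument has the constant \<open>norm u / t\<close>, which is finite
  for each \<open>t > 0\<close> but blows up at 0. The core consists of smoothed vectors for this
  reason, and the closure alone recovers the rest of the domain.\<close>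

lemma cinner_zero_left [simp]: "cinner 0 (y::'a::complex_hilbert) = 0"
  using cinner_add_left[of 0 0 y] by simp

lemma cinner_add_right: "cinner (x::'a::complex_hilbert) (y + z) = cinner x y + cinner x z"
  by (metis cinner_add_left cinner_commute complex_cnj_add)

lemma cinner_scaleC_right: "cinner (x::'a::complex_hilbert) (c *\<^sub>C y) = cnj c * cinner x y"
  by (metis cinner_scaleC_left cinner_commute complex_cnj_mult)

lemma cinner_scaleR_left: "cinner (r *\<^sub>R (x::'a::complex_hilbert)) y = of_real r * cinner x y"
  by (metis cinner_scaleC_left scaleC_of_real)

lemma cinner_scaleR_right: "cinner (x::'a::complex_hilbert) (r *\<^sub>R y) = of_real r * cinner x y"
  by (metis cinner_scaleC_right scaleC_of_real complex_cnj_complex_of_real)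

lemma cinner_zero_right [simp]: "cinner (x::'a::complex_hilbert) 0 = 0"
  using cinner_add_right[of x 0 0] by simp

lemma cinner_diff_left: "cinner ((x::'a::complex_hilbert) - y) z = cinner x z - cinner y z"
  by (metis add_diff_cancel_right' cinner_add_left diff_add_cancel)

lemma cinner_diff_right: "cinner (x::'a::complex_hilbert) (y - z) = cinner x y - cinner x z"
  by (metis add_diff_cancel_right' cinner_add_right diff_add_cancel)

lemma norm_scaleC: "norm (c *\<^sub>C (x::'a::complex_hilbert)) = cmod c * norm x"
proof -
  have "complex_of_real ((norm (c *\<^sub>C x))\<^sup>2) = (c * cnj c) * of_real ((norm x)\<^sup>2)"
    by (metis cinner_self cinner_scaleC_left cinner_scaleC_right mult.assoc)
  also have "\<dots> = of_real ((cmod c * norm x)\<^sup>2)"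
    by (simp add: complex_norm_square[symmetric] power_mult_distrib)
  finally have "(norm (c *\<^sub>C x))\<^sup>2 = (cmod c * norm x)\<^sup>2"
    using of_real_eq_iff by blast
  then show ?thesis by (simp add: power2_eq_iff_nonneg)
qed

lemma cinner_Cauchy_Schwarz: "cmod (cinner (x::'a::complex_hilbert) y) \<le> norm x * norm y"
proof (cases "y = 0")
  case False
  define c where "c = cinner x y"
  define s where "s = (norm y)\<^sup>2"
  have "s > 0" using False by (simp add: s_def)
  \<comment> \<open>\<open>?z\<close> is \<open>s\<close> times the component of \<open>x\<close>
    orthogonal to \<open>y\<close>; clearing the denominator keeps the computation
    polynomial.\<close>
  let ?z = "of_real s *\<^sub>C x - c *\<^sub>C y"
  have yx: "cinner y x = cnj c" by (metis c_def cinner_commute)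
  have "of_real ((norm ?z)\<^sup>2) = cinner ?z ?z" by (simp only: cinner_self)
  also have "\<dots> = of_real s * (of_real s * of_real ((norm x)\<^sup>2)) - of_real s * (c * cnj c)"
    unfolding cinner_diff_left cinner_diff_right cinner_scaleC_left cinner_scaleC_right yx
    by (simp add: cinner_self s_def[symmetric] c_def[symmetric] algebra_simps)
  also have "\<dots> = of_real (s * (s * (norm x)\<^sup>2 - (cmod c)\<^sup>2))"
    by (simp add: complex_norm_square[symmetric] algebra_simps)
  finally have "(norm ?z)\<^sup>2 = s * (s * (norm x)\<^sup>2 - (cmod c)\<^sup>2)" using of_real_eq_iff by blast
  then have "0 \<le> s * (s * (norm x)\<^sup>2 - (cmod c)\<^sup>2)" by (metis zero_le_power2)
  then have "(cmod c)\<^sup>2 \<le> s * (norm x)\<^sup>2" using \<open>s > 0\<close> by (simp add: zero_le_mult_iff)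
  then have "(cmod c)\<^sup>2 \<le> (norm x * norm y)\<^sup>2" by (simp add: s_def power_mult_distrib mult.commute)
  then show ?thesis unfolding c_def by (rule power2_le_imp_le) simp
qed simp

lemma bounded_bilinear_cinner: "bounded_bilinear (cinner :: 'a::complex_hilbert \<Rightarrow> 'a \<Rightarrow> complex)"
proof
  show "\<exists>K. \<forall>a b::'a. norm (cinner a b) \<le> norm a * norm b * K"
    by (intro exI[of _ 1] allI) (simp add: cinner_Cauchy_Schwarz)
qed (simp_all add: cinner_add_left cinner_add_right cinner_scaleR_left cinner_scaleR_right scaleR_conv_of_real)

lemmas tendsto_cinner = bounded_bilinear.tendsto[OF bounded_bilinear_cinner]
lemmas continuous_on_cinner = bounded_bilinear.continuous_on[OF bounded_bilinear_cinner]

lemma bounded_linear_scaleC: "bounded_linear (\<lambda>x::'a::complex_hilbert. c *\<^sub>C x)"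
  by (rule bounded_linear_intro[where K="cmod c"])
    (auto simp: scaleC_add_right norm_scaleC scaleC_scaleC mult.commute simp flip: scaleC_of_real)

lemmas tendsto_scaleC = bounded_linear.tendsto[OF bounded_linear_scaleC]

lemma scaleC_diff_right: "c *\<^sub>C ((x::'a::complex_hilbert) - y) = c *\<^sub>C x - c *\<^sub>C y"
  by (rule complex_vector.scale_right_diff_distrib)

text \<open>The common form of all density arguments below: a property that defines a closed complex
  subspace is checked on generators only.\<close>

lemma closed_csubspace_UNIV:
  fixes V :: "'a::complex_hilbert set"
  assumes "closed V" "complex_vector.subspace V" "G \<subseteq> V" "closure (cspan G) = UNIV"
  shows "V = UNIV"
proof -
  have "cspan G \<subseteq> V" using assms by (intro complex_vector.span_minimal)
  then have "closure (cspan G) \<subseteq> V" using assms(1) by (intro closure_minimal)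
  then show ?thesis using assms(4) by auto
qed

lemma orthogonal_dense_eq_0:
  fixes g :: "'a::complex_hilbert"
  assumes "\<And>f. f \<in> G \<Longrightarrow> cinner f g = 0" "closure (cspan G) = UNIV"
  shows "g = 0"
proof -
  have "{f. cinner f g = 0} = UNIV"
  proof (rule closed_csubspace_UNIV[OF _ _ _ assms(2)])
    show "closed {f. cinner f g = 0}"
      by (intro closed_Collect_eq continuous_on_cinner continuous_intros)
    show "complex_vector.subspace {f. cinner f g = 0}"
      by (auto simp: complex_vector.subspace_def cinner_add_left cinner_scaleC_left)
  qed (use assms in auto)
  then have "cinner g g = 0" by blast
  then show ?thesis by (simp add: cinner_self)
qed

lemma subspace_closure:
  fixes S :: "'a::real_normed_vector set"
  assumes "subspace S"
  shows "subspace (closure S)"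
  unfolding subspace_def
proof (intro conjI ballI allI)
  show "0 \<in> closure S" using subspace_0[OF assms] closure_subset by blast
next
  fix x y assume "x \<in> closure S" "y \<in> closure S"
  then obtain X Y where "\<And>n. X n \<in> S" "X \<longlonglongrightarrow> x" "\<And>n. Y n \<in> S" "Y \<longlonglongrightarrow> y"
    unfolding closure_sequential by blast
  then show "x + y \<in> closure S"
    unfolding closure_sequential using subspace_add[OF assms] tendsto_add
    by (intro exI[of _ "\<lambda>n. X n + Y n"]) auto
next
  fix c :: real and x assume "x \<in> closure S"
  then obtain X where "\<And>n. X n \<in> S" "X \<longlonglongrightarrow> x"
    unfolding closure_sequential by blast
  then show "c *\<^sub>R x \<in> closure S"
    unfolding closure_sequential using subspace_scale[OF assms]
    by (intro exI[of _ "\<lambda>n. c *\<^sub>R X n"]) (auto intro: tendsto_intros)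
qed

text \<open>The Lipschitz bound is asked for only eventually so that the lemma also serves
  \<open>at_right 0\<close>, where the operators are contractions for non-negative parameters
  only.\<close>

lemma tendsto_on_closure:
  fixes A :: "'i \<Rightarrow> 'a::real_normed_vector \<Rightarrow> 'b::real_normed_vector"
  assumes S: "w \<in> closure S"
    and lim: "\<And>v. v \<in> S \<Longrightarrow> ((\<lambda>i. A i v) \<longlongrightarrow> 0) F"
    and bd: "eventually (\<lambda>i. \<forall>x y. norm (A i x - A i y) \<le> K * norm (x - y)) F" and K: "K > 0"
  shows "((\<lambda>i. A i w) \<longlongrightarrow> 0) F"
proof (rule tendstoI)
  fix \<epsilon> :: real assume "\<epsilon> > 0"
  then obtain v where v: "v \<in> S" "dist v w < \<epsilon> / (2 * K)"
    using S K by (metis closure_approachable divide_pos_pos mult_pos_pos zero_less_numeral)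
  have *: "eventually (\<lambda>i. norm (A i v) < \<epsilon> / 2) F"
    using tendstoD[OF lim[OF v(1)], of "\<epsilon>/2"] \<open>\<epsilon> > 0\<close> by simp
  show "eventually (\<lambda>i. dist (A i w) 0 < \<epsilon>) F"
    using * bd
  proof eventually_elim
    case (elim i)
    have "norm (A i w - A i v) \<le> K * norm (w - v)" using elim by blast
    also have "\<dots> < \<epsilon> / 2" using v(2) K by (simp add: dist_norm norm_minus_commute field_simps)
    finally have "norm (A i w - A i v) < \<epsilon> / 2" .
    moreover have "norm (A i w) \<le> norm (A i w - A i v) + norm (A i v)" by (metis diff_add_cancel norm_triangle_ineq)
    ultimately show ?case using elim by simp
  qed
qed

section \<open>Square-integrable functions\<close>

lemma L2_real_measurable: "u \<in> L2_real \<Longrightarrow> u \<in> borel_measurable borel"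
  by (simp add: L2_real_def)

lemma L2_real_integrable: "u \<in> L2_real \<Longrightarrow> integrable lborel (\<lambda>s. (cmod (u s))\<^sup>2)"
  by (simp add: L2_real_def)

lemma L2_real_inner_integrable:
  assumes "u \<in> L2_real" "u' \<in> L2_real"
  shows "integrable lborel (\<lambda>s. u s * cnj (u' s))"
proof (rule Bochner_Integration.integrable_bound)
  show "integrable lborel (\<lambda>s. (cmod (u s))\<^sup>2 + (cmod (u' s))\<^sup>2)"
    using assms by (intro Bochner_Integration.integrable_add L2_real_integrable)
  show "(\<lambda>s. u s * cnj (u' s)) \<in> borel_measurable lborel"
    using assms[THEN L2_real_measurable]
    by (simp, intro borel_measurable_times borel_measurable_continuous_on[where f=cnj]) (auto intro!: continuous_intros)
  have "cmod (u s) * cmod (u' s) \<le> (cmod (u s))\<^sup>2 + (cmod (u' s))\<^sup>2" for s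
    using sum_squares_bound[of "cmod (u s)" "cmod (u' s)"]
      mult_nonneg_nonneg[OF norm_ge_zero[of "u s"] norm_ge_zero[of "u' s"]] by linarith
  then show "AE s in lborel. norm (u s * cnj (u' s)) \<le> norm ((cmod (u s))\<^sup>2 + (cmod (u' s))\<^sup>2)"
    by (simp add: norm_mult)
qed

lemma L2_real_add:
  assumes "u \<in> L2_real" "u' \<in> L2_real"
  shows "(\<lambda>s. u s + u' s) \<in> L2_real"
proof -
  have m: "(\<lambda>s. u s + u' s) \<in> borel_measurable borel" using assms[THEN L2_real_measurable] by simp
  have "integrable lborel (\<lambda>s. (cmod (u s + u' s))\<^sup>2)"
  proof (rule Bochner_Integration.integrable_bound)
    show "integrable lborel (\<lambda>s. 2 * (cmod (u s))\<^sup>2 + 2 * (cmod (u' s))\<^sup>2)"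
      using assms by (intro Bochner_Integration.integrable_add integrable_mult_right L2_real_integrable)
    show "(\<lambda>s. (cmod (u s + u' s))\<^sup>2) \<in> borel_measurable lborel" using m by simp
    have "(cmod (u s + u' s))\<^sup>2 \<le> 2 * (cmod (u s))\<^sup>2 + 2 * (cmod (u' s))\<^sup>2" for s
    proof -
      have "(cmod (u s + u' s))\<^sup>2 \<le> (cmod (u s) + cmod (u' s))\<^sup>2"
        by (intro power_mono norm_triangle_ineq) simp
      also have "\<dots> \<le> 2 * (cmod (u s))\<^sup>2 + 2 * (cmod (u' s))\<^sup>2"
        using sum_squares_bound[of "cmod (u s)" "cmod (u' s)"] by (simp add: power2_sum)
      finally show ?thesis .
    qed
    then show "AE s in lborel. norm ((cmod (u s + u' s))\<^sup>2) \<le> norm (2 * (cmod (u s))\<^sup>2 + 2 * (cmod (u' s))\<^sup>2)"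
      by simp
  qed
  with m show ?thesis by (simp add: L2_real_def)
qed

lemma L2_real_mult_bounded:
  assumes "u \<in> L2_real" "f \<in> borel_measurable borel" "\<And>s. cmod (f s) \<le> K"
  shows "(\<lambda>s. f s * u s) \<in> L2_real"
proof -
  have m: "(\<lambda>s. f s * u s) \<in> borel_measurable borel" using assms L2_real_measurable by simp
  have "integrable lborel (\<lambda>s. (cmod (f s * u s))\<^sup>2)"
  proof (rule Bochner_Integration.integrable_bound)
    show "integrable lborel (\<lambda>s. K\<^sup>2 * (cmod (u s))\<^sup>2)"
      using assms by (intro integrable_mult_right L2_real_integrable)
    show "(\<lambda>s. (cmod (f s * u s))\<^sup>2) \<in> borel_measurable lborel" using m by simp
    show "AE s in lborel. norm ((cmod (f s * u s))\<^sup>2) \<le> norm (K\<^sup>2 * (cmod (u s))\<^sup>2)"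
      using assms(3) by (auto simp: norm_mult power_mult_distrib intro!: mult_right_mono power_mono)
  qed
  with m show ?thesis by (simp add: L2_real_def)
qed

lemma L2_real_scale: "u \<in> L2_real \<Longrightarrow> (\<lambda>s. c * u s) \<in> L2_real"
  by (rule L2_real_mult_bounded[where K="cmod c"]) auto

lemma L2_real_mult_real:
  assumes "u \<in> L2_real" "\<phi> \<in> borel_measurable borel" "\<And>s. \<bar>\<phi> s\<bar> \<le> K"
  shows "(\<lambda>s. complex_of_real (\<phi> s) * u s) \<in> L2_real"
  using assms by (intro L2_real_mult_bounded[where K=K]) auto

lemma L2_real_diff:
  assumes "u \<in> L2_real" "u' \<in> L2_real" shows "(\<lambda>s. u s - u' s) \<in> L2_real"
  using L2_real_add[OF assms(1) L2_real_scale[OF assms(2), of "-1"]] by simp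

lemma L2_real_indicator: "(indicator {\<alpha>..<\<beta>} :: real \<Rightarrow> complex) \<in> L2_real"
proof -
  have "(\<lambda>s. (cmod (indicator {\<alpha>..<\<beta>} s))\<^sup>2) = indicat_real {\<alpha>..<\<beta>}"
    by (auto simp: indicator_def fun_eq_iff)
  moreover have "emeasure lborel {\<alpha>..<\<beta>} < \<infinity>"
    by (cases "\<alpha> \<le> \<beta>") auto
  ultimately show ?thesis by (simp add: L2_real_def integrable_real_indicator)
qed

section \<open>Multiplication operators in one coordinate\<close>

locale hilbert_tensor =
  fixes \<tau> :: "(real \<Rightarrow> complex) \<Rightarrow> 'g::complex_hilbert \<Rightarrow> 'h::complex_hilbert"
  assumes tensor_add_left: "\<And>u u' v. u \<in> L2_real \<Longrightarrow> u' \<in> L2_real \<Longrightarrow>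
      \<tau> (\<lambda>s. u s + u' s) v = \<tau> u v + \<tau> u' v"
    and tensor_scale_left: "\<And>u c v. u \<in> L2_real \<Longrightarrow> \<tau> (\<lambda>s. c * u s) v = c *\<^sub>C \<tau> u v"
    and cinner_tensor: "\<And>u u' v v'. u \<in> L2_real \<Longrightarrow> u' \<in> L2_real \<Longrightarrow>
      cinner (\<tau> u v) (\<tau> u' v') = (\<integral>s. u s * cnj (u' s) \<partial>lborel) * cinner v v'"
    and tensor_dense: "closure (cspan {\<tau> u v | u v. u \<in> L2_real}) = UNIV"
begin

definition mult_pairs :: "(real \<Rightarrow> real) \<Rightarrow> ('h \<times> 'h) set" where
  "mult_pairs \<phi> = {(\<tau> u v, \<tau> (\<lambda>s. complex_of_real (\<phi> s) * u s) v) | u v.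
       u \<in> L2_real \<and> (\<lambda>s. complex_of_real (\<phi> s) * u s) \<in> L2_real}"

lemma coord_mult_graph_eq: "coord_mult_graph \<tau> \<phi> = closure (span (mult_pairs \<phi>))"
  by (simp add: coord_mult_graph_def mult_pairs_def)

lemma tensor_diff_left:
  assumes "u \<in> L2_real" "u' \<in> L2_real"
  shows "\<tau> (\<lambda>s. u s - u' s) v = \<tau> u v - \<tau> u' v"
  using tensor_add_left[OF L2_real_diff[OF assms] assms(2), of v] by simp

lemma norm_tensor:
  assumes "u \<in> L2_real"
  shows "(norm (\<tau> u v))\<^sup>2 = (\<integral>s. (cmod (u s))\<^sup>2 \<partial>lborel) * (norm v)\<^sup>2"
proof -
  have "complex_of_real ((norm (\<tau> u v))\<^sup>2) = (\<integral>s. complex_of_real ((cmod (u s))\<^sup>2) \<partial>lborel) * of_real ((norm v)\<^sup>2)"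
    by (simp only: complex_norm_square[of "u _"] cinner_self[symmetric] cinner_tensor[OF assms assms, of v v])
  also have "\<dots> = of_real ((\<integral>s. (cmod (u s))\<^sup>2 \<partial>lborel) * (norm v)\<^sup>2)"
    by (simp only: integral_complex_of_real of_real_mult)
  finally show ?thesis using of_real_eq_iff by blast
qed

text \<open>Dominated convergence in \<open>L2_real\<close>; \<open>norm_tensor\<close> turns
  convergence in mean square of the first factor into convergence of the tensors.\<close>

lemma tendsto_tensor:
  assumes u: "\<And>n. U n \<in> L2_real" "u \<in> L2_real"
    and lim: "\<And>s. (\<lambda>n. U n s) \<longlonglongrightarrow> u s"
    and bd: "\<And>n s. cmod (U n s) \<le> cmod (w s)" and w: "w \<in> L2_real"
  shows "(\<lambda>n. \<tau> (U n) v) \<longlonglongrightarrow> \<tau> u v"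
proof -
  have bu: "cmod (u s) \<le> cmod (w s)" for s
    using tendsto_norm[OF lim[of s]] bd by (intro LIMSEQ_le_const2[where X="\<lambda>n. cmod (U n s)"]) auto
  have "(\<lambda>n. \<integral>s. (cmod (U n s - u s))\<^sup>2 \<partial>lborel) \<longlonglongrightarrow> (\<integral>s. 0 \<partial>(lborel :: real measure))"
  proof (rule integral_dominated_convergence[where w="\<lambda>s. 4 * (cmod (w s))\<^sup>2"])
    show "integrable lborel (\<lambda>s. 4 * (cmod (w s))\<^sup>2)"
      using w by (intro integrable_mult_right L2_real_integrable)
    show "(\<lambda>s. (cmod (U n s - u s))\<^sup>2) \<in> borel_measurable lborel" for n
      using L2_real_measurable[OF u(1)[of n]] L2_real_measurable[OF u(2)] by simp
    show "AE s in lborel. (\<lambda>n. (cmod (U n s - u s))\<^sup>2) \<longlonglongrightarrow> 0"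
    proof (rule AE_I2)
      fix s show "(\<lambda>n. (cmod (U n s - u s))\<^sup>2) \<longlonglongrightarrow> 0"
        using tendsto_power[OF tendsto_norm[OF tendsto_diff[OF lim[of s] tendsto_const[of "u s"]]], of 2]
        by simp
    qed
    \<comment> \<open>The factor 4 is the square of the 2 in the triangle inequality, both functions
      being dominated by \<open>w\<close>.\<close>
    have "(cmod (U n s - u s))\<^sup>2 \<le> 4 * (cmod (w s))\<^sup>2" for n s
    proof -
      have "cmod (U n s - u s) \<le> 2 * cmod (w s)"
        using norm_triangle_ineq4[of "U n s" "u s"] bd[of n s] bu[of s] by linarith
      then have "(cmod (U n s - u s))\<^sup>2 \<le> (2 * cmod (w s))\<^sup>2" by (intro power_mono) auto
      then show ?thesis by (simp add: power_mult_distrib)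
    qed
    then show "AE s in lborel. norm ((cmod (U n s - u s))\<^sup>2) \<le> 4 * (cmod (w s))\<^sup>2" for n by simp
  qed simp
  then have "(\<lambda>n. (\<integral>s. (cmod (U n s - u s))\<^sup>2 \<partial>lborel) * (norm v)\<^sup>2) \<longlonglongrightarrow> 0 * (norm v)\<^sup>2"
    by (intro tendsto_mult_right) simp
  then have "(\<lambda>n. sqrt ((norm (\<tau> (U n) v - \<tau> u v))\<^sup>2)) \<longlonglongrightarrow> sqrt 0"
    using u by (intro tendsto_real_sqrt)
      (simp add: tensor_diff_left[symmetric] norm_tensor L2_real_diff)
  then show ?thesis by (simp add: tendsto_norm_zero_iff LIM_zero_iff)
qed

section \<open>Graphs of multiplication operators: symmetry, closedness, single-valuedness\<close>

lemma cinner_mult_pairs_commute: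
  assumes "p \<in> mult_pairs \<phi>" "q \<in> mult_pairs \<phi>"
  shows "cinner (snd p) (fst q) = cinner (fst p) (snd q)"
  using assms by (auto simp: mult_pairs_def cinner_tensor mult_ac)

lemma subspace_cinner_commute:
  "subspace {p :: 'h \<times> 'h. cinner (snd p) a = cinner (fst p) b}"
  "subspace {p :: 'h \<times> 'h. cinner a (fst p) = cinner b (snd p)}"
  by (auto simp: subspace_def cinner_add_left cinner_scaleR_left cinner_add_right cinner_scaleR_right)

text \<open>Because \<open>\<phi>\<close> is real, generating pairs satisfy the relation. It is
  real-linear and continuous in each argument, so it passes to the closed span one argument at a
  time.\<close>

lemma coord_mult_graph_symmetric:
  assumes "p \<in> coord_mult_graph \<tau> \<phi>" "q \<in> coord_mult_graph \<tau> \<phi>"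
  shows "cinner (snd p) (fst q) = cinner (fst p) (snd q)"
proof -
  have 1: "cinner (snd p) (fst q) = cinner (fst p) (snd q)" if "p \<in> span (mult_pairs \<phi>)" "q \<in> mult_pairs \<phi>" for p q
    using that(1) by (rule span_induct[OF _ subspace_cinner_commute(1)])
      (use that in \<open>auto simp: cinner_mult_pairs_commute\<close>)
  have 2: "cinner (snd p) (fst q) = cinner (fst p) (snd q)" if "p \<in> span (mult_pairs \<phi>)" "q \<in> span (mult_pairs \<phi>)" for p q
    using that(2) by (rule span_induct[OF _ subspace_cinner_commute(2)])
      (use that 1 in \<open>auto\<close>)
  have 3: "cinner (snd p) (fst q) = cinner (fst p) (snd q)" if p: "p \<in> coord_mult_graph \<tau> \<phi>" and q: "q \<in> span (mult_pairs \<phi>)" for p q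
  proof -
    have "coord_mult_graph \<tau> \<phi> \<subseteq> {p. cinner (snd p) (fst q) = cinner (fst p) (snd q)}"
      unfolding coord_mult_graph_eq using 2 q
      by (intro closure_minimal closed_Collect_eq continuous_on_cinner continuous_intros) auto
    then show ?thesis using p by auto
  qed
  have "coord_mult_graph \<tau> \<phi> \<subseteq> {q. cinner (snd p) (fst q) = cinner (fst p) (snd q)}"
    using 3 assms(1) unfolding coord_mult_graph_eq[of \<phi>, symmetric]
    by (subst coord_mult_graph_eq, intro closure_minimal closed_Collect_eq continuous_on_cinner continuous_intros) auto
  then show ?thesis using assms by auto
qed

lemma subspace_coord_mult_graph: "subspace (coord_mult_graph \<tau> \<phi>)"
  unfolding coord_mult_graph_eq by (simp add: subspace_closure)

lemma closed_coord_mult_graph: "closed (coord_mult_graph \<tau> \<phi>)"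
  unfolding coord_mult_graph_eq by simp

lemma coord_mult_graph_add:
  "(f, g) \<in> coord_mult_graph \<tau> \<phi> \<Longrightarrow> (f', g') \<in> coord_mult_graph \<tau> \<phi> \<Longrightarrow> (f + f', g + g') \<in> coord_mult_graph \<tau> \<phi>"
  using subspace_add[OF subspace_coord_mult_graph, of "(f,g)" \<phi> "(f',g')"] by simp

lemma coord_mult_graph_diff:
  "(f, g) \<in> coord_mult_graph \<tau> \<phi> \<Longrightarrow> (f', g') \<in> coord_mult_graph \<tau> \<phi> \<Longrightarrow> (f - f', g - g') \<in> coord_mult_graph \<tau> \<phi>"
  using subspace_diff[OF subspace_coord_mult_graph, of "(f,g)" \<phi> "(f',g')"] by simp

lemma coord_mult_graph_scaleR:
  "(f, g) \<in> coord_mult_graph \<tau> \<phi> \<Longrightarrow> (r *\<^sub>R f, r *\<^sub>R g) \<in> coord_mult_graph \<tau> \<phi>"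
  using subspace_scale[OF subspace_coord_mult_graph, of "(f,g)" \<phi> r] by simp

lemma coord_mult_graph_tensor:
  "u \<in> L2_real \<Longrightarrow> (\<lambda>s. complex_of_real (\<phi> s) * u s) \<in> L2_real \<Longrightarrow>
   (\<tau> u v, \<tau> (\<lambda>s. complex_of_real (\<phi> s) * u s) v) \<in> coord_mult_graph \<tau> \<phi>"
  unfolding coord_mult_graph_eq
  by (intro closure_subset[THEN subsetD] span_base) (auto simp: mult_pairs_def)

lemma coord_mult_graph_limit:
  assumes "\<And>n. (F n, G n) \<in> coord_mult_graph \<tau> \<phi>" "F \<longlonglongrightarrow> f" "G \<longlonglongrightarrow> g"
  shows "(f, g) \<in> coord_mult_graph \<tau> \<phi>"
  by (rule closed_sequentially[OF closed_coord_mult_graph]) (use assms in \<open>auto intro: tendsto_Pair\<close>)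

text \<open>The graph is the closure of a real span, so its stability under complex scalars has to
  be derived; this is the transport principle for it, applied to
  \<open>A = scaleC c\<close>.\<close>

lemma coord_mult_graph_closed_map:
  assumes A: "bounded_linear A"
    and gen: "\<And>f g. (f, g) \<in> mult_pairs \<phi> \<Longrightarrow> (A f, A g) \<in> coord_mult_graph \<tau> \<phi>"
    and fg: "(f, g) \<in> coord_mult_graph \<tau> \<phi>"
  shows "(A f, A g) \<in> coord_mult_graph \<tau> \<phi>"
proof -
  interpret bounded_linear A by fact
  let ?S = "{p. (A (fst p), A (snd p)) \<in> coord_mult_graph \<tau> \<phi>}"
  have "subspace ?S"
    using subspace_coord_mult_graph[of \<phi>]
    using subspace_0[OF subspace_coord_mult_graph[of \<phi>]]
    unfolding subspace_def[of "Collect _"]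
    by (auto simp: zero add scaleR zero_prod_def intro: coord_mult_graph_add coord_mult_graph_scaleR)
  then have "span (mult_pairs \<phi>) \<subseteq> ?S"
    using gen by (intro span_minimal) auto
  moreover have "closed ?S"
  proof -
    have "closed ((\<lambda>p. (A (fst p), A (snd p))) -` coord_mult_graph \<tau> \<phi>)"
      by (intro closed_vimage closed_coord_mult_graph continuous_intros continuous_on)
    then show ?thesis by (simp add: vimage_def)
  qed
  ultimately have "coord_mult_graph \<tau> \<phi> \<subseteq> ?S"
    unfolding coord_mult_graph_eq[of \<phi>] by (metis closure_minimal)
  then show ?thesis using fg by auto
qed

lemma coord_mult_graph_scaleC:
  assumes "(f, g) \<in> coord_mult_graph \<tau> \<phi>"
  shows "(c *\<^sub>C f, c *\<^sub>C g) \<in> coord_mult_graph \<tau> \<phi>"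
proof (rule coord_mult_graph_closed_map[OF bounded_linear_scaleC _ assms])
  fix f g assume "(f, g) \<in> mult_pairs \<phi>"
  then obtain u v where uv: "f = \<tau> u v" "g = \<tau> (\<lambda>s. complex_of_real (\<phi> s) * u s) v"
    "u \<in> L2_real" "(\<lambda>s. complex_of_real (\<phi> s) * u s) \<in> L2_real" by (auto simp: mult_pairs_def)
  have "(\<lambda>s. complex_of_real (\<phi> s) * (c * u s)) \<in> L2_real"
    using L2_real_scale[OF uv(4), of c] by (simp add: mult_ac)
  from coord_mult_graph_tensor[OF L2_real_scale[OF uv(3), of c] this, of v]
  show "(c *\<^sub>C f, c *\<^sub>C g) \<in> coord_mult_graph \<tau> \<phi>"
    using uv tensor_scale_left[OF uv(4), of c v] by (simp add: tensor_scale_left mult_ac)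
qed

text \<open>Symmetry gives closability: a pair \<open>(0, h)\<close> of the graph forces
  \<open>h\<close> to be orthogonal to every tensor in the domain, and such tensors are
  dense.\<close>

lemma coord_mult_graph_unique:
  assumes \<phi>: "\<phi> \<in> borel_measurable borel"
    and "(f, g) \<in> coord_mult_graph \<tau> \<phi>" "(f, g') \<in> coord_mult_graph \<tau> \<phi>"
  shows "g = g'"
proof -
  have 0: "(0, g - g') \<in> coord_mult_graph \<tau> \<phi>" using coord_mult_graph_diff[OF assms(2,3)] by simp
  have "g - g' = 0"
  proof (rule orthogonal_dense_eq_0[OF _ tensor_dense])
    fix f assume "f \<in> {\<tau> u v | u v. u \<in> L2_real}"
    then obtain u v where uv: "f = \<tau> u v" "u \<in> L2_real" by blast
    \<comment> \<open>Cutting off where \<open>\<phi>\<close> exceeds \<open>n\<close> keeps the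
      product with \<open>\<phi>\<close> square-integrable, so \<open>\<tau> (U n) v\<close> lies in
      the domain even if \<open>\<phi>\<close> is unbounded.\<close>
    define U where "U n s = indicator {s. \<bar>\<phi> s\<bar> \<le> real n} s * u s" for n :: nat and s
    have meas: "(indicator {s. \<bar>\<phi> s\<bar> \<le> real n} :: real \<Rightarrow> complex) \<in> borel_measurable borel" for n
      using \<phi> by simp
    have U: "U n \<in> L2_real" for n
      unfolding U_def by (rule L2_real_mult_bounded[OF uv(2) meas, where K=1]) (auto simp: indicator_def)
    have \<phi>U: "(\<lambda>s. complex_of_real (\<phi> s) * U n s) \<in> L2_real" for n
    proof -
      have "(\<lambda>s. (complex_of_real (\<phi> s) * indicator {s. \<bar>\<phi> s\<bar> \<le> real n} s) * u s) \<in> L2_real"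
        using \<phi> by (intro L2_real_mult_bounded[OF uv(2), where K="real n"]) (auto simp: indicator_def)
      then show ?thesis by (simp add: U_def mult_ac)
    qed
    have orth: "cinner (\<tau> (U n) v) (g - g') = 0" for n
      using coord_mult_graph_symmetric[OF coord_mult_graph_tensor[OF U \<phi>U] 0] by simp
    have "(\<lambda>n. \<tau> (U n) v) \<longlonglongrightarrow> \<tau> u v"
    proof (rule tendsto_tensor[OF U uv(2) _ _ uv(2)])
      show "(\<lambda>n. U n s) \<longlonglongrightarrow> u s" for s
      proof (rule tendsto_eventually)
        obtain m :: nat where "\<bar>\<phi> s\<bar> \<le> real m" using real_arch_simple by blast
        then have "U n s = u s" if "n \<ge> m" for n using that by (auto simp: U_def)
        then show "\<forall>\<^sub>F n in sequentially. U n s = u s" using eventually_sequentially by blast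
      qed
    qed (auto simp: U_def indicator_def)
    then have "(\<lambda>n. cinner (\<tau> (U n) v) (g - g')) \<longlonglongrightarrow> cinner (\<tau> u v) (g - g')"
      by (intro tendsto_cinner tendsto_const)
    then have "cinner (\<tau> u v) (g - g') = 0" using orth by (simp add: LIMSEQ_const_iff)
    then show "cinner f (g - g') = 0" using uv by simp
  qed
  then show ?thesis by simp
qed

lemma coord_mult_eqI:
  "\<phi> \<in> borel_measurable borel \<Longrightarrow> (f, g) \<in> coord_mult_graph \<tau> \<phi> \<Longrightarrow> coord_mult \<tau> \<phi> f = g"
  unfolding coord_mult_def using coord_mult_graph_unique by blast

text \<open>For \<open>\<psi>\<^sup>2 = K\<^sup>2 - \<phi>\<^sup>2\<close> the multiplications by \<open>\<phi>\<close> and \<open>\<psi>\<close> satisfy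
  \<open>\<parallel>\<phi> f\<parallel>\<^sup>2 + \<parallel>\<psi> f\<parallel>\<^sup>2 = K\<^sup>2 \<parallel>f\<parallel>\<^sup>2\<close> on finite sums of tensors.\<close>

lemma norm_le_span_mult_pairs:
  assumes \<phi>: "\<phi> \<in> borel_measurable borel" "\<And>s. \<bar>\<phi> s\<bar> \<le> K"
    and fg: "(f, g) \<in> span (mult_pairs \<phi>)"
  shows "norm g \<le> K * norm f"
proof -
  have K0: "0 \<le> K" using \<phi>(2)[of 0] by linarith
  define \<psi> where "\<psi> s = sqrt (K\<^sup>2 - (\<phi> s)\<^sup>2)" for s
  have sq: "(\<phi> s)\<^sup>2 \<le> K\<^sup>2" for s using \<phi>(2)[of s] K0 by (metis abs_le_square_iff abs_of_nonneg)
  have \<psi>: "\<psi> \<in> borel_measurable borel" using \<phi>(1) by (simp add: \<psi>_def[abs_def])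
  have \<psi>2: "(\<psi> s)\<^sup>2 = K\<^sup>2 - (\<phi> s)\<^sup>2" for s using sq[of s] by (simp add: \<psi>_def)
  have \<psi>b: "\<bar>\<psi> s\<bar> \<le> K" for s
    by (rule power2_le_imp_le) (use \<psi>2[of s] K0 in auto)
  \<comment> \<open>A sum of tensors can be written in many ways. Triples carry both products along
    one common representation, so that the third component can play the part of
    \<open>\<psi> f\<close> before that operator is known to exist.\<close>
  let ?T = "{(\<tau> u v, \<tau> (\<lambda>s. complex_of_real (\<phi> s) * u s) v, \<tau> (\<lambda>s. complex_of_real (\<psi> s) * u s) v) | u v. u \<in> L2_real}"
  let ?P = "\<lambda>p q :: 'h \<times> 'h \<times> 'h. cinner (fst (snd p)) (fst (snd q)) + cinner (snd (snd p)) (snd (snd q))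
      = of_real (K\<^sup>2) * cinner (fst p) (fst q)"
  have T: "?P p q" if "p \<in> ?T" "q \<in> ?T" for p q
  proof -
    obtain u v u' v' where p: "p = (\<tau> u v, \<tau> (\<lambda>s. complex_of_real (\<phi> s) * u s) v, \<tau> (\<lambda>s. complex_of_real (\<psi> s) * u s) v)"
      and q: "q = (\<tau> u' v', \<tau> (\<lambda>s. complex_of_real (\<phi> s) * u' s) v', \<tau> (\<lambda>s. complex_of_real (\<psi> s) * u' s) v')"
      and u: "u \<in> L2_real" "u' \<in> L2_real" using \<open>p \<in> ?T\<close> \<open>q \<in> ?T\<close> by blast
    note L = L2_real_mult_real[OF _ \<phi>] L2_real_mult_real[OF _ \<psi> \<psi>b]
    have "(\<integral>s. (of_real (\<phi> s) * u s) * cnj (of_real (\<phi> s) * u' s) \<partial>lborel) +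
       (\<integral>s. (of_real (\<psi> s) * u s) * cnj (of_real (\<psi> s) * u' s) \<partial>lborel) =
       (\<integral>s. (of_real (\<phi> s) * u s) * cnj (of_real (\<phi> s) * u' s) +
         (of_real (\<psi> s) * u s) * cnj (of_real (\<psi> s) * u' s) \<partial>lborel)"
      using u L by (intro Bochner_Integration.integral_add[symmetric] L2_real_inner_integrable)
    also have "\<dots> = (\<integral>s. of_real (K\<^sup>2) * (u s * cnj (u' s)) \<partial>lborel)"
    proof (rule Bochner_Integration.integral_cong[OF refl])
      fix s
      have "(of_real (\<phi> s) * u s) * cnj (of_real (\<phi> s) * u' s) + (of_real (\<psi> s) * u s) * cnj (of_real (\<psi> s) * u' s)
         = of_real ((\<phi> s)\<^sup>2 + (\<psi> s)\<^sup>2) * (u s * cnj (u' s))"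
        by (simp add: algebra_simps power2_eq_square)
      then show "(of_real (\<phi> s) * u s) * cnj (of_real (\<phi> s) * u' s) + (of_real (\<psi> s) * u s) * cnj (of_real (\<psi> s) * u' s)
         = of_real (K\<^sup>2) * (u s * cnj (u' s))" by (simp add: \<psi>2)
    qed
    also have "\<dots> = of_real (K\<^sup>2) * (\<integral>s. u s * cnj (u' s) \<partial>lborel)" by simp
    finally show ?thesis using u L unfolding p q
      by (simp add: cinner_tensor distrib_right[symmetric] del: complex_cnj_mult of_real_power)
  qed
  have T1: "?P p q" if "p \<in> span ?T" "q \<in> ?T" for p q
  proof -
    have "subspace {p. ?P p q}"
      by (auto simp: subspace_def cinner_add_left cinner_scaleR_left algebra_simps) (simp_all add: distrib_left[symmetric])
    from span_induct[OF that(1) this] T[OF _ that(2)] show ?thesis by blast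
  qed
  have T2: "?P p q" if "p \<in> span ?T" "q \<in> span ?T" for p q
  proof -
    have "subspace {q. ?P p q}"
      by (auto simp: subspace_def cinner_add_right cinner_scaleR_right algebra_simps) (simp_all add: distrib_left[symmetric])
    from span_induct[OF that(2) this] T1[OF that(1)] show ?thesis by blast
  qed
  have "\<exists>h. (fst p, snd p, h) \<in> span ?T" if "p \<in> span (mult_pairs \<phi>)" for p
  proof (rule span_induct[OF that])
    show "subspace {p. \<exists>h. (fst p, snd p, h) \<in> span ?T}"
      unfolding subspace_def
    proof (safe, goal_cases)
      case 1 show ?case by (intro exI[of _ 0]) (simp add: zero_prod_def[symmetric] span_zero)
    next
      case (2 a b a' b' h h')
      then show ?case using span_add[of "(a,b,h)" ?T "(a',b',h')"] by auto
    next
      case (3 c a b h)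
      then show ?case using span_scale[of "(a,b,h)" ?T c] by auto
    qed
    fix p assume "p \<in> mult_pairs \<phi>"
    then obtain u v where uv: "p = (\<tau> u v, \<tau> (\<lambda>s. complex_of_real (\<phi> s) * u s) v)" "u \<in> L2_real"
      by (auto simp: mult_pairs_def)
    then show "\<exists>h. (fst p, snd p, h) \<in> span ?T"
      by (intro exI[of _ "\<tau> (\<lambda>s. complex_of_real (\<psi> s) * u s) v"] span_base) auto
  qed
  from this[OF fg] obtain h where h: "(f, g, h) \<in> span ?T" by auto
  have "complex_of_real ((norm g)\<^sup>2 + (norm h)\<^sup>2) = of_real (K\<^sup>2 * (norm f)\<^sup>2)"
    using T2[OF h h] by (simp add: cinner_self)
  then have "(norm g)\<^sup>2 + (norm h)\<^sup>2 = (K * norm f)\<^sup>2"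
    unfolding of_real_eq_iff by (simp add: power_mult_distrib)
  then have "(norm g)\<^sup>2 \<le> (K * norm f)\<^sup>2" using zero_le_power2[of "norm h"] by linarith
  then show ?thesis by (rule power2_le_imp_le) (use K0 in auto)
qed

section \<open>Bounded multipliers as operators on the whole space\<close>

lemma coord_mult_graph_bounded:
  assumes \<phi>: "\<phi> \<in> borel_measurable borel" "\<And>s. \<bar>\<phi> s\<bar> \<le> K"
    and fg: "(f, g) \<in> coord_mult_graph \<tau> \<phi>"
  shows "norm g \<le> K * norm f"
proof -
  have "coord_mult_graph \<tau> \<phi> \<subseteq> {p. norm (snd p) \<le> K * norm (fst p)}"
    unfolding coord_mult_graph_eq using norm_le_span_mult_pairs[OF \<phi>]
    by (intro closure_minimal closed_Collect_le continuous_intros) auto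
  then show ?thesis using fg by auto
qed

text \<open>The domain contains all tensors, so only its closedness is at stake; the norm bound
  makes the values Cauchy along a convergent sequence of arguments.\<close>

lemma coord_mult_graph_total:
  assumes \<phi>: "\<phi> \<in> borel_measurable borel" "\<And>s. \<bar>\<phi> s\<bar> \<le> K"
  shows "(f, coord_mult \<tau> \<phi> f) \<in> coord_mult_graph \<tau> \<phi>"
proof -
  let ?\<Gamma> = "coord_mult_graph \<tau> \<phi>"
  have "Domain ?\<Gamma> = UNIV"
  proof (rule closed_csubspace_UNIV[OF _ _ _ tensor_dense])
    show "{\<tau> u v |u v. u \<in> L2_real} \<subseteq> Domain ?\<Gamma>"
      using coord_mult_graph_tensor[OF _ L2_real_mult_real[OF _ \<phi>]] by blast
    show "complex_vector.subspace (Domain ?\<Gamma>)"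
      unfolding complex_vector.subspace_def
      using subspace_0[OF subspace_coord_mult_graph[of \<phi>]] coord_mult_graph_add coord_mult_graph_scaleC
      unfolding zero_prod_def by (safe; blast)
    show "closed (Domain ?\<Gamma>)"
      unfolding closed_sequential_limits
    proof safe
      fix F f assume F: "\<forall>n. F n \<in> Domain ?\<Gamma>" "F \<longlonglongrightarrow> f"
      then obtain G where G: "\<And>n. (F n, G n) \<in> ?\<Gamma>" by (meson Domain.cases)
      have K0: "0 \<le> K" using \<phi>(2)[of 0] by linarith
      \<comment> \<open>The constant \<open>K + 1\<close> instead of \<open>K\<close> allows
        division by it when \<open>K = 0\<close>.\<close>
      have d: "norm (G m - G n) \<le> (K + 1) * norm (F m - F n)" for m n
        using coord_mult_graph_bounded[OF \<phi> coord_mult_graph_diff[OF G G], of m n]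
        by (smt (verit, best) mult_right_mono norm_ge_zero)
      have "Cauchy G"
      proof (rule metric_CauchyI)
        fix \<epsilon> :: real assume "\<epsilon> > 0"
        with K0 obtain M where M: "\<And>m n. m \<ge> M \<Longrightarrow> n \<ge> M \<Longrightarrow> dist (F m) (F n) < \<epsilon> / (K + 1)"
          using metric_CauchyD[OF LIMSEQ_imp_Cauchy[OF F(2)], of "\<epsilon> / (K + 1)"] by auto
        have "dist (G m) (G n) < \<epsilon>" if "m \<ge> M" "n \<ge> M" for m n
          using d[of m n] M[OF that] K0 by (simp add: dist_norm field_simps)
        then show "\<exists>M. \<forall>m\<ge>M. \<forall>n\<ge>M. dist (G m) (G n) < \<epsilon>" by blast
      qed
      then obtain g where "G \<longlonglongrightarrow> g" using Cauchy_convergent convergent_def by blast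
      then show "f \<in> Domain ?\<Gamma>" using coord_mult_graph_limit[OF G F(2)] by blast
    qed
  qed
  then obtain g where "(f, g) \<in> ?\<Gamma>" by blast
  then show ?thesis using coord_mult_eqI[OF \<phi>(1)] by simp
qed

lemma norm_coord_mult:
  assumes \<phi>: "\<phi> \<in> borel_measurable borel" "\<And>s. \<bar>\<phi> s\<bar> \<le> K"
  shows "norm (coord_mult \<tau> \<phi> f) \<le> K * norm f"
  by (rule coord_mult_graph_bounded[OF \<phi> coord_mult_graph_total[OF \<phi>]])

lemma coord_mult_add:
  assumes \<phi>: "\<phi> \<in> borel_measurable borel" "\<And>s. \<bar>\<phi> s\<bar> \<le> K"
  shows "coord_mult \<tau> \<phi> (f + g) = coord_mult \<tau> \<phi> f + coord_mult \<tau> \<phi> g"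
  by (intro coord_mult_eqI coord_mult_graph_add coord_mult_graph_total[OF \<phi>] \<phi>)

lemma coord_mult_diff:
  assumes \<phi>: "\<phi> \<in> borel_measurable borel" "\<And>s. \<bar>\<phi> s\<bar> \<le> K"
  shows "coord_mult \<tau> \<phi> (f - g) = coord_mult \<tau> \<phi> f - coord_mult \<tau> \<phi> g"
  by (intro coord_mult_eqI coord_mult_graph_diff coord_mult_graph_total[OF \<phi>] \<phi>)

lemma coord_mult_scaleC:
  assumes \<phi>: "\<phi> \<in> borel_measurable borel" "\<And>s. \<bar>\<phi> s\<bar> \<le> K"
  shows "coord_mult \<tau> \<phi> (c *\<^sub>C f) = c *\<^sub>C coord_mult \<tau> \<phi> f"
  by (intro coord_mult_eqI coord_mult_graph_scaleC coord_mult_graph_total[OF \<phi>] \<phi>)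

lemma bounded_linear_coord_mult:
  assumes \<phi>: "\<phi> \<in> borel_measurable borel" "\<And>s. \<bar>\<phi> s\<bar> \<le> K"
  shows "bounded_linear (coord_mult \<tau> \<phi>)"
  by (rule bounded_linear_intro[where K=K])
    (use coord_mult_add[OF \<phi>] norm_coord_mult[OF \<phi>] coord_mult_scaleC[OF \<phi>] in
      \<open>auto simp: mult.commute simp flip: scaleC_of_real\<close>)

lemma coord_mult_tensor:
  assumes \<phi>: "\<phi> \<in> borel_measurable borel" "\<And>s. \<bar>\<phi> s\<bar> \<le> K" and u: "u \<in> L2_real"
  shows "coord_mult \<tau> \<phi> (\<tau> u v) = \<tau> (\<lambda>s. complex_of_real (\<phi> s) * u s) v"
  by (intro coord_mult_eqI coord_mult_graph_tensor \<phi> u L2_real_mult_real[OF _ \<phi>])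

lemma cinner_coord_mult:
  assumes \<phi>: "\<phi> \<in> borel_measurable borel" "\<And>s. \<bar>\<phi> s\<bar> \<le> K"
  shows "cinner (coord_mult \<tau> \<phi> f) g = cinner f (coord_mult \<tau> \<phi> g)"
  using coord_mult_graph_symmetric[OF coord_mult_graph_total[OF \<phi>] coord_mult_graph_total[OF \<phi>]] by simp

text \<open>Complex homogeneity is assumed separately because \<open>bounded_linear\<close> yields
  real linearity only, while the tensors are dense in the sense of a complex span.\<close>

lemma tensor_dense_eq:
  assumes A: "bounded_linear A" "\<And>c f. A (c *\<^sub>C f) = c *\<^sub>C A f"
    and B: "bounded_linear B" "\<And>c f. B (c *\<^sub>C f) = c *\<^sub>C B f"
    and eq: "\<And>u v. u \<in> L2_real \<Longrightarrow> A (\<tau> u v) = (B (\<tau> u v) :: 'k::complex_hilbert)"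
  shows "A = B"
proof -
  interpret A: bounded_linear A by fact
  interpret B: bounded_linear B by fact
  have "{f. A f = B f} = UNIV"
  proof (rule closed_csubspace_UNIV[OF _ _ _ tensor_dense])
    show "closed {f. A f = B f}"
      by (intro closed_Collect_eq A.continuous_on B.continuous_on continuous_intros)
    show "complex_vector.subspace {f. A f = B f}"
      by (auto simp: complex_vector.subspace_def A B A.zero B.zero A.add B.add)
  qed (use eq in auto)
  then show ?thesis by blast
qed

lemma coord_mult_coord_mult:
  assumes \<phi>: "\<phi> \<in> borel_measurable borel" "\<And>s. \<bar>\<phi> s\<bar> \<le> K"
    and \<psi>: "\<psi> \<in> borel_measurable borel" "\<And>s. \<bar>\<psi> s\<bar> \<le> L"
  shows "coord_mult \<tau> \<phi> (coord_mult \<tau> \<psi> f) = coord_mult \<tau> (\<lambda>s. \<phi> s * \<psi> s) f"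
proof -
  have m: "(\<lambda>s. \<phi> s * \<psi> s) \<in> borel_measurable borel" using \<phi>(1) \<psi>(1) by simp
  have b: "\<bar>\<phi> s * \<psi> s\<bar> \<le> K * L" for s
    unfolding abs_mult using \<phi>(2)[of s] \<psi>(2)[of s] by (intro mult_mono) linarith+
  have "(\<lambda>f. coord_mult \<tau> \<phi> (coord_mult \<tau> \<psi> f)) = coord_mult \<tau> (\<lambda>s. \<phi> s * \<psi> s)"
  proof (rule tensor_dense_eq)
    show "bounded_linear (\<lambda>f. coord_mult \<tau> \<phi> (coord_mult \<tau> \<psi> f))"
      by (intro bounded_linear_compose[OF bounded_linear_coord_mult[OF \<phi>] bounded_linear_coord_mult[OF \<psi>]])
    show "bounded_linear (coord_mult \<tau> (\<lambda>s. \<phi> s * \<psi> s))" by (rule bounded_linear_coord_mult[OF m b])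
  qed (simp_all add: coord_mult_scaleC[OF \<phi>] coord_mult_scaleC[OF \<psi>] coord_mult_scaleC[OF m b]
      coord_mult_tensor[OF \<phi>] coord_mult_tensor[OF \<psi>] coord_mult_tensor[OF m b] L2_real_mult_real[OF _ \<psi>] mult.assoc)
  from fun_cong[OF this, of f] show ?thesis by simp
qed

lemma coord_mult_one: "coord_mult \<tau> (\<lambda>_. 1) = (\<lambda>f. f)"
proof (rule tensor_dense_eq)
  show "bounded_linear (coord_mult \<tau> (\<lambda>_. 1))" by (rule bounded_linear_coord_mult[where K=1]) auto
  show "coord_mult \<tau> (\<lambda>_. 1) (c *\<^sub>C f) = c *\<^sub>C coord_mult \<tau> (\<lambda>_. 1) f" for c f
    by (rule coord_mult_scaleC[where K=1]) auto
  show "coord_mult \<tau> (\<lambda>_. 1) (\<tau> u v) = \<tau> u v" if "u \<in> L2_real" for u v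
    using coord_mult_tensor[of "\<lambda>_. 1" 1 u v] that by simp
qed (auto intro: bounded_linear_ident)

lemma coord_mult_linear_comb:
  assumes \<phi>: "\<phi> \<in> borel_measurable borel" "\<And>s. \<bar>\<phi> s\<bar> \<le> K"
    and \<psi>: "\<psi> \<in> borel_measurable borel" "\<And>s. \<bar>\<psi> s\<bar> \<le> L"
  shows "coord_mult \<tau> (\<lambda>s. \<phi> s + r * \<psi> s) f = coord_mult \<tau> \<phi> f + r *\<^sub>R coord_mult \<tau> \<psi> f"
proof -
  have m: "(\<lambda>s. \<phi> s + r * \<psi> s) \<in> borel_measurable borel" using \<phi>(1) \<psi>(1) by simp
  have b: "\<bar>\<phi> s + r * \<psi> s\<bar> \<le> K + \<bar>r\<bar> * L" for s
    using \<phi>(2)[of s] mult_left_mono[OF \<psi>(2)[of s], of "\<bar>r\<bar>"] abs_triangle_ineq[of "\<phi> s" "r * \<psi> s"]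
    by (simp add: abs_mult)
  have "coord_mult \<tau> (\<lambda>s. \<phi> s + r * \<psi> s) = (\<lambda>f. coord_mult \<tau> \<phi> f + r *\<^sub>R coord_mult \<tau> \<psi> f)"
  proof (rule tensor_dense_eq)
    show "bounded_linear (\<lambda>f. coord_mult \<tau> \<phi> f + r *\<^sub>R coord_mult \<tau> \<psi> f)"
      by (intro bounded_linear_add bounded_linear_const_scaleR
        bounded_linear_coord_mult[OF \<phi>] bounded_linear_coord_mult[OF \<psi>])
    show "bounded_linear (coord_mult \<tau> (\<lambda>s. \<phi> s + r * \<psi> s))" by (rule bounded_linear_coord_mult[OF m b])
    show "coord_mult \<tau> (\<lambda>s. \<phi> s + r * \<psi> s) (\<tau> u v) = coord_mult \<tau> \<phi> (\<tau> u v) + r *\<^sub>R coord_mult \<tau> \<psi> (\<tau> u v)"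
      if u: "u \<in> L2_real" for u v
    proof -
      note L = L2_real_mult_real[OF u \<phi>] L2_real_mult_real[OF u \<psi>]
      have "\<tau> (\<lambda>s. complex_of_real (\<phi> s) * u s + of_real r * (complex_of_real (\<psi> s) * u s)) v
        = \<tau> (\<lambda>s. complex_of_real (\<phi> s) * u s) v + r *\<^sub>R \<tau> (\<lambda>s. complex_of_real (\<psi> s) * u s) v"
        using L by (simp add: tensor_add_left L2_real_scale tensor_scale_left scaleC_of_real)
      then show ?thesis
        by (simp add: coord_mult_tensor[OF \<phi> u] coord_mult_tensor[OF \<psi> u] coord_mult_tensor[OF m b u] algebra_simps)
    qed
  qed (simp_all add: coord_mult_scaleC[OF \<phi>] coord_mult_scaleC[OF \<psi>] coord_mult_scaleC[OF m b]
      scaleC_add_right scaleC_scaleC mult.commute flip: scaleC_of_real)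
  from fun_cong[OF this, of f] show ?thesis by simp
qed

text \<open>Dominated convergence settles the tensors, and the uniform bound \<open>K\<close> on the
  operator norms extends the convergence to their closed span.\<close>

lemma tendsto_coord_mult:
  assumes \<Phi>: "\<And>n. \<Phi> n \<in> borel_measurable borel" "\<And>n s. \<bar>\<Phi> n s\<bar> \<le> K"
    and lim: "\<And>s. (\<lambda>n. \<Phi> n s) \<longlonglongrightarrow> \<phi> s"
  shows "(\<lambda>n. coord_mult \<tau> (\<Phi> n) f) \<longlonglongrightarrow> coord_mult \<tau> \<phi> f"
proof -
  have \<phi>m: "\<phi> \<in> borel_measurable borel" by (rule borel_measurable_LIMSEQ_real[OF lim \<Phi>(1)])
  have \<phi>b: "\<bar>\<phi> s\<bar> \<le> K" for s
    using tendsto_rabs[OF lim[of s]] \<Phi>(2) by (intro LIMSEQ_le_const2[where X="\<lambda>n. \<bar>\<Phi> n s\<bar>"]) auto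
  note \<phi> = \<phi>m \<phi>b
  have K0: "0 \<le> K" using \<phi>(2)[of 0] by linarith
  let ?A = "\<lambda>n f. coord_mult \<tau> (\<Phi> n) f - coord_mult \<tau> \<phi> f"
  let ?V = "{f. (\<lambda>n. ?A n f) \<longlonglongrightarrow> 0}"
  have "?V = UNIV"
  proof (rule closed_csubspace_UNIV[OF _ _ _ tensor_dense])
    have "closure ?V \<subseteq> ?V"
    proof (safe, rule tendsto_on_closure[where A="?A" and K="2 * K + 1"])
      have "norm (?A n x - ?A n y) \<le> (2 * K + 1) * norm (x - y)" for n x y
      proof -
        have "?A n x - ?A n y = ?A n (x - y)"
          by (simp add: coord_mult_diff[OF \<Phi>] coord_mult_diff[OF \<phi>])
        also have "norm \<dots> \<le> K * norm (x - y) + K * norm (x - y)"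
          by (rule order_trans[OF norm_triangle_ineq4 add_mono[OF norm_coord_mult[OF \<Phi>] norm_coord_mult[OF \<phi>]]])
        finally show ?thesis by (simp add: algebra_simps) (smt (verit) norm_ge_zero)
      qed
      then show "\<forall>\<^sub>F n in sequentially. \<forall>x y. norm (?A n x - ?A n y) \<le> (2 * K + 1) * norm (x - y)" by simp
      show "0 < 2 * K + 1" using K0 by simp
    qed auto
    then show "closed ?V" using closure_subset_eq by blast
    show "complex_vector.subspace ?V"
      unfolding complex_vector.subspace_def
    proof (safe, goal_cases)
      case 1
      have "coord_mult \<tau> (\<Phi> n) 0 = 0" "coord_mult \<tau> \<phi> 0 = 0" for n
        using norm_coord_mult[OF \<Phi>, of n 0] norm_coord_mult[OF \<phi>, of 0] by auto
      then show ?case by simp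
    next
      case (2 x y)
      from tendsto_add[OF this] show ?case
        by (simp add: coord_mult_add[OF \<Phi>] coord_mult_add[OF \<phi>] algebra_simps)
    next
      case (3 c x)
      from tendsto_scaleC[OF this, of c] show ?case
        by (simp add: coord_mult_scaleC[OF \<Phi>] coord_mult_scaleC[OF \<phi>] scaleC_diff_right)
    qed
    show "{\<tau> u v |u v. u \<in> L2_real} \<subseteq> ?V"
    proof (safe, goal_cases)
      case (1 f u v)
      have "(\<lambda>n. \<tau> (\<lambda>s. complex_of_real (\<Phi> n s) * u s) v) \<longlonglongrightarrow> \<tau> (\<lambda>s. complex_of_real (\<phi> s) * u s) v"
      proof (rule tendsto_tensor[where w="\<lambda>s. of_real K * u s"])
        show "cmod (complex_of_real (\<Phi> n s) * u s) \<le> cmod (complex_of_real K * u s)" for n s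
          using \<Phi>(2)[of n s] K0 by (auto simp: norm_mult intro!: mult_right_mono)
        show "(\<lambda>n. complex_of_real (\<Phi> n s) * u s) \<longlonglongrightarrow> complex_of_real (\<phi> s) * u s" for s
          by (intro tendsto_intros lim)
      qed (use 1 in \<open>auto intro: L2_real_mult_real[OF _ \<Phi>] L2_real_mult_real[OF _ \<phi>] L2_real_scale\<close>)
      then show ?case
        using 1 by (simp add: coord_mult_tensor[OF \<Phi>] coord_mult_tensor[OF \<phi>] LIM_zero_iff)
    qed
  qed
  then show ?thesis by (auto simp: LIM_zero_iff)
qed

text \<open>A factor \<open>\<psi>\<close> that tames \<open>\<phi>\<close> maps every vector into
  the domain of the unbounded multiplication. It is used with \<open>\<phi>\<close> the square and
  \<open>\<psi>\<close> a Gaussian; closedness of the graph carries it from tensors to all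
  vectors.\<close>

lemma coord_mult_unbounded:
  assumes \<phi>: "\<phi> \<in> borel_measurable borel"
    and \<psi>: "\<psi> \<in> borel_measurable borel" "\<And>s. \<bar>\<psi> s\<bar> \<le> K"
    and \<phi>\<psi>: "\<And>s. \<bar>\<phi> s * \<psi> s\<bar> \<le> L"
  shows "(coord_mult \<tau> \<psi> f, coord_mult \<tau> (\<lambda>s. \<phi> s * \<psi> s) f) \<in> coord_mult_graph \<tau> \<phi>"
proof -
  have m: "(\<lambda>s. \<phi> s * \<psi> s) \<in> borel_measurable borel" using \<phi> \<psi>(1) by simp
  let ?V = "{f. (coord_mult \<tau> \<psi> f, coord_mult \<tau> (\<lambda>s. \<phi> s * \<psi> s) f) \<in> coord_mult_graph \<tau> \<phi>}"
  interpret \<psi>: bounded_linear "coord_mult \<tau> \<psi>" by (rule bounded_linear_coord_mult[OF \<psi>])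
  interpret \<phi>\<psi>: bounded_linear "coord_mult \<tau> (\<lambda>s. \<phi> s * \<psi> s)" by (rule bounded_linear_coord_mult[OF m \<phi>\<psi>])
  have "?V = UNIV"
  proof (rule closed_csubspace_UNIV[OF _ _ _ tensor_dense])
    have "closed ((\<lambda>f. (coord_mult \<tau> \<psi> f, coord_mult \<tau> (\<lambda>s. \<phi> s * \<psi> s) f)) -` coord_mult_graph \<tau> \<phi>)"
      by (intro closed_vimage closed_coord_mult_graph continuous_intros \<psi>.continuous_on \<phi>\<psi>.continuous_on)
    then show "closed ?V" by (simp add: vimage_def)
    show "complex_vector.subspace ?V"
      using subspace_0[OF subspace_coord_mult_graph[of \<phi>]]
      by (auto simp: complex_vector.subspace_def \<psi>.zero \<phi>\<psi>.zero \<psi>.add \<phi>\<psi>.add zero_prod_def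
        coord_mult_scaleC[OF \<psi>] coord_mult_scaleC[OF m \<phi>\<psi>] intro: coord_mult_graph_add coord_mult_graph_scaleC)
    show "{\<tau> u v |u v. u \<in> L2_real} \<subseteq> ?V"
    proof (safe, goal_cases)
      case (1 f u v)
      have "(\<lambda>s. complex_of_real (\<phi> s) * (complex_of_real (\<psi> s) * u s)) \<in> L2_real"
        using L2_real_mult_real[OF 1 m \<phi>\<psi>] by (simp add: mult_ac)
      from coord_mult_graph_tensor[OF L2_real_mult_real[OF 1 \<psi>] this, of v] show ?case
        by (simp add: coord_mult_tensor[OF \<psi> 1] coord_mult_tensor[OF m \<phi>\<psi> 1] mult_ac)
    qed
  qed
  then show ?thesis by auto
qed

end

section \<open>Orthonormal bases\<close>

type_synonym box = "(nat \<Rightarrow> real) \<times> (nat \<Rightarrow> real)"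

locale hilbert_basis =
  fixes e :: "nat \<Rightarrow> 'a::{real_inner, complete_space}"
  assumes orthonormal_basis: "orthonormal_basis e"
begin

lemma inner_basis: "e i \<bullet> e j = (if i = j then 1 else 0)"
  using orthonormal_basis by (simp add: orthonormal_basis_def)

lemma norm_sum_basis:
  assumes "finite F"
  shows "(norm (\<Sum>j\<in>F. c j *\<^sub>R e j))\<^sup>2 = (\<Sum>j\<in>F. (c j)\<^sup>2)"
proof -
  have "(norm (\<Sum>j\<in>F. c j *\<^sub>R e j))\<^sup>2 = (\<Sum>i\<in>F. \<Sum>j\<in>F. c i * (c j * (e i \<bullet> e j)))"
    by (simp add: power2_norm_eq_inner inner_sum_left inner_sum_right sum_distrib_left inner_commute mult.left_commute)
  also have "\<dots> = (\<Sum>i\<in>F. (c i)\<^sup>2)"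
    using assms by (intro sum.cong refl) (simp add: inner_basis power2_eq_square if_distrib cong: if_cong)
  finally show ?thesis .
qed

lemma Bessel_finite:
  assumes "finite F"
  shows "(\<Sum>j\<in>F. (x \<bullet> e j)\<^sup>2) \<le> (norm x)\<^sup>2"
proof -
  let ?p = "\<Sum>j\<in>F. (x \<bullet> e j) *\<^sub>R e j"
  have xp: "x \<bullet> ?p = (\<Sum>j\<in>F. (x \<bullet> e j)\<^sup>2)"
    by (simp add: inner_sum_right power2_eq_square)
  have "0 \<le> (norm (x - ?p))\<^sup>2" by simp
  also have "\<dots> = (norm x)\<^sup>2 - 2 * (x \<bullet> ?p) + (norm ?p)\<^sup>2"
    by (simp add: power2_norm_eq_inner algebra_simps inner_commute)
  also have "\<dots> = (norm x)\<^sup>2 - (\<Sum>j\<in>F. (x \<bullet> e j)\<^sup>2)"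
    unfolding xp norm_sum_basis[OF assms] by simp
  finally show ?thesis by simp
qed

lemma Bessel_summable: "summable (\<lambda>j. (x \<bullet> e j)\<^sup>2)"
  by (rule bounded_imp_summable[of _ "(norm x)\<^sup>2"]) (auto intro: Bessel_finite)

lemma subspace_subspace_of: "subspace (subspace_of e J)"
  unfolding subspace_of_def by (intro subspace_closure subspace_span)

lemma subspace_of_UNIV: "subspace_of e UNIV = UNIV"
  using orthonormal_basis by (simp add: orthonormal_basis_def subspace_of_def)

text \<open>The splitting clause tests \<open>x - (x \<bullet> e k) *\<^sub>R e k\<close> for
  membership in a complementary block, so this projection must land in the space of those blocks. It
  is continuous and maps the span of the basis into the span of the remaining vectors.\<close>

lemma diff_coordinate_in_subspace_of:
  "x - (x \<bullet> e k) *\<^sub>R e k \<in> subspace_of e (UNIV - {k})"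
proof -
  let ?P = "\<lambda>x. x - (x \<bullet> e k) *\<^sub>R e k"
  have lin: "linear ?P"
    by (intro linearI) (simp_all add: algebra_simps)
  have "?P ` span (range e) = span (?P ` range e)"
    using linear_span_image[OF lin] by simp
  also have "\<dots> \<subseteq> span (e ` (UNIV - {k}))"
  proof (intro span_minimal subsetI)
    fix y assume "y \<in> ?P ` range e"
    then obtain i where y: "y = e i - (e i \<bullet> e k) *\<^sub>R e k" by auto
    show "y \<in> span (e ` (UNIV - {k}))"
      by (cases "i = k") (auto simp: y inner_basis span_zero intro: span_base)
  qed simp
  finally have *: "?P ` span (range e) \<subseteq> closure (span (e ` (UNIV - {k})))"
    using closure_subset by blast
  have "?P ` closure (span (range e)) \<subseteq> closure (span (e ` (UNIV - {k})))"
    by (rule image_closure_subset[OF _ _ *]) (intro continuous_intros, simp)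
  then show ?thesis
    using orthonormal_basis by (auto simp: orthonormal_basis_def subspace_of_def)
qed

lemma Riesz_Fischer:
  assumes "summable (\<lambda>j. (c j)\<^sup>2)"
  obtains x where "x \<in> subspace_of e J" "\<And>j. j \<in> J \<Longrightarrow> x \<bullet> e j = c j"
proof -
  define c' where "c' j = (if j \<in> J then c j else 0)" for j
  define s where "s n = (\<Sum>j<n. c' j *\<^sub>R e j)" for n :: nat
  have c'c: "(c' j)\<^sup>2 \<le> (c j)\<^sup>2" for j by (simp add: c'_def)
  have sum': "summable (\<lambda>j. (c' j)\<^sup>2)"
    by (rule summable_comparison_test[OF _ assms]) (use c'c in auto)
  have "Cauchy s"
  proof (rule metric_CauchyI)
    fix \<epsilon> :: real assume "\<epsilon> > 0"
    then obtain N where N: "\<And>m n. m \<ge> N \<Longrightarrow> norm (\<Sum>j=m..<n. (c' j)\<^sup>2) < \<epsilon>\<^sup>2"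
      using sum' unfolding summable_Cauchy by (meson zero_less_power)
    have *: "dist (s n) (s m) < \<epsilon>" if "m \<ge> N" "m \<le> n" for m n
    proof -
      have "s n - s m = (\<Sum>j=m..<n. c' j *\<^sub>R e j)"
        using that by (simp add: s_def lessThan_atLeast0 sum_diff_nat_ivl)
      then have "(norm (s n - s m))\<^sup>2 = (\<Sum>j=m..<n. (c' j)\<^sup>2)"
        by (simp add: norm_sum_basis)
      also have "\<dots> < \<epsilon>\<^sup>2" using N[OF that(1), of n] by simp
      finally show ?thesis using \<open>\<epsilon> > 0\<close> by (simp add: dist_norm power2_less_imp_less)
    qed
    have "dist (s m) (s n) < \<epsilon>" if "m \<ge> N" "n \<ge> N" for m n
      using *[of m n] *[of n m] that by (cases "m \<le> n") (auto simp: dist_commute)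
    then show "\<exists>M. \<forall>m\<ge>M. \<forall>n\<ge>M. dist (s m) (s n) < \<epsilon>" by blast
  qed
  then obtain x where x: "s \<longlonglongrightarrow> x" using Cauchy_convergent convergent_def by blast
  show ?thesis
  proof
    have "s n \<in> span (e ` J)" for n
      unfolding s_def by (rule span_sum) (auto simp: c'_def span_zero intro: span_base span_scale)
    then show "x \<in> subspace_of e J"
      unfolding subspace_of_def closure_sequential using x by blast
    fix j assume j: "j \<in> J"
    have "(\<lambda>n. s n \<bullet> e j) \<longlonglongrightarrow> x \<bullet> e j" by (intro tendsto_inner x tendsto_const)
    moreover have "(\<lambda>n. s n \<bullet> e j) \<longlonglongrightarrow> c j"
    proof (rule tendsto_eventually)
      have "s n \<bullet> e j = c j" if "n > j" for n
        using that j by (simp add: s_def inner_sum_left inner_basis if_distrib cong: if_cong) (simp add: c'_def)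
      then show "\<forall>\<^sub>F n in sequentially. s n \<bullet> e j = c j"
        by (rule eventually_mono[OF eventually_gt_at_top[of j]])
    qed
    ultimately show "x \<bullet> e j = c j" by (rule LIMSEQ_unique)
  qed
qed

section \<open>The finitely additive measure on the ring of blocks\<close>

definition box_block :: "nat set \<Rightarrow> box \<Rightarrow> 'a set" where
  "box_block J p = block e J (fst p) (snd p)"

definition box_measure :: "nat set \<Rightarrow> box \<Rightarrow> real" where
  "box_measure J p = block_measure e J (fst p) (snd p)"

definition box_inter ::
    "box \<Rightarrow> box \<Rightarrow> box" where
  "box_inter p q = (\<lambda>j. max (fst p j) (fst q j), \<lambda>j. min (snd p j) (snd q j))"

text \<open>Dropping the condition \<open>a j < b j\<close> of \<open>abs_measurable\<close> makes
  the family closed under \<open>box_inter\<close>, whose edges may degenerate.\<close>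

definition good_box :: "nat set \<Rightarrow> box \<Rightarrow> bool" where
  "good_box J p \<longleftrightarrow> bounded (fst p ` J) \<and> bounded (snd p ` J) \<and>
     (box_block J p \<noteq> {} \<longrightarrow> (\<lambda>j. max 0 (ln (snd p j - fst p j))) summable_on J)"

text \<open>The neutral value 1 outside \<open>J\<close> lets all products run over initial segments
  of the natural numbers, whatever \<open>J\<close> is.\<close>

definition edge :: "nat set \<Rightarrow> box \<Rightarrow> nat \<Rightarrow> real" where
  "edge J p j = (if j \<in> J then snd p j - fst p j else 1)"

lemma box_inter_simps:
  "box_inter p p = p" "box_inter (box_inter p q) r = box_inter (box_inter p r) q"
  by (auto simp: box_inter_def fun_eq_iff max_def min_def)

lemma box_block_inter: "box_block J (box_inter p q) = box_block J p \<inter> box_block J q"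
  by (auto simp: box_block_def block_def box_inter_def)

lemma box_block_edge_pos: "box_block J p \<noteq> {} \<Longrightarrow> edge J p j > 0"
  by (force simp: box_block_def block_def edge_def)

lemma box_block_edge_inter_le: "edge J (box_inter q p) j \<le> edge J p j"
  by (auto simp: edge_def box_inter_def)

lemma good_box_subbox:
  assumes p: "good_box J p" and q: "bounded (fst q ` J)" "bounded (snd q ` J)"
    and le: "\<And>j. j \<in> J \<Longrightarrow> fst p j \<le> fst q j" "\<And>j. j \<in> J \<Longrightarrow> snd q j \<le> snd p j"
  shows "good_box J q"
proof -
  have sub: "box_block J q \<subseteq> box_block J p"
    using le by (force simp: box_block_def block_def)
  have "(\<lambda>j. max 0 (ln (snd q j - fst q j))) summable_on J" if ne: "box_block J q \<noteq> {}"
  proof (rule summable_on_comparison_test)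
    show "(\<lambda>j. max 0 (ln (snd p j - fst p j))) summable_on J"
      using ne p sub by (auto simp: good_box_def)
    fix j assume j: "j \<in> J"
    have "0 < snd q j - fst q j" "snd q j - fst q j \<le> snd p j - fst p j"
      using box_block_edge_pos[OF ne, of j] le[OF j] j by (auto simp: edge_def)
    then have "ln (snd q j - fst q j) \<le> ln (snd p j - fst p j)" by simp
    then show "max 0 (ln (snd q j - fst q j)) \<le> max 0 (ln (snd p j - fst p j))" by simp
  qed simp
  then show ?thesis using q by (simp add: good_box_def)
qed

lemma good_box_inter:
  assumes "good_box J p" "good_box J q"
  shows "good_box J (box_inter p q)"
proof (rule good_box_subbox[OF assms(1)])
  obtain K where K: "\<And>j. j \<in> J \<Longrightarrow> \<bar>fst p j\<bar> \<le> K" using assms(1) by (auto simp: good_box_def bounded_iff)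
  obtain K' where K': "\<And>j. j \<in> J \<Longrightarrow> \<bar>fst q j\<bar> \<le> K'" using assms(2) by (auto simp: good_box_def bounded_iff)
  obtain L where L: "\<And>j. j \<in> J \<Longrightarrow> \<bar>snd p j\<bar> \<le> L" using assms(1) by (auto simp: good_box_def bounded_iff)
  obtain L' where L': "\<And>j. j \<in> J \<Longrightarrow> \<bar>snd q j\<bar> \<le> L'" using assms(2) by (auto simp: good_box_def bounded_iff)
  show "bounded (fst (box_inter p q) ` J)"
    unfolding bounded_iff using K K' by (intro exI[of _ "max K K'"]) (force simp: box_inter_def max_def)
  show "bounded (snd (box_inter p q) ` J)"
    unfolding bounded_iff using L L' by (intro exI[of _ "max L L'"]) (force simp: box_inter_def max_def min_def)
qed (auto simp: box_inter_def)

lemma prod_edge: "(\<Prod>j\<in>{j\<in>J. j < n}. snd p j - fst p j) = (\<Prod>j<n. edge J p j)"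
proof -
  have "(\<Prod>j<n. edge J p j) = (\<Prod>j\<in>{..<n} \<inter> J. snd p j - fst p j)"
    unfolding edge_def by (subst prod.inter_restrict) auto
  also have "{..<n} \<inter> J = {j\<in>J. j < n}" by auto
  finally show ?thesis by simp
qed

text \<open>Each factor is split as \<open>max 1 x * min 1 x\<close>. The first product converges as
  the exponential of a summable series; the second decreases and is bounded below, possibly to
  0.\<close>

lemma box_measure_limit:
  assumes p: "good_box J p" and ne: "box_block J p \<noteq> {}"
  shows "(\<lambda>n. \<Prod>j<n. edge J p j) \<longlonglongrightarrow> box_measure J p"
proof -
  note pos = box_block_edge_pos[OF ne]
  have "(\<lambda>j. max 0 (ln (snd p j - fst p j))) summable_on J"
    using p ne by (simp add: good_box_def)
  then have "(\<lambda>j. max 0 (ln (edge J p j))) summable_on UNIV"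
    by (subst summable_on_cong_neutral[where T=J and g="\<lambda>j. max 0 (ln (snd p j - fst p j))"])
      (auto simp: edge_def)
  then have "summable (\<lambda>j. max 0 (ln (edge J p j)))" by (rule summable_on_imp_summable)
  then have "convergent (\<lambda>n. \<Sum>j<n. max 0 (ln (edge J p j)))" by (simp add: summable_iff_convergent)
  then have "convergent (\<lambda>n. exp (\<Sum>j<n. max 0 (ln (edge J p j))))"
    unfolding convergent_def by (metis tendsto_exp)
  moreover have "exp (\<Sum>j<n. max 0 (ln (edge J p j))) = (\<Prod>j<n. max 1 (edge J p j))" for n
  proof -
    have "exp (max 0 (ln (edge J p j))) = max 1 (edge J p j)" for j
      using pos[of j] by (auto simp: max_def not_le ln_ge_zero_iff)
    then show ?thesis by (simp add: exp_sum)
  qed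
  ultimately have c1: "convergent (\<lambda>n. \<Prod>j<n. max 1 (edge J p j))" by simp
  have "decseq (\<lambda>n. \<Prod>j<n. min 1 (edge J p j))"
    unfolding decseq_Suc_iff using pos less_imp_le[OF pos]
    by (auto intro!: mult_left_le prod_nonneg)
  moreover have "0 \<le> (\<Prod>j<n. min 1 (edge J p j))" for n
    using less_imp_le[OF pos] by (intro prod_nonneg) auto
  ultimately have c2: "convergent (\<lambda>n. \<Prod>j<n. min 1 (edge J p j))"
    using decseq_convergent unfolding convergent_def by metis
  have "(\<Prod>j<n. edge J p j) = (\<Prod>j<n. max 1 (edge J p j)) * (\<Prod>j<n. min 1 (edge J p j))" for n
    unfolding prod.distrib[symmetric] by (intro prod.cong refl) (auto simp: max_def min_def)
  with convergent_mult[OF c1 c2] have "convergent (\<lambda>n. \<Prod>j<n. edge J p j)" by simp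
  then show ?thesis
    using ne by (simp add: convergent_LIMSEQ_iff box_measure_def block_measure_def box_block_def prod_edge)
qed

lemma box_measure_empty: "box_block J p = {} \<Longrightarrow> box_measure J p = 0"
  by (simp add: box_measure_def block_measure_def box_block_def)

lemma box_measure_nonneg: "good_box J p \<Longrightarrow> 0 \<le> box_measure J p"
proof (cases "box_block J p = {}")
  case False
  assume "good_box J p"
  have "0 \<le> (\<Prod>j<n. edge J p j)" for n
    using less_imp_le[OF box_block_edge_pos[OF False]] by (intro prod_nonneg) auto
  then show ?thesis using LIMSEQ_le_const[OF box_measure_limit[OF \<open>good_box J p\<close> False]] by blast
qed (simp add: box_measure_empty)

lemma box_measure_inter_le:
  assumes "good_box J p" "good_box J q"
  shows "box_measure J (box_inter q p) \<le> box_measure J p"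
proof (cases "box_block J (box_inter q p) = {}")
  case False
  then have ne: "box_block J p \<noteq> {}" by (auto simp: box_block_inter)
  show ?thesis
  proof (rule LIMSEQ_le[OF box_measure_limit[OF good_box_inter False] box_measure_limit[OF _ ne]])
    show "\<exists>N. \<forall>n\<ge>N. (\<Prod>j<n. edge J (box_inter q p) j) \<le> (\<Prod>j<n. edge J p j)"
      using less_imp_le[OF box_block_edge_pos[OF False]] box_block_edge_inter_le
      by (intro exI[of _ 0] allI impI prod_mono conjI) auto
  qed (use assms in auto)
qed (simp add: box_measure_empty box_measure_nonneg assms)

text \<open>A block which meets \<open>\<ell>\<^sub>2\<close> is controlled there by any of its points. Clamping the tail of an
  arbitrary sequence by such points thus yields an element of \<open>\<ell>\<^sub>2\<close> in the same blocks.\<close>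

lemma square_summable_representative:
  assumes Q: "finite Q" "\<And>q. q \<in> Q \<Longrightarrow> box_block J q \<noteq> {}"
  obtains x where "x \<in> subspace_of e J"
    "\<And>q. q \<in> Q \<Longrightarrow> x \<in> box_block J q \<longleftrightarrow> (\<forall>j\<in>J. fst q j \<le> y j \<and> y j < snd q j)"
proof -
  have "\<forall>q\<in>Q. \<exists>x. x \<in> box_block J q" using Q(2) by blast
  then obtain P where P: "\<And>q. q \<in> Q \<Longrightarrow> P q \<in> box_block J q" by metis
  \<comment> \<open>\<open>M\<close> dominates the coordinates of all chosen points and is still
    square-summable because \<open>Q\<close> is finite.\<close>
  define M where "M j = sqrt (\<Sum>q\<in>Q. (P q \<bullet> e j)\<^sup>2)" for j
  have M2: "(M j)\<^sup>2 = (\<Sum>q\<in>Q. (P q \<bullet> e j)\<^sup>2)" for j by (simp add: M_def sum_nonneg)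
  have M0: "0 \<le> M j" for j by (simp add: M_def sum_nonneg)
  have PM: "\<bar>P q \<bullet> e j\<bar> \<le> M j" if "q \<in> Q" for q j
    by (rule power2_le_imp_le) (use that Q(1) M0 in \<open>auto simp: M2 intro: member_le_sum\<close>)
  define bad where "bad q = (SOME j. j \<in> J \<and> \<not> (fst q j \<le> y j \<and> y j < snd q j))"
    for q :: "box"
  have bad: "bad q \<in> J \<and> \<not> (fst q (bad q) \<le> y (bad q) \<and> y (bad q) < snd q (bad q))"
    if "j \<in> J" "\<not> (fst q j \<le> y j \<and> y j < snd q j)" for q j
    unfolding bad_def by (rule someI[of _ j]) (use that in blast)
  \<comment> \<open>Below \<open>N\<close> the sequence is kept, so a box that \<open>y\<close>
    misses is still missed at the coordinate \<open>bad q\<close>. From \<open>N\<close> on,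
    clamping to the range between \<open>- M j\<close> and \<open>M j\<close> cannot leave an edge
    that contains both \<open>y j\<close> and a point of that range.\<close>
  obtain N where N: "\<And>q. q \<in> Q \<Longrightarrow> bad q < N"
    using Q(1) finite_nat_set_iff_bounded[of "bad ` Q"] by auto
  define c where "c j = (if j < N then y j else max (- M j) (min (y j) (M j)))" for j
  have "summable (\<lambda>j. (M j)\<^sup>2)" unfolding M2 by (intro summable_sum Bessel_summable)
  moreover have "(c j)\<^sup>2 \<le> (M j)\<^sup>2" if "j \<ge> N" for j
    using that M0[of j] by (intro power2_mono) (auto simp: c_def)
  ultimately have "summable (\<lambda>j. (c j)\<^sup>2)"
    by (intro summable_comparison_test[of "\<lambda>j. (c j)\<^sup>2" "\<lambda>j. (M j)\<^sup>2"]) (auto intro!: exI[of _ N])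
  then obtain x where x: "x \<in> subspace_of e J" "\<And>j. j \<in> J \<Longrightarrow> x \<bullet> e j = c j"
    using Riesz_Fischer by metis
  show thesis
  proof
    fix q assume q: "q \<in> Q"
    show "x \<in> box_block J q \<longleftrightarrow> (\<forall>j\<in>J. fst q j \<le> y j \<and> y j < snd q j)"
    proof
      assume *: "\<forall>j\<in>J. fst q j \<le> y j \<and> y j < snd q j"
      have "fst q j \<le> c j \<and> c j < snd q j" if j: "j \<in> J" for j
      proof -
        have "fst q j \<le> y j" "y j < snd q j" using * j by auto
        moreover have "fst q j \<le> P q \<bullet> e j" "P q \<bullet> e j < snd q j"
          using P[OF q] j by (auto simp: box_block_def block_def)
        ultimately show ?thesis using PM[OF q, of j] by (auto simp: c_def max_def min_def)
      qed
      then show "x \<in> box_block J q" using x by (auto simp: box_block_def block_def)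
    next
      assume *: "x \<in> box_block J q"
      show "\<forall>j\<in>J. fst q j \<le> y j \<and> y j < snd q j"
      proof (rule ccontr)
        assume "\<not> ?thesis"
        then have b: "bad q \<in> J" "\<not> (fst q (bad q) \<le> y (bad q) \<and> y (bad q) < snd q (bad q))"
          using bad by blast+
        have "x \<bullet> e (bad q) = y (bad q)" using x(2)[OF b(1)] N[OF q] by (simp add: c_def)
        then show False using * b by (auto simp: box_block_def block_def)
      qed
    qed
  qed (rule x)
qed

section \<open>Boxes inside a fixed box as events of a product probability space\<close>

abbreviation unit_cube :: "(nat \<Rightarrow> real) measure" where
  "unit_cube \<equiv> Pi\<^sub>M UNIV (\<lambda>_. uniform_measure lborel {0..<1})"

text \<open>The pullback of \<open>q\<close> along the affine map from the unit cube to
  \<open>p\<close>. It consists of arbitrary sequences, since the product measure does not live on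
  square-summable ones.\<close>

definition cube_part :: "nat set \<Rightarrow> box \<Rightarrow> box \<Rightarrow> (nat \<Rightarrow> real) set" where
  "cube_part J p q = {u. \<forall>j\<in>J. fst q j \<le> fst p j + (snd p j - fst p j) * u j \<and>
      fst p j + (snd p j - fst p j) * u j < snd q j}"

lemma prob_space_unit_interval: "prob_space (uniform_measure lborel {0..<1::real})"
  by (rule prob_space_uniform_measure) auto

lemma prob_space_unit_cube: "prob_space unit_cube"
  by (intro prob_space_PiM prob_space_unit_interval)

text \<open>Both quantities are limits of products of ratios of edges. Positivity of the measure of
  \<open>p\<close> permits the division of the two limits.\<close>

lemma measure_cube_part:
  assumes p: "good_box J p" and q: "good_box J q"
    and pos: "box_measure J p > 0" and ne: "box_block J (box_inter q p) \<noteq> {}"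
  shows "cube_part J p (box_inter q p) \<in> sets unit_cube"
    and "box_measure J (box_inter q p) = box_measure J p * measure unit_cube (cube_part J p (box_inter q p))"
proof -
  let ?r = "box_inter q p" and ?U = "uniform_measure lborel {0..<1::real}"
  interpret U: prob_space ?U by (rule prob_space_unit_interval)
  interpret S: sequence_space ?U by unfold_locales
  define E where "E j = (if j \<in> J then {(fst ?r j - fst p j) / edge J p j ..< (snd ?r j - fst p j) / edge J p j} else UNIV)" for j
  have nep: "box_block J p \<noteq> {}" using ne by (auto simp: box_block_inter)
  note ep = box_block_edge_pos[OF nep] and er = box_block_edge_pos[OF ne]
  have Es: "E j \<in> sets ?U" for j by (simp add: E_def)
  have eq: "cube_part J p ?r = Pi UNIV E"
  proof -
    have "(fst ?r j \<le> fst p j + (snd p j - fst p j) * s \<and> fst p j + (snd p j - fst p j) * s < snd ?r j) \<longleftrightarrow> s \<in> E j"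
      if "j \<in> J" for j s
      using that ep[of j] by (simp add: E_def edge_def field_simps)
    then show ?thesis by (auto simp: cube_part_def Pi_def E_def)
  qed
  show "cube_part J p ?r \<in> sets unit_cube"
    unfolding eq by (rule S.infprod_in_sets[OF Es])
  have mE: "measure ?U (E j) = edge J ?r j / edge J p j" for j
  proof (cases "j \<in> J")
    case True
    let ?l = "(fst ?r j - fst p j) / edge J p j" and ?u = "(snd ?r j - fst p j) / edge J p j"
    have "fst p j \<le> fst ?r j" "snd ?r j \<le> snd p j" by (auto simp: box_inter_def)
    then have l: "0 \<le> ?l" "?u \<le> 1" using ep[of j] True by (auto simp: edge_def field_simps)
    have "?u - ?l = edge J ?r j / edge J p j" using True by (simp add: edge_def diff_divide_distrib[symmetric])
    then have lu: "?l \<le> ?u" using divide_pos_pos[OF er[of j] ep[of j]] by linarith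
    have "measure ?U (E j) = measure lborel ({0..<1} \<inter> {?l..<?u}) / measure lborel {0..<1::real}"
      using True by (subst measure_uniform_measure) (auto simp: E_def)
    also have "{0..<1} \<inter> {?l..<?u} = {?l..<?u}" using l by auto
    finally show ?thesis using lu \<open>?u - ?l = _\<close> by simp
  next
    case False
    then show ?thesis using U.prob_space by (simp add: E_def edge_def)
  qed
  have "(\<lambda>n. \<Prod>i\<le>n. measure ?U (E i)) \<longlonglongrightarrow> measure unit_cube (Pi UNIV E)"
    by (rule S.measure_PiM_countable[OF Es])
  moreover have "(\<lambda>n. \<Prod>i\<le>n. measure ?U (E i)) \<longlonglongrightarrow> box_measure J ?r / box_measure J p"
  proof -
    have "(\<lambda>n. (\<Prod>j<n. edge J ?r j) / (\<Prod>j<n. edge J p j)) \<longlonglongrightarrow> box_measure J ?r / box_measure J p"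
      using pos by (intro tendsto_divide box_measure_limit good_box_inter p q ne nep) auto
    \<comment> \<open>The shift reconciles products over \<open>j < n\<close> with the products over
      \<open>i \<le> n\<close> of the infinite product measure.\<close>
    from LIMSEQ_Suc[OF this] show ?thesis
      by (simp add: mE prod_dividef lessThan_Suc_atMost)
  qed
  ultimately have "measure unit_cube (Pi UNIV E) = box_measure J ?r / box_measure J p"
    by (rule LIMSEQ_unique)
  then show "box_measure J ?r = box_measure J p * measure unit_cube (cube_part J p ?r)"
    using pos by (simp add: eq)
qed

text \<open>Linear combinations of indicators are kept formal, because only \<open>comb_measure_nonneg\<close> below
  shows that the function determines the measure.\<close>

definition comb_value :: "nat set \<Rightarrow> (real \<times> box) list \<Rightarrow> 'a \<Rightarrow> real" where
  "comb_value J F x = (\<Sum>(c, q)\<leftarrow>F. c * indicator (box_block J q) x)"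

definition comb_measure :: "nat set \<Rightarrow> (real \<times> box) list \<Rightarrow> real" where
  "comb_measure J F = (\<Sum>(c, q)\<leftarrow>F. c * box_measure J q)"

definition comb_good :: "nat set \<Rightarrow> (real \<times> box) list \<Rightarrow> bool" where
  "comb_good J F \<longleftrightarrow> (\<forall>(c, q)\<in>set F. good_box J q)"

abbreviation comb_neg :: "(real \<times> box) list \<Rightarrow> (real \<times> box) list" where
  "comb_neg F \<equiv> map (\<lambda>(c, q). (- c, q)) F"

abbreviation comb_cut :: "(real \<times> box) list \<Rightarrow> box \<Rightarrow> (real \<times> box) list" where
  "comb_cut F p \<equiv> map (\<lambda>(c, q). (c, box_inter q p)) F"

lemma comb_simps:
  "comb_value J [] x = 0" "comb_measure J [] = 0" "comb_good J []"
  "comb_value J ((c, q) # F) x = c * indicator (box_block J q) x + comb_value J F x"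
  "comb_measure J ((c, q) # F) = c * box_measure J q + comb_measure J F"
  "comb_good J ((c, q) # F) \<longleftrightarrow> good_box J q \<and> comb_good J F"
  "comb_value J (F @ G) x = comb_value J F x + comb_value J G x"
  "comb_measure J (F @ G) = comb_measure J F + comb_measure J G"
  "comb_good J (F @ G) \<longleftrightarrow> comb_good J F \<and> comb_good J G"
  by (auto simp: comb_value_def comb_measure_def comb_good_def)

lemma comb_neg_simps:
  "comb_value J (comb_neg F) x = - comb_value J F x"
  "comb_measure J (comb_neg F) = - comb_measure J F"
  "comb_good J (comb_neg F) = comb_good J F"
  by (induction F) (auto simp: comb_simps)

lemma comb_value_cut: "comb_value J (comb_cut F p) x = comb_value J F x * indicator (box_block J p) x"
  by (induction F) (auto simp: comb_simps box_block_inter indicator_inter_arith algebra_simps)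

lemma comb_good_cut: "comb_good J F \<Longrightarrow> good_box J p \<Longrightarrow> comb_good J (comb_cut F p)"
  by (induction F) (auto simp: comb_simps good_box_inter)

text \<open>Inside \<open>p\<close> the box measures are multiples of probabilities, so the
  combination becomes the integral of a pointwise non-negative function. If \<open>p\<close> has
  measure 0, no normalization is possible, but then monotonicity makes every term vanish.\<close>

lemma comb_measure_cut_nonneg:
  assumes F: "comb_good J F" and p: "good_box J p"
    and nonneg: "\<And>x. x \<in> subspace_of e J \<Longrightarrow> 0 \<le> comb_value J F x"
  shows "0 \<le> comb_measure J (comb_cut F p)"
proof (cases "box_measure J p = 0")
  case True
  have "box_measure J (box_inter q p) = 0" if "good_box J q" for q
    using box_measure_inter_le[OF p that] box_measure_nonneg[OF good_box_inter[OF that p]] True by simp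
  with F have "comb_measure J (comb_cut F p) = 0"
    by (induction F) (auto simp: comb_simps)
  then show ?thesis by simp
next
  case False
  then have pos: "box_measure J p > 0" using box_measure_nonneg[OF p] by simp
  interpret S: prob_space unit_cube by (rule prob_space_unit_cube)
  \<comment> \<open>A cut that misses the Hilbert space may still contain sequences. Its box measure
    is 0 by convention, and it is dropped because a square-summable representative can be found only
    for boxes that meet the space.\<close>
  let ?ne = "\<lambda>(c :: real, q). box_block J (box_inter q p) \<noteq> {}"
  let ?f = "\<lambda>u. \<Sum>(c, q)\<leftarrow>filter ?ne F. c * indicator (cube_part J p (box_inter q p)) u"
  have int: "integrable unit_cube ?f \<and> comb_measure J (comb_cut F p) = box_measure J p * (\<integral>u. ?f u \<partial>unit_cube)"
    using F
  proof (induction F)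
    case Nil show ?case by (simp add: comb_simps)
  next
    case (Cons cq F)
    obtain c q where cq: "cq = (c, q)" by (cases cq)
    have q: "good_box J q" and F: "comb_good J F" using Cons.prems by (auto simp: cq comb_simps)
    note IH = Cons.IH[OF F]
    show ?case
    proof (cases "box_block J (box_inter q p) = {}")
      case True
      then show ?thesis using IH by (simp add: cq comb_simps box_measure_empty)
    next
      case False
      note m = measure_cube_part[OF p q pos False]
      have i: "integrable unit_cube (\<lambda>u. c * indicat_real (cube_part J p (box_inter q p)) u)"
        using m(1) by (intro integrable_mult_right integrable_real_indicator) (auto simp: S.emeasure_eq_measure)
      have "(\<integral>u. c * indicat_real (cube_part J p (box_inter q p)) u \<partial>unit_cube) =
          c * measure unit_cube (cube_part J p (box_inter q p))"
        using m(1) by (simp add: sets.Int_space_eq2)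
      then show ?thesis using IH False i m(2) sets.Int_space_eq2[OF m(1)]
        by (simp add: cq comb_simps Bochner_Integration.integral_add Bochner_Integration.integrable_add algebra_simps)
    qed
  qed
  have "0 \<le> ?f u" for u
  proof -
    let ?y = "\<lambda>j. fst p j + (snd p j - fst p j) * u j"
    let ?Q = "(\<lambda>(c :: real, q). box_inter q p) ` set (filter ?ne F)"
    obtain x where x: "x \<in> subspace_of e J"
      "\<And>r. r \<in> ?Q \<Longrightarrow> x \<in> box_block J r \<longleftrightarrow> (\<forall>j\<in>J. fst r j \<le> ?y j \<and> ?y j < snd r j)"
      by (rule square_summable_representative[of ?Q J ?y]) auto
    have "?f u = (\<Sum>(c, q)\<leftarrow>filter ?ne F. c * indicator (box_block J (box_inter q p)) x)"
    proof (intro arg_cong[where f=sum_list] map_cong refl, clarify)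
      fix c q assume "(c, q) \<in> set (filter ?ne F)"
      then have "box_inter q p \<in> ?Q" by force
      from x(2)[OF this] show "c * indicator (cube_part J p (box_inter q p)) u = c * indicator (box_block J (box_inter q p)) x"
        by (auto simp: indicator_def cube_part_def)
    qed
    also have "\<dots> = comb_value J (comb_cut F p) x"
      by (induction F) (auto simp: comb_simps)
    also have "\<dots> \<ge> 0" using nonneg[OF x(1)] by (simp add: comb_value_cut)
    finally show ?thesis .
  qed
  then have "0 \<le> (\<integral>u. ?f u \<partial>unit_cube)" by (intro Bochner_Integration.integral_nonneg) auto
  then show ?thesis using int pos by simp
qed

text \<open>\<open>cut_measure J q ps\<close> is the measure of \<open>q\<close> outside all the boxes \<open>ps\<close>, expanded by
  inclusion and exclusion.\<close>

fun cut_measure :: "nat set \<Rightarrow> box \<Rightarrow> box list \<Rightarrow> real" where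
  "cut_measure J q [] = box_measure J q"
| "cut_measure J q (p # ps) = cut_measure J q ps - cut_measure J (box_inter q p) ps"

text \<open>The terms with and without the covering box cancel. Further cuts preserve the covering
  relation because \<open>box_inter\<close> can be exchanged with itself.\<close>

lemma cut_measure_covered: "\<exists>p\<in>set ps. box_inter q p = q \<Longrightarrow> cut_measure J q ps = 0"
proof (induction ps arbitrary: q)
  case (Cons p ps)
  show ?case
  proof (cases "box_inter q p = q")
    case False
    with Cons.prems obtain p' where "p' \<in> set ps" "box_inter q p' = q" by auto
    then have "box_inter (box_inter q p) p' = box_inter q p" by (metis box_inter_simps(2))
    then have "cut_measure J (box_inter q p) ps = 0" using \<open>p' \<in> set ps\<close> Cons.IH by blast
    moreover have "cut_measure J q ps = 0" using \<open>p' \<in> set ps\<close> \<open>box_inter q p' = q\<close> Cons.IH by blast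
    ultimately show ?thesis by simp
  qed simp
qed simp

text \<open>Removing a box \<open>p\<close> from the combination keeps its function non-negative and
  lowers its measure by the non-negative amount inside \<open>p\<close>. Once all boxes that occur
  in \<open>F\<close> have been removed nothing is left, so the measure was at least 0.\<close>

lemma comb_measure_nonneg:
  assumes F: "comb_good J F"
    and nonneg: "\<And>x. x \<in> subspace_of e J \<Longrightarrow> 0 \<le> comb_value J F x"
  shows "0 \<le> comb_measure J F"
proof -
  have "(\<Sum>(c, q)\<leftarrow>F. c * cut_measure J q ps) \<le> comb_measure J F"
    if "\<forall>p\<in>set ps. good_box J p" for ps
    using that F nonneg
  proof (induction ps arbitrary: F)
    case Nil
    show ?case by (simp add: comb_measure_def)
  next
    case (Cons p ps)
    \<comment> \<open>The function of \<open>?G\<close> is that of \<open>F\<close> times the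
      indicator of the complement of \<open>p\<close>.\<close>
    let ?G = "F @ comb_neg (comb_cut F p)"
    have "(\<Sum>(c, q)\<leftarrow>F. c * cut_measure J q (p # ps)) = (\<Sum>(c, q)\<leftarrow>?G. c * cut_measure J q ps)"
      by (induction F) (auto simp: algebra_simps)
    also have "\<dots> \<le> comb_measure J ?G"
    proof (rule Cons.IH)
      show "comb_good J ?G" using Cons.prems by (simp only: comb_simps comb_neg_simps) (simp add: comb_good_cut)
      show "0 \<le> comb_value J ?G x" if "x \<in> subspace_of e J" for x
        using Cons.prems(3)[OF that]
        by (simp only: comb_simps comb_neg_simps comb_value_cut) (simp add: indicator_def)
    qed (use Cons.prems in auto)
    also have "\<dots> = comb_measure J F - comb_measure J (comb_cut F p)"
      by (simp only: comb_simps comb_neg_simps)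
    also have "\<dots> \<le> comb_measure J F"
      using comb_measure_cut_nonneg[OF Cons.prems(2) _ Cons.prems(3)] Cons.prems(1) by simp
    finally show ?case .
  qed
  from this[of "map snd F"] F have "(\<Sum>(c, q)\<leftarrow>F. c * cut_measure J q (map snd F)) \<le> comb_measure J F"
    by (simp add: comb_good_def case_prod_unfold)
  moreover have "(\<Sum>(c, q)\<leftarrow>F. c * cut_measure J q (map snd F)) = (\<Sum>(c, q)\<leftarrow>F. 0)"
    by (intro arg_cong[where f=sum_list] map_cong refl)
      (force intro!: cut_measure_covered simp: box_inter_simps(1))
  ultimately show ?thesis by (simp add: case_prod_unfold)
qed

section \<open>The generated ring through disjoint unions and proper differences\<close>

inductive_set block_dynkin :: "nat set \<Rightarrow> 'a set set" for J where
  block: "abs_measurable e J a b \<Longrightarrow> block e J a b \<in> block_dynkin J"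
| disjoint_union: "A \<in> block_dynkin J \<Longrightarrow> B \<in> block_dynkin J \<Longrightarrow> A \<inter> B = {} \<Longrightarrow> A \<union> B \<in> block_dynkin J"
| proper_diff: "A \<in> block_dynkin J \<Longrightarrow> B \<in> block_dynkin J \<Longrightarrow> B \<subseteq> A \<Longrightarrow> A - B \<in> block_dynkin J"

lemma good_box_iff: "abs_measurable e J a b \<longleftrightarrow> good_box J (a, b) \<and> (\<forall>j\<in>J. a j < b j)"
  by (auto simp: abs_measurable_def good_box_def box_block_def)

lemma box_block_dynkin:
  assumes "good_box J p" "box_block J p \<noteq> {}" shows "box_block J p \<in> block_dynkin J"
proof -
  have "\<forall>j\<in>J. fst p j < snd p j" using assms(2) by (force simp: box_block_def block_def)
  with assms(1) have "abs_measurable e J (fst p) (snd p)" by (simp add: good_box_iff)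
  then show ?thesis unfolding box_block_def by (rule block)
qed

lemma block_dynkin_empty: "{} \<in> block_dynkin J"
proof -
  have "abs_measurable e J (\<lambda>_. 0) (\<lambda>_. 1)"
    by (auto simp: abs_measurable_def bounded_iff)
  from proper_diff[OF block[OF this] block[OF this]] show ?thesis by simp
qed

text \<open>As in the pi-lambda theorem, the induction is done twice: first against a fixed block,
  where two blocks meet in a box, then against an arbitrary member.\<close>

lemma block_dynkin_Int:
  assumes "A \<in> block_dynkin J" "B \<in> block_dynkin J"
  shows "A \<inter> B \<in> block_dynkin J"
proof -
  have block_block: "block e J a b \<inter> block e J c d \<in> block_dynkin J"
    if "abs_measurable e J a b" "abs_measurable e J c d" for a b c d
  proof (cases "block e J a b \<inter> block e J c d = {}")
    case False
    have "block e J a b \<inter> block e J c d = box_block J (box_inter (a, b) (c, d))"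
      by (simp only: box_block_inter) (simp add: box_block_def)
    with False that good_box_inter[of J "(a, b)" "(c, d)"] show ?thesis
      by (metis box_block_dynkin good_box_iff)
  qed (simp add: block_dynkin_empty)
  have Int_block: "A \<inter> block e J c d \<in> block_dynkin J"
    if "A \<in> block_dynkin J" "abs_measurable e J c d" for A c d
    using that(1)
  proof induction
    case (block a b) then show ?case using that(2) by (rule block_block)
  next
    case (disjoint_union A B)
    have "(A \<union> B) \<inter> block e J c d = (A \<inter> block e J c d) \<union> (B \<inter> block e J c d)" by blast
    moreover have "(A \<inter> block e J c d) \<inter> (B \<inter> block e J c d) = {}" using disjoint_union by blast
    ultimately show ?case using disjoint_union block_dynkin.disjoint_union by metis
  next
    case (proper_diff A B)
    have "(A - B) \<inter> block e J c d = (A \<inter> block e J c d) - (B \<inter> block e J c d)" by blast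
    moreover have "B \<inter> block e J c d \<subseteq> A \<inter> block e J c d" using proper_diff by blast
    ultimately show ?case using proper_diff block_dynkin.proper_diff by metis
  qed
  show ?thesis using assms(2)
  proof induction
    case (block a b) then show ?case using Int_block[OF assms(1)] by simp
  next
    case (disjoint_union B B')
    have "A \<inter> (B \<union> B') = (A \<inter> B) \<union> (A \<inter> B')" by blast
    moreover have "(A \<inter> B) \<inter> (A \<inter> B') = {}" using disjoint_union by blast
    ultimately show ?case using disjoint_union block_dynkin.disjoint_union by metis
  next
    case (proper_diff B B')
    have "A \<inter> (B - B') = (A \<inter> B) - (A \<inter> B')" by blast
    moreover have "A \<inter> B' \<subseteq> A \<inter> B" using proper_diff by blast
    ultimately show ?case using proper_diff block_dynkin.proper_diff by metis
  qed
qed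

lemma block_dynkin_Diff:
  assumes "A \<in> block_dynkin J" "B \<in> block_dynkin J"
  shows "A - B \<in> block_dynkin J"
  using proper_diff[OF assms(1) block_dynkin_Int[OF assms]] by (simp add: Diff_Int)

lemma block_dynkin_Un:
  assumes "A \<in> block_dynkin J" "B \<in> block_dynkin J"
  shows "A \<union> B \<in> block_dynkin J"
  using disjoint_union[OF block_dynkin_Diff[OF assms] assms(2)] by auto

lemma block_dynkin_subset: "A \<in> block_dynkin J \<Longrightarrow> A \<subseteq> subspace_of e J"
  by (induction rule: block_dynkin.induct) (auto simp: block_def)

text \<open>The gain is an induction principle whose rules are exactly those through which
  additivity determines a measure. Stability under intersection turns proper differences and
  disjoint unions into arbitrary ones.\<close>

lemma block_ring_eq: "block_ring e J = block_dynkin J"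
proof
  have "ring_of_sets (subspace_of e J) (block_dynkin J)"
    using block_dynkin_subset by (auto simp: ring_of_sets_iff block_dynkin_empty block_dynkin_Un block_dynkin_Diff)
  then show "block_ring e J \<subseteq> block_dynkin J"
    unfolding block_ring_def by (intro Inter_lower) (auto intro: block)
  have "A \<in> M" if "A \<in> block_dynkin J" "ring_of_sets (subspace_of e J) M"
    "{block e J a b |a b. abs_measurable e J a b} \<subseteq> M" for A M
    using that(1)
  proof induction
    case (block a b) then show ?case using that(3) by blast
  next
    case (disjoint_union A B) then show ?case using ring_of_sets.Un[OF that(2)] by blast
  next
    case (proper_diff A B) then show ?case using ring_of_sets.Diff[OF that(2)] by blast
  qed
  then show "block_dynkin J \<subseteq> block_ring e J" unfolding block_ring_def by blast
qed

definition represents :: "nat set \<Rightarrow> (real \<times> box) list \<Rightarrow> 'a set \<Rightarrow> bool" where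
  "represents J F A \<longleftrightarrow> comb_good J F \<and> (\<forall>x\<in>subspace_of e J. comb_value J F x = indicator A x)"

lemma represents_block: "abs_measurable e J a b \<Longrightarrow> represents J [(1, a, b)] (block e J a b)"
  by (simp add: represents_def comb_simps good_box_iff box_block_def)

lemma represents_Un:
  "represents J F A \<Longrightarrow> represents J G B \<Longrightarrow> A \<inter> B = {} \<Longrightarrow> represents J (F @ G) (A \<union> B)"
  by (auto simp: represents_def comb_simps indicator_def)

lemma represents_Diff:
  "represents J F A \<Longrightarrow> represents J G B \<Longrightarrow> B \<subseteq> A \<Longrightarrow> represents J (F @ comb_neg G) (A - B)"
  by (auto simp: represents_def comb_simps comb_neg_simps indicator_def)

lemma represents_exists: "A \<in> block_dynkin J \<Longrightarrow> \<exists>F. represents J F A"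
proof (induction rule: block_dynkin.induct)
  case (block a b) then show ?case using represents_block by blast
next
  case (disjoint_union A B) then show ?case using represents_Un by blast
next
  case (proper_diff A B) then show ?case using represents_Diff by blast
qed

text \<open>The difference of the two combinations is non-negative on the space. For
  \<open>A = B\<close> this is well-definedness: all representations of a set have the same
  measure.\<close>

lemma represents_mono:
  assumes "represents J F A" "represents J G B" "A \<subseteq> B"
  shows "comb_measure J F \<le> comb_measure J G"
  using comb_measure_nonneg[of J "G @ comb_neg F"] assms
  by (simp add: represents_def comb_simps comb_neg_simps indicator_def) (smt (verit) in_mono)

definition dynkin_measure :: "nat set \<Rightarrow> 'a set \<Rightarrow> real" where
  "dynkin_measure J A = (if A \<in> block_dynkin J then comb_measure J (SOME F. represents J F A) else 0)"

lemma dynkin_measure_eq: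
  assumes "A \<in> block_dynkin J" "represents J F A"
  shows "dynkin_measure J A = comb_measure J F"
proof -
  have "represents J (SOME F. represents J F A) A" using assms(2) by (rule someI)
  then show ?thesis using represents_mono assms by (simp add: dynkin_measure_def antisym)
qed

lemma dynkin_measure_Un:
  assumes "A \<in> block_dynkin J" "B \<in> block_dynkin J" "A \<inter> B = {}"
  shows "dynkin_measure J (A \<union> B) = dynkin_measure J A + dynkin_measure J B"
proof -
  obtain F G where "represents J F A" "represents J G B" using assms represents_exists by blast
  with assms show ?thesis
    by (simp add: dynkin_measure_eq[OF _ represents_Un] dynkin_measure_eq block_dynkin_Un comb_simps)
qed

lemma dynkin_measure_nonneg: "0 \<le> dynkin_measure J A"
proof (cases "A \<in> block_dynkin J")
  case True
  obtain F where F: "represents J F A" using represents_exists[OF True] by blast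
  have "represents J [] {}" by (simp add: represents_def comb_simps)
  from represents_mono[OF this F] show ?thesis by (simp add: dynkin_measure_eq[OF True F] comb_simps)
qed (simp add: dynkin_measure_def)

section \<open>Shift invariance, existence and uniqueness of the extension\<close>

definition box_shift :: "'a \<Rightarrow> box \<Rightarrow> box" where
  "box_shift h p = (\<lambda>j. fst p j + h \<bullet> e j, \<lambda>j. snd p j + h \<bullet> e j)"

lemma mem_translate_iff: "x \<in> (+) h ` A \<longleftrightarrow> x - h \<in> (A :: 'a set)"
  by (metis add_diff_cancel_left' add.commute diff_add_cancel image_iff)

lemma box_block_shift:
  assumes h: "h \<in> subspace_of e J"
  shows "box_block J (box_shift h p) = (+) h ` box_block J p"
proof -
  have "x \<in> subspace_of e J \<longleftrightarrow> x - h \<in> subspace_of e J" for x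
    using subspace_diff[OF subspace_subspace_of _ h] subspace_add[OF subspace_subspace_of _ h]
    by (metis diff_add_cancel)
  then show ?thesis
    unfolding set_eq_iff mem_translate_iff
    by (simp add: box_block_def block_def box_shift_def inner_diff_left le_diff_eq diff_less_eq)
qed

lemma abs_inner_basis_le: "\<bar>h \<bullet> e j\<bar> \<le> norm h"
  using Cauchy_Schwarz_ineq2[of h "e j"] inner_basis[of j j] by (simp add: norm_eq_sqrt_inner)

lemma bounded_shift:
  assumes "bounded (a ` J)" shows "bounded ((\<lambda>j. a j + h \<bullet> e j) ` J)"
proof -
  obtain K where K: "\<And>j. j \<in> J \<Longrightarrow> \<bar>a j\<bar> \<le> K" using assms by (auto simp: bounded_iff)
  show ?thesis
    unfolding bounded_iff
  proof (intro exI[of _ "K + norm h"] ballI, clarify)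
    fix j assume "j \<in> J"
    then show "norm (a j + h \<bullet> e j) \<le> K + norm h"
      using K[of j] abs_inner_basis_le[of h j] by simp
  qed
qed

lemma good_box_shift:
  "h \<in> subspace_of e J \<Longrightarrow> good_box J p \<Longrightarrow> good_box J (box_shift h p)"
  by (simp add: good_box_def box_block_shift) (simp add: box_shift_def bounded_shift)

lemma box_measure_shift:
  "h \<in> subspace_of e J \<Longrightarrow> box_measure J (box_shift h p) = box_measure J p"
  using box_block_shift[of h J p]
  by (simp add: box_measure_def block_measure_def box_block_def) (simp add: box_shift_def)

lemma block_dynkin_shift:
  assumes "A \<in> block_dynkin J" and h: "h \<in> subspace_of e J"
  shows "(+) h ` A \<in> block_dynkin J"
  using assms(1)
proof induction
  case (block a b)
  have "abs_measurable e J (fst (box_shift h (a, b))) (snd (box_shift h (a, b)))"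
    using block good_box_shift[OF h, of "(a, b)"] by (simp add: good_box_iff) (simp add: box_shift_def)
  then have "box_block J (box_shift h (a, b)) \<in> block_dynkin J"
    unfolding box_block_def by (rule block_dynkin.block)
  then show ?case by (simp add: box_block_shift[OF h]) (simp add: box_block_def)
next
  case (disjoint_union A B)
  have "(+) h ` (A \<union> B) = (+) h ` A \<union> (+) h ` B" "(+) h ` A \<inter> (+) h ` B = {}"
    using disjoint_union by (auto simp: mem_translate_iff)
  then show ?case using disjoint_union block_dynkin.disjoint_union by metis
next
  case (proper_diff A B)
  have "(+) h ` (A - B) = (+) h ` A - (+) h ` B" "(+) h ` B \<subseteq> (+) h ` A"
    using proper_diff by (auto simp: mem_translate_iff)
  then show ?case using proper_diff block_dynkin.proper_diff by metis
qed

lemma represents_shift: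
  assumes "represents J F A" and h: "h \<in> subspace_of e J"
  shows "represents J (map (\<lambda>(c, q). (c, box_shift h q)) F) ((+) h ` A)"
    and "comb_measure J (map (\<lambda>(c, q). (c, box_shift h q)) F) = comb_measure J F"
proof -
  let ?G = "map (\<lambda>(c, q). (c, box_shift h q)) F"
  have "comb_good J ?G"
    using assms good_box_shift[OF h] by (auto simp: represents_def comb_good_def)
  moreover have "comb_value J ?G x = indicator ((+) h ` A) x" if x: "x \<in> subspace_of e J" for x
  proof -
    have "comb_value J ?G x = comb_value J F (x - h)"
      by (induction F) (auto simp: comb_simps box_block_shift[OF h] indicator_def mem_translate_iff)
    also have "\<dots> = indicator A (x - h)"
      using assms subspace_diff[OF subspace_subspace_of x h] by (simp add: represents_def)
    finally show ?thesis by (simp add: indicator_def mem_translate_iff)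
  qed
  ultimately show "represents J ?G ((+) h ` A)" by (simp add: represents_def)
  show "comb_measure J ?G = comb_measure J F"
    by (induction F) (auto simp: comb_simps box_measure_shift[OF h])
qed

lemma block_extension_dynkin_measure: "block_extension e J (dynkin_measure J)"
  unfolding block_extension_def block_ring_eq
proof (intro conjI ballI allI impI)
  fix A h assume A: "A \<in> block_dynkin J" and h: "h \<in> subspace_of e J"
  obtain F where F: "represents J F A" using represents_exists[OF A] by blast
  show "dynkin_measure J ((+) h ` A) = dynkin_measure J A"
    by (simp add: dynkin_measure_eq[OF A F] dynkin_measure_eq[OF block_dynkin_shift[OF A h] represents_shift(1)[OF F h]]
      represents_shift(2)[OF F h])
next
  fix a b assume "abs_measurable e J a b"
  then show "dynkin_measure J (block e J a b) = block_measure e J a b"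
    by (simp add: dynkin_measure_eq[OF block represents_block] comb_simps box_measure_def)
qed (auto simp: dynkin_measure_nonneg dynkin_measure_Un)

text \<open>This gives the definite description its content. Uniqueness is an induction over
  \<open>block_dynkin\<close>: for a proper difference the value is the one forced by
  \<open>(A - B) \<union> B = A\<close>; the value 0 off the ring fixes the rest.\<close>

lemma ring_measure_eq: "ring_measure e J = dynkin_measure J"
  unfolding ring_measure_def
proof (rule the_equality)
  show "block_extension e J (dynkin_measure J) \<and> (\<forall>A. A \<notin> block_ring e J \<longrightarrow> dynkin_measure J A = 0)"
    using block_extension_dynkin_measure by (simp add: block_ring_eq dynkin_measure_def)
  fix m assume m: "block_extension e J m \<and> (\<forall>A. A \<notin> block_ring e J \<longrightarrow> m A = 0)"
  have add: "m (A \<union> B) = m A + m B" if "A \<in> block_dynkin J" "B \<in> block_dynkin J" "A \<inter> B = {}" for A B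
    using m that unfolding block_extension_def block_ring_eq by blast
  have "m A = dynkin_measure J A" if "A \<in> block_dynkin J" for A
    using that
  proof induction
    case (block a b)
    then show ?case using m block_extension_dynkin_measure[of J] by (simp add: block_extension_def)
  next
    case (disjoint_union A B)
    then show ?case using add dynkin_measure_Un by simp
  next
    case (proper_diff A B)
    have "(A - B) \<union> B = A" "(A - B) \<inter> B = {}" using proper_diff by auto
    then show ?case
      using add[of "A - B" B] dynkin_measure_Un[of "A - B" J B] block_dynkin_Diff[of A J B] proper_diff by simp
  qed
  then show "m = dynkin_measure J"
    using m by (auto simp: block_ring_eq dynkin_measure_def fun_eq_iff)
qed

section \<open>Monotonicity and the completed ring\<close>

lemma ring_measure_nonneg: "0 \<le> ring_measure e J A"
  by (simp add: ring_measure_eq dynkin_measure_nonneg)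

lemma ring_measure_mono:
  assumes "A \<in> block_ring e J" "B \<in> block_ring e J" "A \<subseteq> B"
  shows "ring_measure e J A \<le> ring_measure e J B"
proof -
  have "B = A \<union> (B - A)" using assms by blast
  then have "ring_measure e J B = ring_measure e J A + ring_measure e J (B - A)"
    using assms dynkin_measure_Un[of A J "B - A"] by (simp add: ring_measure_eq block_ring_eq block_dynkin_Diff)
  then show ?thesis using ring_measure_nonneg[of J "B - A"] by simp
qed

lemma ring_measure_empty: "ring_measure e J {} = 0"
  using dynkin_measure_Un[of "{}" J "{}"] by (simp add: ring_measure_eq block_dynkin_empty)

lemma block_ring_subset_complete_ring: "block_ring e J \<subseteq> complete_ring e J"
  unfolding complete_ring_def by (auto simp: ring_measure_empty intro!: bexI)

lemma block_ring_Diff: "A \<in> block_ring e J \<Longrightarrow> B \<in> block_ring e J \<Longrightarrow> A - B \<in> block_ring e J"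
  by (simp add: block_ring_eq block_dynkin_Diff)

lemma complete_ring_Diff:
  assumes A: "A \<in> complete_ring e J" and B: "B \<in> block_ring e J"
  shows "A - B \<in> complete_ring e J"
  unfolding complete_ring_def
proof (intro CollectI allI impI)
  fix \<epsilon> :: real assume "\<epsilon> > 0"
  then obtain P Q where PQ: "P \<in> block_ring e J" "Q \<in> block_ring e J" "P \<subseteq> A" "A \<subseteq> Q"
    "ring_measure e J (Q - P) < \<epsilon>" using A unfolding complete_ring_def by blast
  have "ring_measure e J ((Q - B) - (P - B)) \<le> ring_measure e J (Q - P)"
    using PQ B by (intro ring_measure_mono block_ring_Diff) auto
  then show "\<exists>P\<in>block_ring e J. \<exists>Q\<in>block_ring e J. P \<subseteq> A - B \<and> A - B \<subseteq> Q \<and> ring_measure e J (Q - P) < \<epsilon>"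
    using PQ B by (intro bexI[of _ "P - B"] bexI[of _ "Q - B"] conjI block_ring_Diff) auto
qed

lemma shift_measure_le:
  assumes "C \<in> block_ring e J" "A \<subseteq> C"
  shows "shift_measure e J A \<le> ring_measure e J C"
  unfolding shift_measure_def
  using assms ring_measure_nonneg by (intro cInf_lower bdd_belowI[of _ 0]) auto

end

section \<open>Multiplications by functions of different coordinates commute\<close>

lemma csubspace_closure:
  fixes S :: "'a::complex_hilbert set"
  assumes "complex_vector.subspace S"
  shows "complex_vector.subspace (closure S)"
  unfolding complex_vector.subspace_def
proof (intro conjI ballI allI)
  show "0 \<in> closure S" using complex_vector.subspace_0[OF assms] closure_subset by blast
next
  fix x y assume "x \<in> closure S" "y \<in> closure S"
  then obtain X Y where "\<And>n. X n \<in> S" "X \<longlonglongrightarrow> x" "\<And>n. Y n \<in> S" "Y \<longlonglongrightarrow> y"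
    unfolding closure_sequential by blast
  then show "x + y \<in> closure S"
    unfolding closure_sequential using complex_vector.subspace_add[OF assms] tendsto_add
    by (intro exI[of _ "\<lambda>n. X n + Y n"]) auto
next
  fix c and x assume "x \<in> closure S"
  then obtain X where "\<And>n. X n \<in> S" "X \<longlonglongrightarrow> x"
    unfolding closure_sequential by blast
  then show "c *\<^sub>C x \<in> closure S"
    unfolding closure_sequential using complex_vector.subspace_scale[OF assms]
    by (intro exI[of _ "\<lambda>n. c *\<^sub>C X n"]) (auto intro: tendsto_scaleC)
qed

text \<open>Half-open cells are chosen because those are the intervals that
  \<open>coord_splitting\<close> relates to blocks. The window from \<open>- (n + 1)\<close> to
  \<open>n + 1\<close> with mesh \<open>1 / (n + 1)\<close> has \<open>2 * (n + 1) * (n + 1)\<close>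
  cells; \<open>\<phi>\<close> is evaluated at their left ends.\<close>

lemma tendsto_step_approximation:
  fixes \<phi> :: "real \<Rightarrow> real"
  assumes cont: "continuous_on UNIV \<phi>" and bd: "\<And>s. \<bar>\<phi> s\<bar> \<le> K"
  defines "\<Phi> n s \<equiv> \<Sum>i<2 * Suc n * Suc n. \<phi> (real i / real (Suc n) - real (Suc n)) *
      indicator {real i / real (Suc n) - real (Suc n)..<real (Suc i) / real (Suc n) - real (Suc n)} s"
  shows "\<And>n s. \<bar>\<Phi> n s\<bar> \<le> K" and "\<And>s. (\<lambda>n. \<Phi> n s) \<longlonglongrightarrow> \<phi> s"
proof -
  have K0: "0 \<le> K" using bd[of 0] by linarith
  \<comment> \<open>The index of the cell containing \<open>s\<close>. Since \<open>nat\<close>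
    truncates, points left of the window would get index 0, whence the extra condition
    \<open>- real (Suc n) \<le> s\<close> below.\<close>
  define a where "a n s = nat \<lfloor>(s + real (Suc n)) * real (Suc n)\<rfloor>" for n s
  have ind: "indicat_real {real i / real (Suc n) - real (Suc n)..<real (Suc i) / real (Suc n) - real (Suc n)} s =
      (if i = a n s then (if - real (Suc n) \<le> s then 1 else 0) else 0)" for i n s
  proof -
    have "real i / real (Suc n) - real (Suc n) \<le> s \<and> s < real (Suc i) / real (Suc n) - real (Suc n) \<longleftrightarrow>
      real i \<le> (s + real (Suc n)) * real (Suc n) \<and> (s + real (Suc n)) * real (Suc n) < real i + 1"
      by (simp add: field_simps del: of_nat_Suc) (simp add: algebra_simps)
    also have "\<dots> \<longleftrightarrow> \<lfloor>(s + real (Suc n)) * real (Suc n)\<rfloor> = int i"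
      by (simp add: floor_eq_iff del: of_nat_Suc)
    also have "\<dots> \<longleftrightarrow> i = a n s \<and> 0 \<le> \<lfloor>(s + real (Suc n)) * real (Suc n)\<rfloor>"
    proof -
      have "z = int i \<longleftrightarrow> i = nat z \<and> 0 \<le> z" for z by auto
      then show ?thesis unfolding a_def .
    qed
    also have "0 \<le> \<lfloor>(s + real (Suc n)) * real (Suc n)\<rfloor> \<longleftrightarrow> - real (Suc n) \<le> s"
      by (simp add: zero_le_mult_iff del: of_nat_Suc) linarith
    finally show ?thesis by (auto simp: indicator_def)
  qed
  have \<Phi>: "\<Phi> n s = (if a n s < 2 * Suc n * Suc n \<and> - real (Suc n) \<le> s
      then \<phi> (real (a n s) / real (Suc n) - real (Suc n)) else 0)" for n s
  proof -
    have "(\<Sum>i<m. g i * (if i = k then b else 0)) = (if k < m then g k * b else 0)"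
      for m k :: nat and g and b :: real
      by (simp add: if_distrib cong: if_cong)
    then show ?thesis unfolding \<Phi>_def ind by (simp del: of_nat_Suc)
  qed
  show "\<bar>\<Phi> n s\<bar> \<le> K" for n s using bd K0 by (simp add: \<Phi>)
  fix s
  define y where "y n = real (a n s) / real (Suc n) - real (Suc n)" for n
  have big: "\<forall>\<^sub>F n in sequentially. \<bar>s\<bar> < real (Suc n)"
    using eventually_gt_at_top[of "nat \<lceil>\<bar>s\<bar>\<rceil>"] by (rule eventually_mono) linarith
  have close: "\<bar>y n - s\<bar> \<le> 1 / real (Suc n) \<and> a n s < 2 * Suc n * Suc n" if "\<bar>s\<bar> < real (Suc n)" for n
  proof -
    let ?x = "(s + real (Suc n)) * real (Suc n)"
    have x0: "0 \<le> ?x" using that by (intro mult_nonneg_nonneg) auto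
    have ra: "real (a n s) = of_int \<lfloor>?x\<rfloor>" using x0 unfolding a_def by simp
    have "?x < (2 * real (Suc n)) * real (Suc n)" using that by (intro mult_strict_right_mono) auto
    then have "real (a n s) < (2 * real (Suc n)) * real (Suc n)"
      using of_int_floor_le[of ?x] unfolding ra by linarith
    also have "\<dots> = real (2 * Suc n * Suc n)" by (simp only: of_nat_mult of_nat_numeral)
    finally have l: "a n s < 2 * Suc n * Suc n" by (simp only: of_nat_less_iff)
    have "y n - s = (of_int \<lfloor>?x\<rfloor> - ?x) / real (Suc n)"
      unfolding y_def ra by (simp add: field_simps del: of_nat_Suc)
    moreover have "\<bar>of_int \<lfloor>?x\<rfloor> - ?x\<bar> \<le> 1" by linarith
    ultimately have "\<bar>y n - s\<bar> \<le> 1 / real (Suc n)" by (simp add: divide_right_mono del: of_nat_Suc)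
    with l show ?thesis by simp
  qed
  have "(\<lambda>n. y n - s) \<longlonglongrightarrow> 0"
  proof (rule Lim_null_comparison)
    show "\<forall>\<^sub>F n in sequentially. norm (y n - s) \<le> 1 / real (Suc n)"
      using big by (rule eventually_mono) (use close in auto)
    show "(\<lambda>n. 1 / real (Suc n)) \<longlonglongrightarrow> 0" using LIMSEQ_inverse_real_of_nat by (simp add: inverse_eq_divide)
  qed
  then have "y \<longlonglongrightarrow> s" by (simp add: LIM_zero_iff)
  moreover have "isCont \<phi> s" using cont by (simp add: continuous_on_eq_continuous_at)
  ultimately have "(\<lambda>n. \<phi> (y n)) \<longlonglongrightarrow> \<phi> s" by (rule isCont_tendsto_compose[rotated])
  moreover have "\<forall>\<^sub>F n in sequentially. \<phi> (y n) = \<Phi> n s"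
    using big by (rule eventually_mono) (use close in \<open>auto simp: \<Phi> y_def\<close>)
  ultimately show "(\<lambda>n. \<Phi> n s) \<longlonglongrightarrow> \<phi> s" by (rule Lim_transform_eventually)
qed

text \<open>\<open>T\<close> is any bounded operator so that the lemma can be applied twice,
  replacing first one and then the other indicator by a continuous function.\<close>

lemma (in hilbert_tensor) commute_coord_mult_continuous:
  fixes T :: "'h \<Rightarrow> 'h"
  assumes T: "bounded_linear T"
    and comm: "\<And>\<alpha> \<beta> f. T (coord_mult \<tau> (indicator {\<alpha>..<\<beta>}) f) = coord_mult \<tau> (indicator {\<alpha>..<\<beta>}) (T f)"
    and \<phi>: "continuous_on UNIV \<phi>" "\<And>s. \<bar>\<phi> s\<bar> \<le> K"
  shows "T (coord_mult \<tau> \<phi> f) = coord_mult \<tau> \<phi> (T f)"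
proof -
  interpret T: bounded_linear T by fact
  \<comment> \<open>Measurability and boundedness are part of the induction because
    \<open>coord_mult_linear_comb\<close> demands them of the partial sum.\<close>
  have sums: "(\<lambda>s. \<Sum>i<m. r i * indicator {\<alpha> i..<\<beta> i} s) \<in> borel_measurable borel \<and>
      (\<forall>s. \<bar>\<Sum>i<m. r i * indicator {\<alpha> i..<\<beta> i} s\<bar> \<le> (\<Sum>i<m. \<bar>r i\<bar>)) \<and>
      (\<forall>f. T (coord_mult \<tau> (\<lambda>s. \<Sum>i<m. r i * indicator {\<alpha> i..<\<beta> i} s) f) =
        coord_mult \<tau> (\<lambda>s. \<Sum>i<m. r i * indicator {\<alpha> i..<\<beta> i} s) (T f))"
    for m :: nat and r \<alpha> \<beta> :: "nat \<Rightarrow> real"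
  proof (induction m)
    case 0
    have "coord_mult \<tau> (\<lambda>_. 0) f = 0" for f using norm_coord_mult[of "\<lambda>_. 0" 0 f] by simp
    then show ?case by (simp add: T.zero)
  next
    case (Suc m)
    let ?S = "\<lambda>s. \<Sum>i<m. r i * indicator {\<alpha> i..<\<beta> i} s"
    have i: "indicat_real {\<alpha> m..<\<beta> m} \<in> borel_measurable borel" "\<And>s. \<bar>indicat_real {\<alpha> m..<\<beta> m} s\<bar> \<le> 1"
      by (auto simp: indicator_def)
    have S: "?S \<in> borel_measurable borel" "\<And>s. \<bar>?S s\<bar> \<le> (\<Sum>i<m. \<bar>r i\<bar>)" using Suc by auto
    have "\<bar>?S s + r m * indicator {\<alpha> m..<\<beta> m} s\<bar> \<le> (\<Sum>i<m. \<bar>r i\<bar>) + \<bar>r m\<bar>" for s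
      using S(2)[of s] by (auto simp: indicator_def)
    moreover have "T (coord_mult \<tau> (\<lambda>s. ?S s + r m * indicator {\<alpha> m..<\<beta> m} s) f) =
      coord_mult \<tau> (\<lambda>s. ?S s + r m * indicator {\<alpha> m..<\<beta> m} s) (T f)" for f
      using Suc comm by (simp only: coord_mult_linear_comb[OF S i] T.add T.scaleR)
    ultimately show ?case using S i by simp
  qed
  note \<Phi> = tendsto_step_approximation[OF \<phi>]
  define \<Phi> where "\<Phi> n s = (\<Sum>i<2 * Suc n * Suc n. \<phi> (real i / real (Suc n) - real (Suc n)) *
      indicator {real i / real (Suc n) - real (Suc n)..<real (Suc i) / real (Suc n) - real (Suc n)} s)" for n s
  have S: "\<Phi> n \<in> borel_measurable borel" "T (coord_mult \<tau> (\<Phi> n) f) = coord_mult \<tau> (\<Phi> n) (T f)" for n f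
  proof -
    note X = sums[where m="2 * Suc n * Suc n" and r="\<lambda>i. \<phi> (real i / real (Suc n) - real (Suc n))"
      and \<alpha>="\<lambda>i. real i / real (Suc n) - real (Suc n)"
      and \<beta>="\<lambda>i. real (Suc i) / real (Suc n) - real (Suc n)",
      folded \<Phi>_def]
    show "\<Phi> n \<in> borel_measurable borel" by (rule X[THEN conjunct1])
    show "T (coord_mult \<tau> (\<Phi> n) f) = coord_mult \<tau> (\<Phi> n) (T f)"
      by (rule X[THEN conjunct2, THEN conjunct2, rule_format])
  qed
  have lim: "(\<lambda>n. coord_mult \<tau> (\<Phi> n) f) \<longlonglongrightarrow> coord_mult \<tau> \<phi> f" for f
    by (rule tendsto_coord_mult[OF S(1), where K=K]) (unfold \<Phi>_def, fact \<Phi>(1), fact \<Phi>(2))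
  have "(\<lambda>n. T (coord_mult \<tau> (\<Phi> n) f)) \<longlonglongrightarrow> T (coord_mult \<tau> \<phi> f)"
    by (intro T.tendsto lim)
  moreover have "(\<lambda>n. T (coord_mult \<tau> (\<Phi> n) f)) \<longlonglongrightarrow> coord_mult \<tau> \<phi> (T f)"
    unfolding S(2) by (rule lim)
  ultimately show ?thesis by (rule LIMSEQ_unique)
qed

locale gauss_setting = hilbert_basis e
  for e :: "nat \<Rightarrow> 'a::{real_inner, complete_space}" +
  fixes \<iota> :: "('a \<Rightarrow> complex) \<Rightarrow> 'h::complex_hilbert"
    and \<iota>' :: "nat \<Rightarrow> ('a \<Rightarrow> complex) \<Rightarrow> 'g::complex_hilbert"
    and \<tau> :: "nat \<Rightarrow> (real \<Rightarrow> complex) \<Rightarrow> 'g \<Rightarrow> 'h"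
  assumes completion: "l2_completion e UNIV \<iota>"
    and splitting: "coord_splitting e k \<iota> (\<iota>' k) (\<tau> k)"
begin

sublocale tensor: hilbert_tensor "\<tau> k" for k
  using splitting[of k] unfolding coord_splitting_def by unfold_locales blast+

section \<open>Step functions and the density of blocks\<close>

lemma step_fun_in_step_funs:
  "(\<And>i. i < n \<Longrightarrow> A i \<in> complete_ring e J) \<Longrightarrow> disjoint_family_on A {..<n} \<Longrightarrow> step_fun n c A \<in> step_funs e J"
  unfolding step_funs_def by blast

lemma indicator_eq_step_fun: "(\<lambda>x. c * indicator A x) = step_fun 1 (\<lambda>_. c) (\<lambda>_. A)"
  by (simp add: step_fun_def fun_eq_iff)

lemma scaled_indicator_in_step_funs: "A \<in> complete_ring e J \<Longrightarrow> (\<lambda>x. c * indicator A x) \<in> step_funs e J"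
  unfolding indicator_eq_step_fun by (rule step_fun_in_step_funs) (auto simp: disjoint_family_on_def)

lemma indicator_in_step_funs: "A \<in> complete_ring e J \<Longrightarrow> indicator A \<in> step_funs e J"
  using scaled_indicator_in_step_funs[of A J 1] by simp

lemma iota_add: "f \<in> step_funs e UNIV \<Longrightarrow> g \<in> step_funs e UNIV \<Longrightarrow> \<iota> (\<lambda>x. f x + g x) = \<iota> f + \<iota> g"
  using completion unfolding l2_completion_def by blast

lemma iota_scale: "f \<in> step_funs e UNIV \<Longrightarrow> \<iota> (\<lambda>x. c * f x) = c *\<^sub>C \<iota> f"
  using completion unfolding l2_completion_def by blast

lemma norm_iota_indicator:
  assumes "A \<in> complete_ring e UNIV"
  shows "norm (\<iota> (indicator A)) = sqrt (shift_measure e UNIV A)"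
proof -
  have "norm (\<iota> (step_fun 1 (\<lambda>_. 1) (\<lambda>_. A))) = sqrt (\<Sum>i<(1::nat). (cmod 1)\<^sup>2 * shift_measure e UNIV A)"
    using completion assms unfolding l2_completion_def by (auto simp: disjoint_family_on_def)
  then show ?thesis unfolding indicator_eq_step_fun[symmetric] by simp
qed

lemma iota_zero: "\<iota> (\<lambda>_. 0) = 0"
proof -
  have "{} \<in> complete_ring e UNIV" using block_ring_subset_complete_ring block_dynkin_empty by (auto simp: block_ring_eq)
  from iota_scale[OF indicator_in_step_funs[OF this], of 0] show ?thesis by simp
qed

lemma iota_indicator_empty: "\<iota> (indicator {}) = 0"
proof -
  have "(indicator {} :: 'a \<Rightarrow> complex) = (\<lambda>_. 0)" by (simp add: fun_eq_iff)
  then show ?thesis using iota_zero by simp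
qed

lemma iota_indicator_Un:
  assumes "A \<in> complete_ring e UNIV" "B \<in> complete_ring e UNIV" "A \<inter> B = {}"
  shows "\<iota> (indicator (A \<union> B)) = \<iota> (indicator A) + \<iota> (indicator B)"
proof -
  have "(\<lambda>x. indicator A x + indicator B x) = (indicator (A \<union> B) :: 'a \<Rightarrow> complex)"
    using assms(3) by (auto simp: indicator_def fun_eq_iff)
  then show ?thesis
    using iota_add[OF indicator_in_step_funs[OF assms(1)] indicator_in_step_funs[OF assms(2)]] by simp
qed

lemma iota_step_fun:
  assumes "\<And>i. i < n \<Longrightarrow> A i \<in> complete_ring e UNIV" "disjoint_family_on A {..<n}"
  shows "\<iota> (step_fun n c A) = (\<Sum>i<n. c i *\<^sub>C \<iota> (indicator (A i)))"
  using assms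
proof (induction n)
  case 0
  have "step_fun 0 c A = (\<lambda>_. 0)" by (simp add: step_fun_def fun_eq_iff)
  then show ?case by (simp add: iota_zero)
next
  case (Suc n)
  have d: "disjoint_family_on A {..<n}" using Suc.prems(2) by (auto simp: disjoint_family_on_def)
  have "step_fun (Suc n) c A = (\<lambda>x. step_fun n c A x + c n * indicator (A n) x)"
    by (simp add: step_fun_def fun_eq_iff)
  moreover have "\<iota> \<dots> = \<iota> (step_fun n c A) + \<iota> (\<lambda>x. c n * indicator (A n) x)"
    by (intro iota_add step_fun_in_step_funs scaled_indicator_in_step_funs d) (use Suc.prems in auto)
  ultimately show ?case
    using Suc.IH[OF _ d] Suc.prems(1) by (simp add: iota_scale indicator_in_step_funs)
qed

text \<open>Additivity of \<open>\<iota>\<close> on disjoint sets follows the rules of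
  \<open>block_dynkin\<close>, inner approximation reaches the completed ring, and linearity the
  step functions.\<close>

lemma blocks_dense:
  assumes V: "closed V" "complex_vector.subspace V"
    and blocks: "\<And>p. good_box UNIV p \<Longrightarrow> \<iota> (indicator (box_block UNIV p)) \<in> V"
  shows "V = UNIV"
proof -
  note complete = block_ring_subset_complete_ring[THEN subsetD]
  have ring: "\<iota> (indicator A) \<in> V" if "A \<in> block_dynkin UNIV" for A
    using that
  proof induction
    case (block a b) then show ?case using blocks[of "(a, b)"] by (simp add: good_box_iff box_block_def)
  next
    case (disjoint_union A B)
    then show ?case using complex_vector.subspace_add[OF V(2)]
      by (simp add: iota_indicator_Un complete block_ring_eq)
  next
    case (proper_diff A B)
    have "\<iota> (indicator ((A - B) \<union> B)) = \<iota> (indicator (A - B)) + \<iota> (indicator B)"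
      using proper_diff by (intro iota_indicator_Un complete) (auto simp: block_ring_eq block_dynkin_Diff)
    moreover have "(A - B) \<union> B = A" using proper_diff by auto
    ultimately have "\<iota> (indicator (A - B)) = \<iota> (indicator A) - \<iota> (indicator B)" by simp
    then show ?case using proper_diff complex_vector.subspace_diff[OF V(2)] by simp
  qed
  have complete_V: "\<iota> (indicator A) \<in> V" if A: "A \<in> complete_ring e UNIV" for A
  proof -
    have "\<exists>y\<in>V. dist y (\<iota> (indicator A)) < \<epsilon>" if "\<epsilon> > 0" for \<epsilon>
    proof -
      obtain B C where BC: "B \<in> block_ring e UNIV" "C \<in> block_ring e UNIV" "B \<subseteq> A" "A \<subseteq> C"
        "ring_measure e UNIV (C - B) < \<epsilon>\<^sup>2"
        using A \<open>\<epsilon> > 0\<close> unfolding complete_ring_def by (auto dest: spec[of _ "\<epsilon>\<^sup>2"])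
      note AB = complete_ring_Diff[OF A BC(1)]
      have "\<iota> (indicator ((A - B) \<union> B)) = \<iota> (indicator (A - B)) + \<iota> (indicator B)"
        using BC AB complete by (intro iota_indicator_Un) auto
      moreover have "(A - B) \<union> B = A" using BC by auto
      \<comment> \<open>With \<open>B\<close> inside \<open>A\<close> the two classes differ by that
        of the indicator of \<open>A - B\<close>, which is covered by the small set
        \<open>C - B\<close>.\<close>
      ultimately have "dist (\<iota> (indicator B)) (\<iota> (indicator A)) = norm (\<iota> (indicator (A - B)))"
        by (simp add: dist_norm norm_minus_commute)
      also have "\<dots> = sqrt (shift_measure e UNIV (A - B))" by (rule norm_iota_indicator[OF AB])
      also have "\<dots> \<le> sqrt (ring_measure e UNIV (C - B))"
        using BC by (intro real_sqrt_le_mono shift_measure_le block_ring_Diff) auto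
      also have "\<dots> < \<epsilon>" using BC(5) \<open>\<epsilon> > 0\<close> real_sqrt_less_mono by fastforce
      finally show ?thesis using ring BC(1) by (auto simp: block_ring_eq)
    qed
    then have "\<iota> (indicator A) \<in> closure V" by (simp add: closure_approachable)
    then show ?thesis using V(1) by simp
  qed
  have "\<iota> ` step_funs e UNIV \<subseteq> V"
  proof (intro image_subsetI)
    fix f assume "f \<in> step_funs e UNIV"
    then obtain n c A where "f = step_fun n c A" "\<And>i. i < n \<Longrightarrow> A i \<in> complete_ring e UNIV"
      "disjoint_family_on A {..<n}" unfolding step_funs_def by blast
    then show "\<iota> f \<in> V"
      by (auto simp: iota_step_fun complete_V intro!: complex_vector.subspace_sum[OF V(2)] complex_vector.subspace_scale[OF V(2)])
  qed
  then have "closure (\<iota> ` step_funs e UNIV) \<subseteq> V" using V(1) by (rule closure_minimal)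
  then show ?thesis using completion by (auto simp: l2_completion_def)
qed

section \<open>Multiplication by indicators as slicing of blocks\<close>

definition box_slice :: "nat \<Rightarrow> real \<Rightarrow> real \<Rightarrow> box \<Rightarrow> box" where
  "box_slice k \<alpha> \<beta> p = ((fst p)(k := max \<alpha> (fst p k)), (snd p)(k := min \<beta> (snd p k)))"

lemma good_box_slice:
  assumes "good_box UNIV p" shows "good_box UNIV (box_slice k \<alpha> \<beta> p)"
proof (rule good_box_subbox[OF assms])
  have "bounded (insert (max \<alpha> (fst p k)) (fst p ` UNIV))" "bounded (insert (min \<beta> (snd p k)) (snd p ` UNIV))"
    using assms by (auto simp: good_box_def)
  then show "bounded (fst (box_slice k \<alpha> \<beta> p) ` UNIV)" "bounded (snd (box_slice k \<alpha> \<beta> p) ` UNIV)"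
    by (auto simp: box_slice_def intro: bounded_subset[of "insert _ (range _)"])
qed (auto simp: box_slice_def)

lemma box_slice_commute: "j \<noteq> k \<Longrightarrow> box_slice j \<alpha> \<beta> (box_slice k \<gamma> \<delta> p) = box_slice k \<gamma> \<delta> (box_slice j \<alpha> \<beta> p)"
  by (auto simp: box_slice_def fun_upd_twist)

text \<open>The same second factor \<open>v\<close> serves all slices in direction \<open>k\<close>:
  slicing alters only the interval in the first factor. This makes the multiplication computable on
  blocks.\<close>

lemma tensor_block:
  assumes p: "good_box UNIV p" and ne: "box_block UNIV p \<noteq> {}"
  obtains v where "\<iota> (indicator (box_block UNIV p)) = \<tau> k (indicator {fst p k..<snd p k}) v"
    "\<And>\<alpha> \<beta>. \<iota> (indicator (box_block UNIV (box_slice k \<alpha> \<beta> p))) =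
       \<tau> k (\<lambda>s. indicator {\<alpha>..<\<beta>} s * indicator {fst p k..<snd p k} s) v"
proof -
  let ?B = "block e (UNIV - {k}) (fst p) (snd p)"
  have lt: "fst p j < snd p j" for j
  proof -
    obtain x where "x \<in> box_block UNIV p" using ne by blast
    then have "fst p j \<le> x \<bullet> e j" "x \<bullet> e j < snd p j" by (auto simp: box_block_def block_def)
    then show ?thesis by simp
  qed
  have "abs_measurable e (UNIV - {k}) (fst p) (snd p)"
    using p ne lt unfolding abs_measurable_def good_box_def
    by (auto elim: bounded_subset intro: summable_on_subset_banach[where A=UNIV])
  then have B: "?B \<in> complete_ring e (UNIV - {k})"
    using block_ring_subset_complete_ring[of "UNIV - {k}"] block by (auto simp: block_ring_eq)
  have eq: "{x. x \<bullet> e k \<in> {\<alpha>..<\<beta>} \<and> x - (x \<bullet> e k) *\<^sub>R e k \<in> ?B} =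
      block e UNIV ((fst p)(k := \<alpha>)) ((snd p)(k := \<beta>))" for \<alpha> \<beta>
  proof -
    have "(x - (x \<bullet> e k) *\<^sub>R e k) \<bullet> e j = x \<bullet> e j" if "j \<noteq> k" for x j
      using that by (simp add: inner_diff_left inner_basis)
    then show ?thesis
      by (auto simp: block_def subspace_of_UNIV diff_coordinate_in_subspace_of)
  qed
  have split: "\<tau> k (indicator {\<alpha>..<\<beta>}) (\<iota>' k (indicator ?B)) =
      \<iota> (indicator (block e UNIV ((fst p)(k := \<alpha>)) ((snd p)(k := \<beta>))))" if "\<alpha> < \<beta>" for \<alpha> \<beta>
    using splitting[of k] B that unfolding coord_splitting_def eq[symmetric] by blast
  show thesis
  proof
    show "\<iota> (indicator (box_block UNIV p)) = \<tau> k (indicator {fst p k..<snd p k}) (\<iota>' k (indicator ?B))"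
      using split[OF lt[of k]] by (simp add: box_block_def)
    fix \<alpha> \<beta>
    let ?l = "max \<alpha> (fst p k)" and ?u = "min \<beta> (snd p k)"
    have ind: "(\<lambda>s. indicator {\<alpha>..<\<beta>} s * indicator {fst p k..<snd p k} s) = (indicator {?l..<?u} :: real \<Rightarrow> complex)"
      by (auto simp: indicator_def fun_eq_iff)
    show "\<iota> (indicator (box_block UNIV (box_slice k \<alpha> \<beta> p))) =
       \<tau> k (\<lambda>s. indicator {\<alpha>..<\<beta>} s * indicator {fst p k..<snd p k} s) (\<iota>' k (indicator ?B))"
    \<comment> \<open>The splitting clause covers proper intervals only; for an empty one both sides
      are 0.\<close>
    proof (cases "?l < ?u")
      case True
      then show ?thesis using split[OF True] by (simp add: ind box_block_def box_slice_def)
    next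
      case False
      then have "box_block UNIV (box_slice k \<alpha> \<beta> p) = {}"
        by (auto simp: box_block_def box_slice_def block_def intro!: exI[of _ k])
      moreover have "\<tau> k (\<lambda>s. 0 * indicator {?l..<?u} s) v = 0" for v
        by (subst tensor.tensor_scale_left[OF L2_real_indicator]) simp
      moreover have "(indicator {?l..<?u} :: real \<Rightarrow> complex) = (\<lambda>_. 0)"
        using False by (auto simp: fun_eq_iff indicator_def)
      ultimately show ?thesis unfolding ind by (simp add: iota_zero iota_indicator_empty)
    qed
  qed
qed

lemma coord_mult_block:
  assumes p: "good_box UNIV p"
  shows "coord_mult (\<tau> k) (indicator {\<alpha>..<\<beta>}) (\<iota> (indicator (box_block UNIV p))) =
    \<iota> (indicator (box_block UNIV (box_slice k \<alpha> \<beta> p)))"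
proof -
  have i: "indicat_real {\<alpha>..<\<beta>} \<in> borel_measurable borel" "\<And>s. \<bar>indicat_real {\<alpha>..<\<beta>} s\<bar> \<le> 1"
    by (auto simp: indicator_def)
  show ?thesis
  proof (cases "box_block UNIV p = {}")
    case True
    then have "box_block UNIV (box_slice k \<alpha> \<beta> p) = {}"
      by (force simp: box_block_def box_slice_def block_def)
    then show ?thesis
      using True bounded_linear.linear[OF tensor.bounded_linear_coord_mult[OF i]]
      by (simp add: iota_indicator_empty linear_0)
  next
    case False
    obtain v where v: "\<iota> (indicator (box_block UNIV p)) = \<tau> k (indicator {fst p k..<snd p k}) v"
      "\<iota> (indicator (box_block UNIV (box_slice k \<alpha> \<beta> p))) =
       \<tau> k (\<lambda>s. indicator {\<alpha>..<\<beta>} s * indicator {fst p k..<snd p k} s) v"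
      using tensor_block[OF p False, where k=k] by metis
    have "complex_of_real (indicator {\<alpha>..<\<beta>} s) = indicator {\<alpha>..<\<beta>} s" for s by (simp add: indicator_def)
    then show ?thesis
      by (simp add: v tensor.coord_mult_tensor[OF i L2_real_indicator])
  qed
qed

text \<open>For indicators, slices in different directions commute as updates of different
  coordinates, and blocks are dense. The two multipliers are then replaced by continuous ones in
  turn.\<close>

lemma coord_mult_commute:
  assumes jk: "j \<noteq> k"
    and \<phi>: "continuous_on UNIV \<phi>" "\<And>s. \<bar>\<phi> s\<bar> \<le> K"
    and \<psi>: "continuous_on UNIV \<psi>" "\<And>s. \<bar>\<psi> s\<bar> \<le> L"
  shows "coord_mult (\<tau> j) \<phi> (coord_mult (\<tau> k) \<psi> f) = coord_mult (\<tau> k) \<psi> (coord_mult (\<tau> j) \<phi> f)"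
proof -
  have i: "indicat_real {\<alpha>..<\<beta>} \<in> borel_measurable borel" "\<And>s. \<bar>indicat_real {\<alpha>..<\<beta>} s\<bar> \<le> 1" for \<alpha> \<beta> :: real
    by (auto simp: indicator_def)
  have 1: "coord_mult (\<tau> j) (indicator {\<alpha>..<\<beta>}) (coord_mult (\<tau> k) (indicator {\<gamma>..<\<delta>}) f) =
    coord_mult (\<tau> k) (indicator {\<gamma>..<\<delta>}) (coord_mult (\<tau> j) (indicator {\<alpha>..<\<beta>}) f)" for \<alpha> \<beta> \<gamma> \<delta> f
  proof -
    let ?A = "coord_mult (\<tau> j) (indicator {\<alpha>..<\<beta>})" and ?B = "coord_mult (\<tau> k) (indicator {\<gamma>..<\<delta>})"
    have A: "bounded_linear ?A" and B: "bounded_linear ?B"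
      by (rule tensor.bounded_linear_coord_mult[OF i])+
    note AB = bounded_linear_compose[OF A B] and BA = bounded_linear_compose[OF B A]
    have "{f. ?A (?B f) = ?B (?A f)} = UNIV"
    proof (rule blocks_dense)
      show "closed {f. ?A (?B f) = ?B (?A f)}"
        by (intro closed_Collect_eq linear_continuous_on AB BA)
      show "complex_vector.subspace {f. ?A (?B f) = ?B (?A f)}"
        using linear_0[OF bounded_linear.linear[OF A]] linear_0[OF bounded_linear.linear[OF B]]
        by (auto simp: complex_vector.subspace_def tensor.coord_mult_add[OF i] tensor.coord_mult_scaleC[OF i])
      fix p assume "good_box UNIV p"
      then show "\<iota> (indicator (box_block UNIV p)) \<in> {f. ?A (?B f) = ?B (?A f)}"
        by (simp add: coord_mult_block good_box_slice box_slice_commute[OF jk])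
    qed
    then show ?thesis by blast
  qed
  have 2: "coord_mult (\<tau> j) (indicator {\<alpha>..<\<beta>}) (coord_mult (\<tau> k) \<psi> f) =
    coord_mult (\<tau> k) \<psi> (coord_mult (\<tau> j) (indicator {\<alpha>..<\<beta>}) f)" for \<alpha> \<beta> f
    by (rule tensor.commute_coord_mult_continuous[OF tensor.bounded_linear_coord_mult[OF i] _ \<psi>]) (rule 1)
  have \<psi>m: "\<psi> \<in> borel_measurable borel" using \<psi>(1) by (rule borel_measurable_continuous_onI)
  show ?thesis
    by (rule tensor.commute_coord_mult_continuous[OF tensor.bounded_linear_coord_mult[OF \<psi>m \<psi>(2)] _ \<phi>, symmetric])
      (rule 2[symmetric])
qed

section \<open>Gaussian multipliers\<close>

definition gauss_mult :: "nat \<Rightarrow> real \<Rightarrow> 'h \<Rightarrow> 'h" where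
  "gauss_mult k c = coord_mult (\<tau> k) (\<lambda>s. exp (- c * s\<^sup>2))"

lemma gauss_bounded:
  fixes c :: real
  assumes "0 \<le> c" shows "(\<lambda>s. exp (- c * s\<^sup>2)) \<in> borel_measurable borel" "\<And>s. \<bar>exp (- c * s\<^sup>2)\<bar> \<le> 1"
proof -
  show "(\<lambda>s. exp (- c * s\<^sup>2)) \<in> borel_measurable borel"
    by (rule borel_measurable_continuous_onI) (intro continuous_intros)
  show "\<bar>exp (- c * s\<^sup>2)\<bar> \<le> 1" for s
    using mult_nonneg_nonneg[OF assms zero_le_power2[of s]] by simp
qed

lemma gauss_mult_commute:
  assumes "0 \<le> c" "0 \<le> c'"
  shows "gauss_mult j c (gauss_mult k c' f) = gauss_mult k c' (gauss_mult j c f)"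
proof (cases "j = k")
  case True
  then show ?thesis unfolding gauss_mult_def
    using tensor.coord_mult_coord_mult[OF gauss_bounded[OF assms(1)] gauss_bounded[OF assms(2)]]
      tensor.coord_mult_coord_mult[OF gauss_bounded[OF assms(2)] gauss_bounded[OF assms(1)]]
    by (simp add: mult.commute)
next
  case False
  show ?thesis unfolding gauss_mult_def
    by (rule coord_mult_commute[OF False _ gauss_bounded(2)[OF assms(1)] _ gauss_bounded(2)[OF assms(2)]])
      (intro continuous_intros)+
qed

lemma gauss_mult_add:
  assumes "0 \<le> c" "0 \<le> c'"
  shows "gauss_mult k c (gauss_mult k c' f) = gauss_mult k (c + c') f"
  unfolding gauss_mult_def
  using tensor.coord_mult_coord_mult[OF gauss_bounded[OF assms(1)] gauss_bounded[OF assms(2)]]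
  by (simp add: exp_add[symmetric] algebra_simps)

text \<open>On the vectors \<open>f\<close> below, all coordinates are bounded by \<open>sqrt (R / norm f)\<close>.\<close>

lemma gauss_mult_bounded_vectors_dense:
  "closure {f. \<exists>R. \<forall>k c. 0 \<le> c \<longrightarrow> norm (gauss_mult k c f - f) \<le> c * R} = UNIV" (is "closure ?V = _")
proof (rule blocks_dense)
  note g = gauss_bounded
  have diff: "gauss_mult k c x - x + (gauss_mult k c y - y) = gauss_mult k c (x + y) - (x + y)" if "0 \<le> c" for k c x y
    unfolding gauss_mult_def tensor.coord_mult_add[OF g[OF that]] by simp
  have "complex_vector.subspace ?V"
    unfolding complex_vector.subspace_def
  proof (safe, goal_cases)
    case 1
    have "gauss_mult k c 0 = 0" if "0 \<le> c" for k c
      unfolding gauss_mult_def using tensor.norm_coord_mult[OF g[OF that], of k 0] by simp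
    then show ?case by (auto intro!: exI[of _ 0])
  next
    case (2 x y R S)
    have "norm (gauss_mult k c (x + y) - (x + y)) \<le> c * (R + S)" if "0 \<le> c" for k c
    proof -
      have "norm (gauss_mult k c x - x) \<le> c * R" "norm (gauss_mult k c y - y) \<le> c * S" using 2 that by auto
      then show ?thesis
        using norm_triangle_ineq[of "gauss_mult k c x - x" "gauss_mult k c y - y"]
        unfolding diff[OF that] distrib_left by linarith
    qed
    then show ?case by blast
  next
    case (3 a x R)
    have "norm (gauss_mult k c (a *\<^sub>C x) - a *\<^sub>C x) \<le> c * (cmod a * R)" if "0 \<le> c" for k c
    proof -
      have "norm (gauss_mult k c (a *\<^sub>C x) - a *\<^sub>C x) = cmod a * norm (gauss_mult k c x - x)"
        unfolding gauss_mult_def tensor.coord_mult_scaleC[OF g[OF that]] scaleC_diff_right[symmetric] norm_scaleC ..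
      also have "\<dots> \<le> cmod a * (c * R)" using 3 that by (intro mult_left_mono) auto
      finally show ?thesis by (simp add: mult_ac)
    qed
    then show ?case by blast
  qed
  then show "complex_vector.subspace (closure ?V)" by (rule csubspace_closure)
  fix p assume p: "good_box UNIV p"
  let ?f = "\<iota> (indicator (box_block UNIV p))"
  have "?f \<in> ?V"
  proof (cases "box_block UNIV p = {}")
    case True
    then show ?thesis using complex_vector.subspace_0[OF \<open>complex_vector.subspace ?V\<close>]
      by (simp add: iota_indicator_empty)
  next
    case False
    obtain A where A: "\<And>j. \<bar>fst p j\<bar> \<le> A" using p by (auto simp: good_box_def bounded_iff)
    obtain B where B: "\<And>j. \<bar>snd p j\<bar> \<le> B" using p by (auto simp: good_box_def bounded_iff)
    have "norm (gauss_mult k c ?f - ?f) \<le> c * ((max A B)\<^sup>2 * norm ?f)" if c: "0 \<le> c" for k c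
    proof -
      obtain v where v: "?f = \<tau> k (indicator {fst p k..<snd p k}) v" using tensor_block[OF p False, where k=k] by metis
      \<comment> \<open>Including the indicator of the edge does not change the result on
        \<open>?f\<close>, but makes the multiplier bounded by \<open>c\<close> times the square of
        the largest coordinate in the block.\<close>
      define \<phi> where "\<phi> s = (exp (- c * s\<^sup>2) - 1) * indicator {fst p k..<snd p k} s" for s
      have m: "\<phi> \<in> borel_measurable borel" unfolding \<phi>_def[abs_def] by simp
      have b: "\<bar>\<phi> s\<bar> \<le> c * (max A B)\<^sup>2" for s
      proof (cases "s \<in> {fst p k..<snd p k}")
        case True
        then have "\<bar>s\<bar> \<le> max A B" using A[of k] B[of k] by auto
        then have "s\<^sup>2 \<le> (max A B)\<^sup>2" by (metis abs_ge_zero power2_abs power_mono)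
        then have "c * s\<^sup>2 \<le> c * (max A B)\<^sup>2" using c by (intro mult_left_mono)
        moreover have "1 - c * s\<^sup>2 \<le> exp (- c * s\<^sup>2)" using exp_ge_add_one_self[of "- c * s\<^sup>2"] by simp
        moreover have "exp (- c * s\<^sup>2) \<le> 1" using c by simp
        ultimately show ?thesis using True by (simp add: \<phi>_def)
      next
        case False
        then show ?thesis using c by (simp add: \<phi>_def)
      qed
      have "gauss_mult k c ?f - ?f = \<tau> k (\<lambda>s. complex_of_real (exp (- c * s\<^sup>2)) * indicator {fst p k..<snd p k} s - indicator {fst p k..<snd p k} s) v"
        unfolding v gauss_mult_def tensor.coord_mult_tensor[OF g[OF c] L2_real_indicator]
        by (rule tensor.tensor_diff_left[symmetric, OF L2_real_mult_real[OF L2_real_indicator g[OF c]] L2_real_indicator])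
      also have "\<dots> = \<tau> k (\<lambda>s. complex_of_real (\<phi> s) * indicator {fst p k..<snd p k} s) v"
        by (intro arg_cong[where f="\<lambda>u. \<tau> k u v"]) (auto simp: \<phi>_def indicator_def fun_eq_iff)
      also have "\<dots> = coord_mult (\<tau> k) \<phi> ?f"
        unfolding v by (rule tensor.coord_mult_tensor[OF m b L2_real_indicator, symmetric])
      finally show ?thesis using tensor.norm_coord_mult[OF m b, of k ?f] by (simp add: mult_ac)
    qed
    then show ?thesis by blast
  qed
  then show "?f \<in> closure ?V" by (rule closure_subset[THEN subsetD])
qed simp

end

section \<open>Contraction semigroups\<close>

definition contraction :: "('h::complex_hilbert \<Rightarrow> 'h) \<Rightarrow> bool" where
  "contraction A \<longleftrightarrow> (\<forall>f g. A (f + g) = A f + A g) \<and> (\<forall>c f. A (c *\<^sub>C f) = c *\<^sub>C A f) \<and>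
     (\<forall>f. norm (A f) \<le> norm f)"

lemma contraction_add: "contraction A \<Longrightarrow> A (f + g) = A f + A g"
  and contraction_scaleC: "contraction A \<Longrightarrow> A (c *\<^sub>C f) = c *\<^sub>C A f"
  and contraction_norm: "contraction A \<Longrightarrow> norm (A f) \<le> norm f"
  by (simp_all add: contraction_def)

lemma contraction_scaleR: "contraction A \<Longrightarrow> A (r *\<^sub>R f) = r *\<^sub>R A f"
  by (metis contraction_scaleC scaleC_of_real)

lemma contraction_bounded_linear: "contraction A \<Longrightarrow> bounded_linear A"
  by (rule bounded_linear_intro[where K=1])
    (simp_all add: contraction_add contraction_scaleR contraction_norm)

lemma contraction_diff: "contraction A \<Longrightarrow> A (f - g) = A f - A g"
  by (rule linear_diff[OF bounded_linear.linear[OF contraction_bounded_linear]])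

lemma contraction_id: "contraction (\<lambda>f. f)"
  by (simp add: contraction_def)

lemma contraction_comp: "contraction A \<Longrightarrow> contraction B \<Longrightarrow> contraction (\<lambda>f. A (B f))"
  unfolding contraction_def by (metis order_trans)

lemma contraction_LIMSEQ:
  assumes A: "\<And>n. contraction (A n)" and lim: "\<And>f. (\<lambda>n. A n f) \<longlonglongrightarrow> B f"
  shows "contraction B"
  unfolding contraction_def
proof (intro conjI allI)
  show "B (f + g) = B f + B g" for f g
    using tendsto_add[OF lim[of f] lim[of g]] lim[of "f + g"]
    by (simp add: contraction_add[OF A] LIMSEQ_unique)
  show "B (c *\<^sub>C f) = c *\<^sub>C B f" for c f
    using tendsto_scaleC[OF lim[of f], of c] lim[of "c *\<^sub>C f"]
    by (simp add: contraction_scaleC[OF A] LIMSEQ_unique)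
  show "norm (B f) \<le> norm f" for f
    by (rule LIMSEQ_le_const2[OF tendsto_norm[OF lim[of f]]]) (use contraction_norm[OF A] in auto)
qed

lemma contraction_tendsto:
  assumes A: "\<And>n. contraction (A n)" and lim: "\<And>f. (\<lambda>n. A n f) \<longlonglongrightarrow> B f" and x: "x \<longlonglongrightarrow> f"
  shows "(\<lambda>n. A n (x n)) \<longlonglongrightarrow> B f"
proof -
  have "(\<lambda>n. A n (x n - f)) \<longlonglongrightarrow> 0"
    by (rule Lim_null_comparison[OF _ tendsto_norm_zero[OF LIM_zero[OF x]]])
      (simp add: contraction_norm[OF A])
  from tendsto_add[OF this lim[of f]] show ?thesis by (simp add: contraction_diff[OF A])
qed

lemma contraction_convergent_closure:
  assumes A: "\<And>n. contraction (A n)" and S: "\<And>f. f \<in> S \<Longrightarrow> convergent (\<lambda>n. A n f)"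
    and f: "f \<in> closure S"
  shows "convergent (\<lambda>n. A n f)"
proof (rule Cauchy_convergent, rule metric_CauchyI)
  fix \<epsilon> :: real assume "\<epsilon> > 0"
  then obtain v where v: "v \<in> S" "dist v f < \<epsilon> / 3"
    using f unfolding closure_approachable by (meson divide_pos_pos zero_less_numeral)
  have "Cauchy (\<lambda>n. A n v)" using S[OF v(1)] by (rule convergent_Cauchy)
  then obtain M where M: "\<And>m n. m \<ge> M \<Longrightarrow> n \<ge> M \<Longrightarrow> dist (A m v) (A n v) < \<epsilon> / 3"
    using \<open>\<epsilon> > 0\<close> by (metis metric_CauchyD divide_pos_pos zero_less_numeral)
  have d: "dist (A n f) (A n v) < \<epsilon> / 3" for n
    using contraction_norm[OF A, of n "f - v"] v(2)
    by (simp add: dist_norm contraction_diff[OF A] norm_minus_commute)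
  have "dist (A m f) (A n f) < \<epsilon>" if "m \<ge> M" "n \<ge> M" for m n
    using M[OF that] d[of m] d[of n] dist_triangle[of "A m f" "A n f" "A m v"]
      dist_triangle[of "A m v" "A n f" "A n v"] by (simp add: dist_commute)
  then show "\<exists>M. \<forall>m\<ge>M. \<forall>n\<ge>M. dist (A m f) (A n f) < \<epsilon>" by blast
qed

locale contraction_semigroup =
  fixes U :: "real \<Rightarrow> 'h::complex_hilbert \<Rightarrow> 'h"
  assumes contraction: "\<And>t. 0 \<le> t \<Longrightarrow> contraction (U t)"
    and semigroup: "\<And>s t f. 0 \<le> s \<Longrightarrow> 0 \<le> t \<Longrightarrow> U (s + t) f = U s (U t f)"
    and U_0: "\<And>f. U 0 f = f"
    and strongly_continuous: "\<And>f. ((\<lambda>t. U t f) \<longlongrightarrow> f) (at_right 0)"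
begin

text \<open>Telescoping \<open>U t f - f\<close> over \<open>n\<close> equal time steps and letting \<open>n\<close> tend to infinity
  bounds the difference quotient without integrating.\<close>

lemma generator_difference_bound:
  assumes fg: "(f, g) \<in> generator_graph U" and t: "0 < t"
    and M: "\<And>s. 0 \<le> s \<Longrightarrow> s \<le> t \<Longrightarrow> norm (U s g - g) \<le> M"
  shows "norm ((U t f - f) /\<^sub>R t - g) \<le> M"
proof -
  define h where "h n = t / real (Suc n)" for n
  have h: "0 < h n" "real (Suc n) * h n = t" for n using t by (auto simp: h_def)
  have bound: "norm (U t f - f - t *\<^sub>R g) \<le> t * (norm ((U (h n) f - f) /\<^sub>R h n - g) + M)" for n
  proof -
    \<comment> \<open>The first-order remainder over one step; \<open>r\<close> divided by
      \<open>h n\<close> tends to 0 because \<open>(f, g)\<close> lies in the graph.\<close>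
    define r where "r = U (h n) f - f - h n *\<^sub>R g"
    have step: "U (real i * h n) f - f - (real i * h n) *\<^sub>R g =
      (\<Sum>j<i. U (real j * h n) r + h n *\<^sub>R (U (real j * h n) g - g))" for i
    proof (induction i)
      case 0 show ?case by (simp add: U_0)
    next
      case (Suc i)
      have c: "contraction (U (real i * h n))" using h(1)[of n] by (intro contraction) simp
      have "U (real (Suc i) * h n) f = U (real i * h n) (U (h n) f)"
        using h(1)[of n] by (subst semigroup[symmetric]) (auto simp: algebra_simps)
      also have "\<dots> = U (real i * h n) r + U (real i * h n) f + h n *\<^sub>R U (real i * h n) g"
        by (simp add: r_def contraction_diff[OF c] contraction_scaleR[OF c])
      finally show ?case using Suc.IH by (simp add: algebra_simps)
    qed
    have "norm (U t f - f - t *\<^sub>R g) \<le> (\<Sum>j<Suc n. h n * (norm ((U (h n) f - f) /\<^sub>R h n - g) + M))"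
      unfolding step[of "Suc n", unfolded h(2)]
    proof (rule sum_norm_le)
      fix j assume j: "j \<in> {..<Suc n}"
      then have jh: "0 \<le> real j * h n" "real j * h n \<le> t"
        using h[of n] by (auto simp: mult_right_mono[of "real j" "real (Suc n)" "h n", unfolded h(2)] simp del: of_nat_Suc)
      have "r = h n *\<^sub>R ((U (h n) f - f) /\<^sub>R h n - g)"
        using h(1)[of n] by (simp add: r_def scaleR_diff_right)
      then have "norm r = h n * norm ((U (h n) f - f) /\<^sub>R h n - g)"
        using h(1)[of n] by simp
      moreover have "norm (U (real j * h n) r) \<le> norm r"
        by (rule contraction_norm[OF contraction[OF jh(1)]])
      moreover have "norm (h n *\<^sub>R (U (real j * h n) g - g)) \<le> h n * M"
        using M[OF jh] h(1)[of n] by (simp add: mult_left_mono)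
      ultimately show "norm (U (real j * h n) r + h n *\<^sub>R (U (real j * h n) g - g))
        \<le> h n * (norm ((U (h n) f - f) /\<^sub>R h n - g) + M)"
        unfolding distrib_left by (intro norm_triangle_le) linarith
    qed
    also have "\<dots> = t * (norm ((U (h n) f - f) /\<^sub>R h n - g) + M)"
      using h(2)[of n] by (simp add: mult.assoc[symmetric] del: of_nat_Suc)
    finally show ?thesis .
  qed
  have "h \<longlonglongrightarrow> 0"
  proof -
    have "(\<lambda>n. t * inverse (real (Suc n))) \<longlonglongrightarrow> t * 0"
      by (intro tendsto_mult_left LIMSEQ_inverse_real_of_nat)
    then show ?thesis unfolding h_def[abs_def] by (simp add: divide_inverse)
  qed
  then have "filterlim h (at_right 0) sequentially"
    using h(1) less_imp_neq[OF h(1)] by (auto simp: filterlim_at)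
  then have "(\<lambda>n. (U (h n) f - f) /\<^sub>R h n) \<longlonglongrightarrow> g"
    using fg by (auto simp: generator_graph_def intro: filterlim_compose)
  then have "(\<lambda>n. t * (norm ((U (h n) f - f) /\<^sub>R h n - g) + M)) \<longlonglongrightarrow> t * (0 + M)"
    by (intro tendsto_intros tendsto_norm_zero LIM_zero)
  then have "norm (U t f - f - t *\<^sub>R g) \<le> t * M"
    using bound by (intro LIMSEQ_le_const[where X="\<lambda>n. t * (norm ((U (h n) f - f) /\<^sub>R h n - g) + M)"]) auto
  moreover have "U t f - f - t *\<^sub>R g = t *\<^sub>R ((U t f - f) /\<^sub>R t - g)"
    using t by (simp add: scaleR_diff_right)
  ultimately show ?thesis using t by simp
qed

text \<open>The difference bound holds on an interval of times that depends on \<open>g\<close>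
  alone, with an error \<open>2 * norm (G n - g)\<close>. Letting \<open>n\<close> grow at a fixed
  time therefore yields the estimate for the limit pair.\<close>

lemma closed_generator_graph: "closed (generator_graph U)"
  unfolding closed_sequential_limits
proof (safe)
  fix X f g assume X: "\<forall>n. X n \<in> generator_graph U" "X \<longlonglongrightarrow> (f, g)"
  define F G where "F n = fst (X n)" and "G n = snd (X n)" for n
  have FG: "(F n, G n) \<in> generator_graph U" for n using X by (simp add: F_def G_def)
  have F: "F \<longlonglongrightarrow> f" and G: "G \<longlonglongrightarrow> g"
    using tendsto_fst[OF X(2)] tendsto_snd[OF X(2)] by (simp_all add: F_def[abs_def] G_def[abs_def])
  have "((\<lambda>t. (U t f - f) /\<^sub>R t) \<longlongrightarrow> g) (at_right 0)"
  proof (rule tendstoI)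
    fix \<epsilon> :: real assume "\<epsilon> > 0"
    then have "\<forall>\<^sub>F s in at_right 0. dist (U s g) g < \<epsilon> / 2"
      using tendstoD[OF strongly_continuous[of g], of "\<epsilon> / 2"] by simp
    then obtain \<delta> where \<delta>: "\<delta> > 0" "\<And>s. 0 < s \<Longrightarrow> s < \<delta> \<Longrightarrow> dist (U s g) g < \<epsilon> / 2"
      by (auto simp: eventually_at_right[OF zero_less_one])
    have "dist ((U t f - f) /\<^sub>R t) g < \<epsilon>" if t: "0 < t" "t < \<delta>" for t
    proof -
      have ct: "contraction (U t)" using t by (intro contraction) simp
      have b: "norm ((U t (F n) - F n) /\<^sub>R t - G n) \<le> \<epsilon> / 2 + 2 * norm (G n - g)" for n
      proof (rule generator_difference_bound[OF FG t(1)])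
        fix s assume s: "0 \<le> s" "s \<le> t"
        have "norm (U s g - g) \<le> \<epsilon> / 2"
          using \<delta>(2)[of s] s t \<open>\<epsilon> > 0\<close> by (cases "s = 0") (auto simp: dist_norm U_0)
        moreover have "norm (U s (G n) - G n) \<le> norm (U s (G n - g)) + norm (U s g - g) + norm (g - G n)"
          unfolding contraction_diff[OF contraction[OF s(1)]] by (smt (verit) norm_triangle_ineq add_diff_cancel diff_add_cancel add_diff_eq)
        ultimately show "norm (U s (G n) - G n) \<le> \<epsilon> / 2 + 2 * norm (G n - g)"
          using contraction_norm[OF contraction[OF s(1)], of "G n - g"] by (simp add: norm_minus_commute)
      qed
      have "(\<lambda>n. norm ((U t (F n) - F n) /\<^sub>R t - G n)) \<longlonglongrightarrow> norm ((U t f - f) /\<^sub>R t - g)"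
        by (intro tendsto_intros F G bounded_linear.tendsto[OF contraction_bounded_linear[OF ct]])
      moreover have "(\<lambda>n. \<epsilon> / 2 + 2 * norm (G n - g)) \<longlonglongrightarrow> \<epsilon> / 2 + 2 * 0"
        by (intro tendsto_intros tendsto_norm_zero LIM_zero G)
      ultimately have "norm ((U t f - f) /\<^sub>R t - g) \<le> \<epsilon> / 2 + 2 * 0"
        using b by (intro LIMSEQ_le) auto
      then show ?thesis using \<open>\<epsilon> > 0\<close> by (simp add: dist_norm)
    qed
    then show "\<forall>\<^sub>F t in at_right 0. dist ((U t f - f) /\<^sub>R t) g < \<epsilon>"
      unfolding eventually_at_right[OF zero_less_one] using \<delta>(1) by blast
  qed
  then show "(f, g) \<in> generator_graph U" by (simp add: generator_graph_def)
qed

lemma generator_graph_unique: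
  "(f, g) \<in> generator_graph U \<Longrightarrow> (f, g') \<in> generator_graph U \<Longrightarrow> g = g'"
  unfolding generator_graph_def using tendsto_unique trivial_limit_at_right_real by blast

lemma generator_graph_commuting:
  assumes A: "contraction A" and comm: "\<And>t f. 0 \<le> t \<Longrightarrow> A (U t f) = U t (A f)"
    and fg: "(f, g) \<in> generator_graph U"
  shows "(A f, A g) \<in> generator_graph U"
proof -
  have "((\<lambda>t. A ((U t f - f) /\<^sub>R t)) \<longlongrightarrow> A g) (at_right 0)"
    using fg by (intro bounded_linear.tendsto[OF contraction_bounded_linear[OF A]]) (simp add: generator_graph_def)
  moreover have "\<forall>\<^sub>F t in at_right 0. A ((U t f - f) /\<^sub>R t) = (U t (A f) - A f) /\<^sub>R t"
    using eventually_at_right_less[of "0::real"]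
    by eventually_elim (simp add: contraction_scaleR[OF A] contraction_diff[OF A] comm)
  ultimately show ?thesis
    unfolding generator_graph_def by (auto intro: Lim_transform_eventually)
qed

text \<open>A commuting semigroup \<open>V\<close> that maps into the domain of the generator of \<open>U\<close> regularizes
  every point \<open>(f, g)\<close> of its graph to \<open>(V s f, V s g)\<close>, so its range is a core.\<close>

lemma generator_graph_core:
  assumes V: "contraction_semigroup V"
    and comm: "\<And>s t f. 0 \<le> s \<Longrightarrow> 0 \<le> t \<Longrightarrow> V s (U t f) = U t (V s f)"
    and L: "\<And>s u. 0 < s \<Longrightarrow> (V s u, L (V s u)) \<in> generator_graph U"
    and C: "C = {V s u | s u. 0 < s}"
  shows "generator_graph U = closure (operator_graph C L)"
proof
  interpret V: contraction_semigroup V by fact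
  have "operator_graph C L \<subseteq> generator_graph U"
    using L by (auto simp: operator_graph_def C)
  then show "closure (operator_graph C L) \<subseteq> generator_graph U"
    by (rule closure_minimal[OF _ closed_generator_graph])
  show "generator_graph U \<subseteq> closure (operator_graph C L)"
  proof clarify
    fix f g assume fg: "(f, g) \<in> generator_graph U"
    have "(V s f, V s g) \<in> operator_graph C L" if s: "0 < s" for s
    proof -
      have "(V s f, V s g) \<in> generator_graph U"
        using s by (intro generator_graph_commuting[OF V.contraction comm fg]) auto
      then have "V s g = L (V s f)" using L[OF s] generator_graph_unique by blast
      then show ?thesis using s by (auto simp: operator_graph_def C)
    qed
    then have "(V (inverse (real (Suc n))) f, V (inverse (real (Suc n))) g) \<in> operator_graph C L" for n
      by simp
    moreover have "(\<lambda>n. (V (inverse (real (Suc n))) f, V (inverse (real (Suc n))) g)) \<longlonglongrightarrow> (f, g)"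
    proof -
      have "filterlim (\<lambda>n. inverse (real (Suc n))) (at_right 0) sequentially"
        using LIMSEQ_inverse_real_of_nat by (auto simp: filterlim_at)
      then show ?thesis
        by (intro tendsto_Pair filterlim_compose[OF V.strongly_continuous])
    qed
    ultimately show "(f, g) \<in> closure (operator_graph C L)"
      unfolding closure_sequential by (intro exI[of _ "\<lambda>n. (V (inverse (real (Suc n))) f, V (inverse (real (Suc n))) g)"]) blast
  qed
qed

text \<open>The quadratic form of each difference quotient is real by symmetry and at most 0 by
  contractivity with Cauchy-Schwarz; both survive the limit.\<close>

lemma generator_negative:
  assumes sym: "\<And>t. 0 \<le> t \<Longrightarrow> cinner (U t f) f = cinner f (U t f)"
    and fg: "(f, g) \<in> generator_graph U"
  shows "cinner g f \<in> \<real>" and "Re (cinner g f) \<le> 0"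
proof -
  have lim: "((\<lambda>t. cinner ((U t f - f) /\<^sub>R t) f) \<longlongrightarrow> cinner g f) (at_right 0)"
    using fg by (intro tendsto_cinner tendsto_const) (simp add: generator_graph_def)
  have q: "Im (cinner ((U t f - f) /\<^sub>R t) f) = 0 \<and> Re (cinner ((U t f - f) /\<^sub>R t) f) \<le> 0" if t: "0 < t" for t
  proof -
    define r where "r = inverse t"
    have eq: "cinner ((U t f - f) /\<^sub>R t) f = of_real r * (cinner (U t f) f - of_real ((norm f)\<^sup>2))"
      by (simp only: cinner_scaleR_left cinner_diff_left cinner_self r_def)
    have "cnj (cinner (U t f) f) = cinner (U t f) f"
      using sym[of t] t cinner_commute[of f "U t f"] by simp
    then have im: "Im (cinner (U t f) f) = 0"
      by (metis Reals_cnj_iff complex_is_Real_iff)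
    have "Re (cinner (U t f) f) \<le> cmod (cinner (U t f) f)" by (rule complex_Re_le_cmod)
    also have "\<dots> \<le> norm (U t f) * norm f" by (rule cinner_Cauchy_Schwarz)
    also have "\<dots> \<le> (norm f)\<^sup>2"
      unfolding power2_eq_square using t by (intro mult_right_mono contraction_norm contraction) auto
    finally have "r * (Re (cinner (U t f) f) - (norm f)\<^sup>2) \<le> 0"
      using t by (intro mult_nonneg_nonpos) (auto simp: r_def)
    then show ?thesis unfolding eq using im by simp
  qed
  have ev: "\<forall>\<^sub>F t in at_right 0. Im (cinner ((U t f - f) /\<^sub>R t) f) = 0"
    "\<forall>\<^sub>F t in at_right 0. Re (cinner ((U t f - f) /\<^sub>R t) f) \<le> 0"
    using eventually_at_right_less[of "0::real"] q by (auto elim: eventually_mono)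
  have "((\<lambda>t. Im (cinner ((U t f - f) /\<^sub>R t) f)) \<longlongrightarrow> 0) (at_right 0)"
    by (rule tendsto_eventually[OF ev(1)])
  then have "Im (cinner g f) = 0"
    using tendsto_unique[OF trivial_limit_at_right_real tendsto_Im[OF lim]] by blast
  then show "cinner g f \<in> \<real>" by (simp add: complex_is_Real_iff)
  show "Re (cinner g f) \<le> 0"
    by (rule tendsto_upperbound[OF tendsto_Re[OF lim] ev(2) trivial_limit_at_right_real])
qed

end

section \<open>Infinite products of commuting Gaussian semigroups\<close>

text \<open>\<open>G k c\<close> and \<open>Q k c\<close> stand for the multiplications by \<open>exp (- c * x\<^sub>k\<^sup>2)\<close> and
  \<open>x\<^sub>k\<^sup>2 * exp (- c * x\<^sub>k\<^sup>2)\<close>.\<close>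

locale gaussian_family =
  fixes G Q :: "nat \<Rightarrow> real \<Rightarrow> 'h::complex_hilbert \<Rightarrow> 'h"
  assumes contraction_G: "\<And>k c. 0 \<le> c \<Longrightarrow> contraction (G k c)"
    and G_add: "\<And>k c c' f. 0 \<le> c \<Longrightarrow> 0 \<le> c' \<Longrightarrow> G k c (G k c' f) = G k (c + c') f"
    and G_0: "\<And>k f. G k 0 f = f"
    and G_commute: "\<And>j k c c' f. 0 \<le> c \<Longrightarrow> 0 \<le> c' \<Longrightarrow> G j c (G k c' f) = G k c' (G j c f)"
    and G_symmetric: "\<And>k c f g. 0 \<le> c \<Longrightarrow> cinner (G k c f) g = cinner f (G k c g)"
    and G_dense: "closure {f. \<exists>R. \<forall>k c. 0 \<le> c \<longrightarrow> norm (G k c f - f) \<le> c * R} = UNIV"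
    and Q_bound: "\<And>k c w. 0 < c \<Longrightarrow> norm (Q k c w) \<le> norm w / c"
    and G_Lipschitz: "\<And>k c h w. 0 < c \<Longrightarrow> 0 \<le> h \<Longrightarrow> norm (G k h (G k c w) - G k c w) \<le> h / c * norm w"
    and G_derivative: "\<And>k c h w. 0 < c \<Longrightarrow> 0 \<le> h \<Longrightarrow>
      norm (G k h (G k c w) - G k c w + h *\<^sub>R Q k c w) \<le> (h / c)\<^sup>2 * norm w"
begin

definition gprod :: "(nat \<Rightarrow> real) \<Rightarrow> nat \<Rightarrow> real \<Rightarrow> 'h \<Rightarrow> 'h" where
  "gprod a n t = fold (\<lambda>k. G k (t * a k)) [0..<n]"

text \<open>The successor makes the truncations run over the coordinates \<open>k \<le> n\<close>,
  as in \<open>gauss_trunc\<close>.\<close>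

definition glim :: "(nat \<Rightarrow> real) \<Rightarrow> real \<Rightarrow> 'h \<Rightarrow> 'h" where
  "glim a t f = lim (\<lambda>n. gprod a (Suc n) t f)"

definition weights :: "(nat \<Rightarrow> real) \<Rightarrow> bool" where
  "weights a \<longleftrightarrow> (\<forall>k. 0 \<le> a k) \<and> summable a"

lemma gprod_0: "gprod a 0 t f = f"
  by (simp add: gprod_def)

lemma gprod_Suc: "gprod a (Suc n) t f = G n (t * a n) (gprod a n t f)"
  by (simp add: gprod_def)

lemma weights_nonneg: "weights a \<Longrightarrow> 0 \<le> t \<Longrightarrow> 0 \<le> t * a k"
  by (simp add: weights_def)

lemma contraction_gprod: "weights a \<Longrightarrow> 0 \<le> t \<Longrightarrow> contraction (gprod a n t)"
proof (induction n)
  case 0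
  then show ?case using contraction_id by (simp add: gprod_0[abs_def])
next
  case (Suc n)
  then show ?case
    using contraction_comp[OF contraction_G[OF weights_nonneg[of a t n]]] by (simp add: gprod_Suc[abs_def])
qed

lemma gprod_commute_operator:
  assumes a: "weights a" "0 \<le> t" and T: "\<And>k c f. 0 \<le> c \<Longrightarrow> T (G k c f) = G k c (T f)"
  shows "T (gprod a n t f) = gprod a n t (T f)"
  by (induction n) (simp_all add: gprod_0 gprod_Suc T weights_nonneg a)

lemma G_gprod_commute: "weights a \<Longrightarrow> 0 \<le> t \<Longrightarrow> 0 \<le> c \<Longrightarrow> G k c (gprod a n t f) = gprod a n t (G k c f)"
  by (rule gprod_commute_operator) (auto simp: G_commute)

lemma gprod_add:
  assumes a: "weights a" and st: "0 \<le> s" "0 \<le> t"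
  shows "gprod a n (s + t) f = gprod a n s (gprod a n t f)"
proof (induction n)
  case (Suc n)
  have "gprod a (Suc n) (s + t) f = G n (s * a n) (G n (t * a n) (gprod a n (s + t) f))"
    using assms by (simp add: gprod_Suc G_add weights_nonneg distrib_right)
  also have "\<dots> = G n (s * a n) (gprod a n s (G n (t * a n) (gprod a n t f)))"
    unfolding Suc.IH using assms by (simp add: G_gprod_commute weights_nonneg)
  finally show ?case by (simp add: gprod_Suc)
qed (simp add: gprod_0)

lemma gprod_symmetric:
  assumes "weights a" "0 \<le> t" shows "cinner (gprod a n t f) g = cinner f (gprod a n t g)"
proof (induction n arbitrary: f g)
  case (Suc n)
  then show ?case
    using assms by (simp add: gprod_Suc G_symmetric G_gprod_commute weights_nonneg)
qed (simp add: gprod_0)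

text \<open>The new factor is commuted to the inside, where it meets \<open>f\<close> itself, the
  vector for which estimates are available; the outer factors are contractions.\<close>

lemma gprod_step:
  assumes "weights a" "0 \<le> t"
  shows "gprod a (Suc n) t f - gprod a n t f = gprod a n t (G n (t * a n) f - f)"
  using assms by (simp add: gprod_Suc G_gprod_commute weights_nonneg contraction_diff[OF contraction_gprod])

lemma gprod_telescope:
  assumes "weights a" "0 \<le> t"
  shows "gprod a n t f - f = (\<Sum>k<n. gprod a k t (G k (t * a k) f - f))"
proof -
  have "(\<Sum>k<n. gprod a (Suc k) t f - gprod a k t f) = gprod a n t f - f"
    by (subst sum_lessThan_telescope[where f="\<lambda>k. gprod a k t f"]) (simp add: gprod_0)
  then show ?thesis by (simp only: gprod_step[OF assms])
qed

text \<open>Both claims come from the majorant \<open>t * R * a k\<close> of the telescoped terms;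
  this is where summability of the weights enters. The bound is uniform in \<open>n\<close>, hence
  inherited by \<open>glim\<close>.\<close>

lemma gprod_near_id:
  assumes a: "weights a" and t: "0 \<le> t" and R: "\<And>k c. 0 \<le> c \<Longrightarrow> norm (G k c f - f) \<le> c * R"
  shows "norm (gprod a n t f - f) \<le> t * (suminf a * R)"
    and "summable (\<lambda>k. gprod a k t (G k (t * a k) f - f))"
proof -
  have R0: "0 \<le> R" using order_trans[OF norm_ge_zero R[of 1 0]] by simp
  have step: "norm (gprod a k t (G k (t * a k) f - f)) \<le> t * R * a k" for k
    using order_trans[OF contraction_norm[OF contraction_gprod[OF a t]] R[OF weights_nonneg[OF a t]]]
    by (simp add: mult_ac)
  have "summable (\<lambda>k. t * R * a k)" using a by (intro summable_mult) (simp add: weights_def)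
  then show "summable (\<lambda>k. gprod a k t (G k (t * a k) f - f))"
    by (rule summable_comparison_test'[where N=0]) (use step in auto)
  have "norm (gprod a n t f - f) \<le> (\<Sum>k<n. t * R * a k)"
    unfolding gprod_telescope[OF a t] by (rule sum_norm_le) (use step in auto)
  also have "\<dots> = t * R * (\<Sum>k<n. a k)" by (simp add: sum_distrib_left)
  also have "\<dots> \<le> t * R * suminf a"
    using a t R0 by (intro mult_left_mono sum_le_suminf) (auto simp: weights_def)
  finally show "norm (gprod a n t f - f) \<le> t * (suminf a * R)" by (simp add: mult_ac)
qed

lemma gprod_convergent:
  assumes a: "weights a" and t: "0 \<le> t"
  shows "convergent (\<lambda>n. gprod a n t f)"
proof (rule contraction_convergent_closure[OF contraction_gprod[OF a t]])
  show "f \<in> closure {f. \<exists>R. \<forall>k c. 0 \<le> c \<longrightarrow> norm (G k c f - f) \<le> c * R}" by (simp add: G_dense)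
  fix f assume "f \<in> {f. \<exists>R. \<forall>k c. 0 \<le> c \<longrightarrow> norm (G k c f - f) \<le> c * R}"
  then obtain R where "\<And>k c. 0 \<le> c \<Longrightarrow> norm (G k c f - f) \<le> c * R" by blast
  from gprod_near_id(2)[OF a t this] have "convergent (\<lambda>n. gprod a n t f - f)"
    unfolding gprod_telescope[OF a t] by (simp add: summable_iff_convergent)
  then have "convergent (\<lambda>n. (gprod a n t f - f) + f)" by (intro convergent_add convergent_const)
  then show "convergent (\<lambda>n. gprod a n t f)" by simp
qed

section \<open>The limit semigroup: semigroup law, commutation, symmetry\<close>

lemma gprod_tendsto:
  assumes "weights a" "0 \<le> t" shows "(\<lambda>n. gprod a n t f) \<longlonglongrightarrow> glim a t f"
proof -
  obtain L where L: "(\<lambda>n. gprod a n t f) \<longlonglongrightarrow> L"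
    using gprod_convergent[OF assms] convergent_def by blast
  then have "glim a t f = L" unfolding glim_def by (intro limI LIMSEQ_Suc)
  then show ?thesis using L by simp
qed

lemma contraction_glim: "weights a \<Longrightarrow> 0 \<le> t \<Longrightarrow> contraction (glim a t)"
  by (rule contraction_LIMSEQ[OF contraction_gprod gprod_tendsto])

lemma gprod_tendsto_id:
  assumes a: "weights a"
  shows "((\<lambda>t. gprod a n t f) \<longlongrightarrow> f) (at_right 0)" and "((\<lambda>t. glim a t f) \<longlongrightarrow> f) (at_right 0)"
proof -
  let ?S = "{f. \<exists>R. \<forall>k c. 0 \<le> c \<longrightarrow> norm (G k c f - f) \<le> c * R}"
  have main: "((\<lambda>t. A t f) \<longlongrightarrow> f) (at_right 0)"
    if A: "\<And>t. 0 \<le> t \<Longrightarrow> contraction (A t)"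
      and bd: "\<And>t f R. 0 \<le> t \<Longrightarrow> (\<And>k c. 0 \<le> c \<Longrightarrow> norm (G k c f - f) \<le> c * R) \<Longrightarrow> norm (A t f - f) \<le> t * (suminf a * R)"
    for A
  proof -
    have "((\<lambda>t. A t f - f) \<longlongrightarrow> 0) (at_right 0)"
    proof (rule tendsto_on_closure[where A="\<lambda>t f. A t f - f" and K=2 and S="?S"])
      show "f \<in> closure ?S" by (simp add: G_dense)
      show "((\<lambda>t. A t v - v) \<longlongrightarrow> 0) (at_right 0)" if v: "v \<in> ?S" for v
      proof -
        obtain R where R: "\<And>k c. 0 \<le> c \<Longrightarrow> norm (G k c v - v) \<le> c * R" using v by blast
        show ?thesis
        proof (rule Lim_null_comparison)
          show "\<forall>\<^sub>F t in at_right 0. norm (A t v - v) \<le> t * (suminf a * R)"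
            using eventually_at_right_less[of "0::real"] by eventually_elim (use bd R in auto)
          have "((\<lambda>t. t * (suminf a * R)) \<longlongrightarrow> 0 * (suminf a * R)) (at_right 0)"
            by (intro tendsto_intros)
          then show "((\<lambda>t. t * (suminf a * R)) \<longlongrightarrow> 0) (at_right 0)" by simp
        qed
      qed
      show "\<forall>\<^sub>F t in at_right 0. \<forall>x y. norm (A t x - x - (A t y - y)) \<le> 2 * norm (x - y)"
        using eventually_at_right_less[of "0::real"]
      proof eventually_elim
        case (elim t)
        then have c: "contraction (A t)" by (intro A) simp
        have "norm (A t x - x - (A t y - y)) \<le> norm (A t (x - y)) + norm (x - y)" for x y
          using norm_triangle_ineq4[of "A t (x - y)" "x - y"] by (simp add: contraction_diff[OF c] algebra_simps)
        then show ?case using contraction_norm[OF c] by (metis add_right_mono mult_2 order_trans)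
      qed
    qed simp
    then show ?thesis by (simp add: LIM_zero_iff)
  qed
  show "((\<lambda>t. gprod a n t f) \<longlongrightarrow> f) (at_right 0)"
    by (rule main[OF contraction_gprod[OF a] gprod_near_id(1)[OF a]])
  show "((\<lambda>t. glim a t f) \<longlongrightarrow> f) (at_right 0)"
  proof (rule main[OF contraction_glim[OF a]])
    fix t :: real and f R assume t: "0 \<le> t" and R: "\<And>k c. 0 \<le> c \<Longrightarrow> norm (G k c f - f) \<le> c * R"
    from gprod_near_id(1)[OF a t R] show "norm (glim a t f - f) \<le> t * (suminf a * R)"
      by (intro LIMSEQ_le_const2[OF tendsto_norm[OF tendsto_diff[OF gprod_tendsto[OF a t] tendsto_const]]]) auto
  qed
qed

lemma glim_semigroup:
  assumes a: "weights a" shows "contraction_semigroup (glim a)"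
proof
  show "contraction (glim a t)" if "0 \<le> t" for t using contraction_glim[OF a that] .
  show "glim a (s + t) f = glim a s (glim a t f)" if "0 \<le> s" "0 \<le> t" for s t f
  proof -
    have "(\<lambda>n. gprod a n s (gprod a n t f)) \<longlonglongrightarrow> glim a s (glim a t f)"
      by (rule contraction_tendsto[OF contraction_gprod gprod_tendsto gprod_tendsto]) (use a that in auto)
    moreover have "(\<lambda>n. gprod a n s (gprod a n t f)) \<longlonglongrightarrow> glim a (s + t) f"
      unfolding gprod_add[OF a that, symmetric] using a that by (intro gprod_tendsto) auto
    ultimately show ?thesis by (metis LIMSEQ_unique)
  qed
  show "glim a 0 f = f" for f
  proof -
    have "gprod a n 0 f = f" for n by (induction n) (simp_all add: gprod_0 gprod_Suc G_0)
    then show ?thesis by (simp add: glim_def)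
  qed
  show "((\<lambda>t. glim a t f) \<longlongrightarrow> f) (at_right 0)" for f by (rule gprod_tendsto_id(2)[OF a])
qed

lemma glim_commute_operator:
  assumes a: "weights a" "0 \<le> t" and A: "contraction A"
    and T: "\<And>k c f. 0 \<le> c \<Longrightarrow> A (G k c f) = G k c (A f)"
  shows "A (glim a t f) = glim a t (A f)"
proof -
  have "(\<lambda>n. A (gprod a n t f)) \<longlonglongrightarrow> A (glim a t f)"
    by (rule bounded_linear.tendsto[OF contraction_bounded_linear[OF A] gprod_tendsto[OF a]])
  moreover have "A (gprod a n t f) = gprod a n t (A f)" for n
    by (rule gprod_commute_operator[OF a T])
  ultimately have "(\<lambda>n. gprod a n t (A f)) \<longlonglongrightarrow> A (glim a t f)" by simp
  from LIMSEQ_unique[OF this gprod_tendsto[OF a]] show ?thesis .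
qed

lemma glim_commute:
  assumes "weights a" "weights b" "0 \<le> s" "0 \<le> t"
  shows "glim a s (glim b t f) = glim b t (glim a s f)"
proof (rule glim_commute_operator[OF assms(2,4) contraction_glim[OF assms(1,3)]])
  show "glim a s (G k c f) = G k c (glim a s f)" if "0 \<le> c" for k c f
    by (rule glim_commute_operator[OF assms(1,3) contraction_G[OF that], symmetric])
      (use that in \<open>auto simp: G_commute\<close>)
qed

lemma glim_symmetric:
  assumes "weights a" "0 \<le> t" shows "cinner (glim a t f) g = cinner f (glim a t g)"
proof -
  have "(\<lambda>n. cinner (gprod a n t f) g) \<longlonglongrightarrow> cinner (glim a t f) g"
    by (intro tendsto_cinner gprod_tendsto assms tendsto_const)
  moreover have "(\<lambda>n. cinner f (gprod a n t g)) \<longlonglongrightarrow> cinner f (glim a t g)"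
    by (intro tendsto_cinner gprod_tendsto assms tendsto_const)
  ultimately show ?thesis unfolding gprod_symmetric[OF assms] by (metis LIMSEQ_unique)
qed

section \<open>Difference quotients on the range of the limit semigroup\<close>

lemma weights_fun_upd:
  assumes "weights a" shows "weights (a(k := 0))"
proof -
  have "summable (a(k := 0))"
    using assms by (intro summable_comparison_test[OF _ conjunct2[OF assms[unfolded weights_def]]]) (auto simp: weights_def)
  then show ?thesis using assms by (simp add: weights_def)
qed

text \<open>Bringing factor \<open>k\<close> to the outside exposes the Gaussian that controls the
  square of \<open>x_k\<close>. Weight 0 turns the remaining factor at \<open>k\<close> into the
  identity, so the other product keeps its form.\<close>

lemma glim_split_coordinate:
  assumes a: "weights a" and t: "0 \<le> t"
  shows "glim a t u = G k (t * a k) (glim (a(k := 0)) t u)"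
proof -
  define a' where "a' = a(k := 0)"
  have a'_eq: "a' k = 0" "\<And>j. j \<noteq> k \<Longrightarrow> a' j = a j" by (auto simp: a'_def)
  have a': "weights a'" unfolding a'_def by (rule weights_fun_upd[OF a])
  have "gprod a n t u = (if k < n then G k (t * a k) (gprod a' n t u) else gprod a' n t u)" for n
  proof (induction n)
    case (Suc n)
    then show ?case
      using weights_nonneg[OF a t] a'_eq by (auto simp: gprod_Suc G_0 G_commute less_Suc_eq)
  qed (simp add: gprod_0)
  then have "\<forall>\<^sub>F n in sequentially. gprod a n t u = G k (t * a k) (gprod a' n t u)"
    by (intro eventually_mono[OF eventually_gt_at_top[of k]]) simp
  moreover have "(\<lambda>n. G k (t * a k) (gprod a' n t u)) \<longlonglongrightarrow> G k (t * a k) (glim a' t u)"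
    by (intro bounded_linear.tendsto[OF contraction_bounded_linear[OF contraction_G[OF weights_nonneg[OF a t]]]] gprod_tendsto a' t)
  ultimately have "(\<lambda>n. gprod a n t u) \<longlonglongrightarrow> G k (t * a k) (glim a' t u)"
    by (simp add: tendsto_cong)
  from LIMSEQ_unique[OF gprod_tendsto[OF a t] this] show ?thesis by (simp add: a'_def)
qed

text \<open>This is the square of \<open>x_k\<close> times \<open>glim b t u\<close>, written with
  bounded operators only; \<open>coord_square_on_core\<close> identifies it with the unbounded
  multiplication.\<close>

definition square_mult :: "(nat \<Rightarrow> real) \<Rightarrow> real \<Rightarrow> 'h \<Rightarrow> nat \<Rightarrow> 'h" where
  "square_mult b t u k = Q k (t * b k) (glim (b(k := 0)) t u)"

text \<open>By telescoping, the difference quotient is a series whose \<open>k\<close>-th term tends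
  to \<open>- d k\<close> times \<open>square_mult b t u k\<close>. A majorant independent of the
  time step allows the limit to be taken termwise.\<close>

lemma generator_on_core:
  assumes d: "weights d" and b: "weights b" and bpos: "\<And>k. 0 < b k"
    and db: "summable (\<lambda>k. d k / b k)" and t: "0 < t"
  shows "summable (\<lambda>k. d k *\<^sub>R square_mult b t u k)"
    and "(glim b t u, - (\<Sum>k. d k *\<^sub>R square_mult b t u k)) \<in> generator_graph (glim d)"
proof -
  define f where "f = glim b t u"
  define w where "w k = glim (b(k := 0)) t u" for k
  define q where "q k = square_mult b t u k" for k
  have q: "q k = Q k (t * b k) (w k)" for k by (simp add: q_def square_mult_def w_def)
  have fw: "f = G k (t * b k) (w k)" for k
    unfolding f_def w_def using t by (intro glim_split_coordinate b) simp
  have wu: "norm (w k) \<le> norm u" for k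
    unfolding w_def using t by (intro contraction_norm contraction_glim weights_fun_upd b) simp
  have tb: "0 < t * b k" for k using t bpos by simp
  have d0: "0 \<le> d k" for k using d by (simp add: weights_def)
  \<comment> \<open>The bounds \<open>Q_bound\<close> and \<open>G_Lipschitz\<close> at
    \<open>c = t * b k\<close> both produce this majorant after \<open>w k\<close> has been
    estimated by \<open>u\<close>; an error term is thus at most \<open>2 * M k\<close>.\<close>
  define M where "M k = d k / b k * (norm u / t)" for k
  have M: "summable M" unfolding M_def by (intro summable_mult2 db)
  have dq: "norm (d k *\<^sub>R q k) \<le> M k" for k
  proof -
    have "norm (q k) \<le> norm (w k) / (t * b k)" unfolding q by (rule Q_bound[OF tb])
    also have "\<dots> \<le> norm u / (t * b k)" using less_imp_le[OF tb] wu by (intro divide_right_mono)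
    finally have "d k * norm (q k) \<le> d k * (norm u / (t * b k))" using d0 by (intro mult_left_mono)
    then show ?thesis using d0[of k] by (simp add: M_def mult_ac)
  qed
  have sum_dq: "summable (\<lambda>k. d k *\<^sub>R q k)"
    by (rule summable_comparison_test'[OF M, where N=0]) (use dq in auto)
  then show "summable (\<lambda>k. d k *\<^sub>R square_mult b t u k)" by (simp add: q_def)
  define E where "E k h = gprod d k h ((G k (h * d k) f - f) /\<^sub>R h) + d k *\<^sub>R q k" for k h
  have quot: "norm ((G k (h * d k) f - f) /\<^sub>R h) \<le> M k" if h: "0 < h" for k h
  proof -
    have "norm (G k (h * d k) f - f) \<le> h * d k / (t * b k) * norm (w k)"
      unfolding fw[of k] using h d0 by (intro G_Lipschitz tb) simp
    also have "\<dots> \<le> h * d k / (t * b k) * norm u"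
      using h d0[of k] tb[of k] wu by (intro mult_left_mono) auto
    also have "\<dots> = h * M k" using bpos[of k] t by (simp add: M_def field_simps)
    finally show ?thesis
      using h unfolding norm_scaleR by (simp add: inverse_eq_divide pos_divide_le_eq mult.commute)
  qed
  have E_bound: "norm (E k h) \<le> 2 * M k" if h: "0 < h" for k h
  proof -
    have "norm (gprod d k h ((G k (h * d k) f - f) /\<^sub>R h)) \<le> M k"
      using h by (intro order_trans[OF contraction_norm[OF contraction_gprod[OF d]] quot]) auto
    then show ?thesis unfolding E_def using dq[of k] by (intro norm_triangle_le) simp
  qed
  have E_limit: "((\<lambda>h. norm (E k h)) \<longlongrightarrow> 0) (at_right 0)" for k
  proof -
    have "((\<lambda>h. h * ((d k / (t * b k))\<^sup>2 * norm (w k)) + norm (gprod d k h (d k *\<^sub>R q k) - d k *\<^sub>R q k))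
      \<longlongrightarrow> 0 * ((d k / (t * b k))\<^sup>2 * norm (w k)) + 0) (at_right 0)"
      by (intro tendsto_intros tendsto_norm_zero LIM_zero gprod_tendsto_id d)
    then have lim: "((\<lambda>h. h * ((d k / (t * b k))\<^sup>2 * norm (w k)) + norm (gprod d k h (d k *\<^sub>R q k) - d k *\<^sub>R q k))
      \<longlongrightarrow> 0) (at_right 0)" by simp
    show ?thesis
    proof (rule Lim_null_comparison[OF _ lim])
      show "\<forall>\<^sub>F h in at_right 0. norm (norm (E k h)) \<le>
        h * ((d k / (t * b k))\<^sup>2 * norm (w k)) + norm (gprod d k h (d k *\<^sub>R q k) - d k *\<^sub>R q k)"
        using eventually_at_right_less[of "0::real"]
      proof eventually_elim
        case (elim h)
        have c: "contraction (gprod d k h)" using elim by (intro contraction_gprod d) simp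
        let ?r = "(G k (h * d k) f - f) /\<^sub>R h + d k *\<^sub>R q k"
        have "norm (h *\<^sub>R ?r) \<le> (h * d k / (t * b k))\<^sup>2 * norm (w k)"
          using G_derivative[OF tb[of k], of "h * d k" k "w k"] elim d0[of k]
          unfolding fw[of k, symmetric] q[symmetric] by (simp add: scaleR_add_right)
        then have "h * norm ?r \<le> h * (h * ((d k / (t * b k))\<^sup>2 * norm (w k)))"
          using elim by (simp add: power_mult_distrib power_divide power2_eq_square mult_ac)
        then have r: "norm ?r \<le> h * ((d k / (t * b k))\<^sup>2 * norm (w k))"
          using elim by (simp only: mult_le_cancel_left_pos)
        \<comment> \<open>The first part is the Taylor remainder, of order \<open>h\<close> after
          division. The second needs only strong continuity of a finite product at one fixed
          vector.\<close>
        have "E k h = gprod d k h ?r - (gprod d k h (d k *\<^sub>R q k) - d k *\<^sub>R q k)"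
          unfolding E_def contraction_add[OF c] by simp
        then have "norm (E k h) \<le> norm (gprod d k h ?r) + norm (gprod d k h (d k *\<^sub>R q k) - d k *\<^sub>R q k)"
          by (metis norm_triangle_ineq4)
        then show ?case using contraction_norm[OF c, of ?r] r by simp
      qed
    qed
  qed
  have tannery: "((\<lambda>h. \<Sum>k. norm (E k h)) \<longlongrightarrow> (\<Sum>k. (0::real))) (at_right 0)"
  proof (rule tannerys_theorem[THEN conjunct2, THEN conjunct2, OF E_limit])
    show "\<forall>\<^sub>F (k, h) in at_top \<times>\<^sub>F at_right 0. norm (norm (E k h)) \<le> 2 * M k"
      using eventually_prodI[OF eventually_True eventually_at_right_less[of "0::real"], of sequentially]
      by (rule eventually_mono) (auto simp: E_bound)
    show "summable (\<lambda>k. 2 * M k)" by (intro summable_mult M)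
  qed simp
  have quotient: "norm ((glim d h f - f) /\<^sub>R h + (\<Sum>k. d k *\<^sub>R q k)) \<le> (\<Sum>k. norm (E k h))" if h: "0 < h" for h
  proof -
    have "(\<lambda>n. (gprod d n h f - f) /\<^sub>R h) \<longlonglongrightarrow> (glim d h f - f) /\<^sub>R h"
      using h by (intro tendsto_intros gprod_tendsto d) simp
    moreover have "(gprod d n h f - f) /\<^sub>R h = (\<Sum>k<n. gprod d k h ((G k (h * d k) f - f) /\<^sub>R h))" for n
      using h by (simp add: gprod_telescope[OF d] scaleR_sum_right contraction_scaleR[OF contraction_gprod[OF d]])
    ultimately have "(\<lambda>k. gprod d k h ((G k (h * d k) f - f) /\<^sub>R h)) sums ((glim d h f - f) /\<^sub>R h)"
      by (simp add: sums_def)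
    from sums_add[OF this summable_sums[OF sum_dq]]
    have "(\<lambda>k. E k h) sums ((glim d h f - f) /\<^sub>R h + (\<Sum>k. d k *\<^sub>R q k))"
      by (simp add: E_def)
    moreover have "summable (\<lambda>k. norm (E k h))"
      by (rule summable_comparison_test'[OF summable_mult[OF M, of 2], where N=0]) (use E_bound[OF h] in auto)
    ultimately show ?thesis using summable_norm by (metis sums_unique)
  qed
  have "((\<lambda>h. (glim d h f - f) /\<^sub>R h + (\<Sum>k. d k *\<^sub>R q k)) \<longlongrightarrow> 0) (at_right 0)"
  proof (rule Lim_null_comparison)
    show "\<forall>\<^sub>F h in at_right 0. norm ((glim d h f - f) /\<^sub>R h + (\<Sum>k. d k *\<^sub>R q k)) \<le> (\<Sum>k. norm (E k h))"
      using eventually_at_right_less[of "0::real"] by eventually_elim (rule quotient)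
    show "((\<lambda>h. \<Sum>k. norm (E k h)) \<longlongrightarrow> 0) (at_right 0)" using tannery by simp
  qed
  from tendsto_add[OF this tendsto_const[of "- (\<Sum>k. d k *\<^sub>R q k)"]]
  have "((\<lambda>h. (glim d h f - f) /\<^sub>R h) \<longlongrightarrow> - (\<Sum>k. d k *\<^sub>R q k)) (at_right 0)" by simp
  then show "(glim b t u, - (\<Sum>k. d k *\<^sub>R square_mult b t u k)) \<in> generator_graph (glim d)"
    by (simp add: generator_graph_def f_def q_def)
qed

text \<open>By the semigroup law the ranges grow as the time decreases, so two vectors can be
  written at the smaller of their times and the union is already a subspace.\<close>

lemma cspan_glim:
  assumes b: "weights b"
  shows "cspan {glim b t u | t u. t > 0} = {glim b t u | t u. t > 0}"
proof -
  interpret U: contraction_semigroup "glim b" by (rule glim_semigroup[OF b])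
  have "complex_vector.subspace {glim b t u | t u. t > 0}"
    unfolding complex_vector.subspace_def
  proof (intro conjI ballI allI)
    have "glim b 1 0 = 0" using contraction_norm[OF U.contraction, of 1 0] by simp
    then show "0 \<in> {glim b t u | t u. t > 0}" by (metis (mono_tags, lifting) mem_Collect_eq zero_less_one)
  next
    fix x y assume "x \<in> {glim b t u | t u. t > 0}" "y \<in> {glim b t u | t u. t > 0}"
    then obtain s u t v where xy: "x = glim b s u" "0 < s" "y = glim b t v" "0 < t" by blast
    let ?m = "min s t"
    have "x = glim b ?m (glim b (s - ?m) u)" "y = glim b ?m (glim b (t - ?m) v)"
      using xy by (simp_all add: U.semigroup[symmetric])
    then have "x + y = glim b ?m (glim b (s - ?m) u + glim b (t - ?m) v)"
      using xy by (simp add: contraction_add[OF U.contraction])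
    moreover have "?m > 0" using xy by simp
    ultimately show "x + y \<in> {glim b t u | t u. t > 0}" by blast
  next
    fix c x assume "x \<in> {glim b t u | t u. t > 0}"
    then obtain t u where x: "x = glim b t u" "0 < t" by blast
    then have "c *\<^sub>C x = glim b t (c *\<^sub>C u)" by (simp add: contraction_scaleC[OF U.contraction])
    then show "c *\<^sub>C x \<in> {glim b t u | t u. t > 0}" using x(2) by blast
  qed
  then show ?thesis by (simp add: complex_vector.span_eq_iff)
qed

end

section \<open>The Gaussian semigroup and its generator\<close>

lemma exp_minus_bounds:
  fixes y :: real
  assumes "0 \<le> y"
  shows "y * exp (- y) \<le> 1" "y\<^sup>2 * exp (- y) \<le> 2" "\<bar>exp (- y) - 1\<bar> \<le> y" "\<bar>exp (- y) - 1 + y\<bar> \<le> y\<^sup>2 / 2"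
proof -
  have taylor: "1 + y + y\<^sup>2 / 2 \<le> exp y" by (rule exp_lower_Taylor_quadratic[OF assms])
  have "y \<le> exp y" "y\<^sup>2 \<le> 2 * exp y" using taylor assms zero_le_power2[of y] by linarith+
  then show "y * exp (- y) \<le> 1" "y\<^sup>2 * exp (- y) \<le> 2"
    by (simp_all add: exp_minus field_simps)
  have lower: "1 - y \<le> exp (- y)" using exp_ge_add_one_self[of "- y"] by simp
  then show "\<bar>exp (- y) - 1\<bar> \<le> y" using assms by simp
  \<comment> \<open>The product of the quadratic Taylor polynomials at \<open>y\<close> and
    \<open>- y\<close> is at least 1, which converts the lower bound of \<open>exp y\<close> into an
    upper bound of \<open>exp (- y)\<close>.\<close>
  have "1 \<le> 1 + (y\<^sup>2)\<^sup>2 / 4" by simp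
  also have "\<dots> = (1 - y + y\<^sup>2 / 2) * (1 + y + y\<^sup>2 / 2)"
    by (simp add: algebra_simps power2_eq_square)
  also have "\<dots> \<le> (1 - y + y\<^sup>2 / 2) * exp y"
  proof (rule mult_left_mono[OF taylor])
    have "0 \<le> ((1 - y)\<^sup>2 + 1) / 2" by simp
    then show "0 \<le> 1 - y + y\<^sup>2 / 2" by (simp add: power2_diff field_simps)
  qed
  finally have "exp (- y) \<le> 1 - y + y\<^sup>2 / 2" by (simp add: exp_minus field_simps)
  then show "\<bar>exp (- y) - 1 + y\<bar> \<le> y\<^sup>2 / 2" using lower by simp
qed

lemma square_gauss_bounded:
  fixes c :: real
  assumes "0 < c"
  shows "(\<lambda>s. s\<^sup>2 * exp (- c * s\<^sup>2)) \<in> borel_measurable borel" "\<And>s. \<bar>s\<^sup>2 * exp (- c * s\<^sup>2)\<bar> \<le> 1 / c"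
proof -
  show "(\<lambda>s. s\<^sup>2 * exp (- c * s\<^sup>2)) \<in> borel_measurable borel"
    by (rule borel_measurable_continuous_onI) (intro continuous_intros)
  show "\<bar>s\<^sup>2 * exp (- c * s\<^sup>2)\<bar> \<le> 1 / c" for s
    using exp_minus_bounds(1)[of "c * s\<^sup>2"] assms by (simp add: field_simps)
qed

context gauss_setting
begin

definition square_gauss_mult :: "nat \<Rightarrow> real \<Rightarrow> 'h \<Rightarrow> 'h" where
  "square_gauss_mult k c = coord_mult (\<tau> k) (\<lambda>s. s\<^sup>2 * exp (- c * s\<^sup>2))"

lemma norm_square_gauss_mult: "0 < c \<Longrightarrow> norm (square_gauss_mult k c w) \<le> norm w / c"
  unfolding square_gauss_mult_def using tensor.norm_coord_mult[OF square_gauss_bounded] by simp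

text \<open>Operator estimates become suprema of one scalar multiplier: \<open>r = 0\<close> serves
  the Lipschitz bound and \<open>r = h\<close> the derivative.\<close>

lemma gauss_mult_difference:
  assumes c: "0 < c" and h: "0 \<le> h"
  shows "gauss_mult k h (gauss_mult k c w) - gauss_mult k c w + r *\<^sub>R square_gauss_mult k c w =
    coord_mult (\<tau> k) (\<lambda>s. exp (- (c * s\<^sup>2)) * (exp (- (h * s\<^sup>2)) - 1 + r * s\<^sup>2)) w"
proof -
  have hc: "0 \<le> h + c" "0 \<le> c" using c h by auto
  note g = gauss_bounded[OF hc(1)] gauss_bounded[OF hc(2)]
  have m: "(\<lambda>s. exp (- (h + c) * s\<^sup>2) + (- 1) * exp (- c * s\<^sup>2)) \<in> borel_measurable borel"
    using g(1,3) by (intro borel_measurable_add borel_measurable_times borel_measurable_const)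
  have b: "\<bar>exp (- (h + c) * s\<^sup>2) + (- 1) * exp (- c * s\<^sup>2)\<bar> \<le> 2" for s :: real
    using g(2)[of s] g(4)[of s] by linarith
  have "gauss_mult k h (gauss_mult k c w) - gauss_mult k c w + r *\<^sub>R square_gauss_mult k c w =
     coord_mult (\<tau> k) (\<lambda>s. exp (- (h + c) * s\<^sup>2) + (- 1) * exp (- c * s\<^sup>2)) w + r *\<^sub>R square_gauss_mult k c w"
    unfolding gauss_mult_add[OF h hc(2)] unfolding gauss_mult_def tensor.coord_mult_linear_comb[OF g] by simp
  also have "\<dots> = coord_mult (\<tau> k) (\<lambda>s. exp (- (h + c) * s\<^sup>2) + (- 1) * exp (- c * s\<^sup>2) + r * (s\<^sup>2 * exp (- c * s\<^sup>2))) w"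
    unfolding square_gauss_mult_def tensor.coord_mult_linear_comb[OF m b square_gauss_bounded[OF c]] ..
  also have "(\<lambda>s. exp (- (h + c) * s\<^sup>2) + (- 1) * exp (- c * s\<^sup>2) + r * (s\<^sup>2 * exp (- c * s\<^sup>2))) =
    (\<lambda>s. exp (- (c * s\<^sup>2)) * (exp (- (h * s\<^sup>2)) - 1 + r * s\<^sup>2))"
    by (simp add: fun_eq_iff algebra_simps flip: exp_add)
  finally show ?thesis .
qed

lemma measurable_gauss_difference:
  "(\<lambda>s. exp (- (c * s\<^sup>2)) * (exp (- (h * s\<^sup>2)) - 1 + r * s\<^sup>2)) \<in> borel_measurable borel" for c h r :: real
  by (rule borel_measurable_continuous_onI) (intro continuous_intros)

sublocale gaussian: gaussian_family gauss_mult square_gauss_mult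
proof
  show "contraction (gauss_mult k c)" if "0 \<le> c" for k c
    unfolding contraction_def gauss_mult_def
    using tensor.coord_mult_add[OF gauss_bounded[OF that]] tensor.coord_mult_scaleC[OF gauss_bounded[OF that]]
      tensor.norm_coord_mult[OF gauss_bounded[OF that]] by simp
  show "gauss_mult k 0 f = f" for k f by (simp add: gauss_mult_def tensor.coord_mult_one)
  show "cinner (gauss_mult k c f) g = cinner f (gauss_mult k c g)" if "0 \<le> c" for k c f g
    unfolding gauss_mult_def by (rule tensor.cinner_coord_mult[OF gauss_bounded[OF that]])
  show "norm (gauss_mult k h (gauss_mult k c w) - gauss_mult k c w) \<le> h / c * norm w"
    if c: "0 < c" and h: "0 \<le> h" for k c h w
  proof -
    have b: "\<bar>exp (- (c * s\<^sup>2)) * (exp (- (h * s\<^sup>2)) - 1 + 0 * s\<^sup>2)\<bar> \<le> h / c" for s :: real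
    proof -
      have "exp (- (c * s\<^sup>2)) * \<bar>exp (- (h * s\<^sup>2)) - 1\<bar> \<le> exp (- (c * s\<^sup>2)) * (h * s\<^sup>2)"
        using h by (intro mult_left_mono exp_minus_bounds(3)) auto
      also have "\<dots> = h / c * (c * s\<^sup>2 * exp (- (c * s\<^sup>2)))" using c by simp
      also have "\<dots> \<le> h / c * 1" using c h by (intro mult_left_mono exp_minus_bounds(1)) auto
      finally show ?thesis by (simp add: abs_mult)
    qed
    from tensor.norm_coord_mult[OF measurable_gauss_difference b] gauss_mult_difference[OF c h, of k w 0]
    show ?thesis by simp
  qed
  show "norm (gauss_mult k h (gauss_mult k c w) - gauss_mult k c w + h *\<^sub>R square_gauss_mult k c w)
      \<le> (h / c)\<^sup>2 * norm w"
    if c: "0 < c" and h: "0 \<le> h" for k c h w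
  proof -
    \<comment> \<open>The factor 1/2 of the Taylor remainder cancels against the bound 2 for
      \<open>y\<^sup>2 * exp (- y)\<close> at \<open>y = c * s\<^sup>2\<close>.\<close>
    have b: "\<bar>exp (- (c * s\<^sup>2)) * (exp (- (h * s\<^sup>2)) - 1 + h * s\<^sup>2)\<bar> \<le> (h / c)\<^sup>2" for s :: real
    proof -
      have "exp (- (c * s\<^sup>2)) * \<bar>exp (- (h * s\<^sup>2)) - 1 + h * s\<^sup>2\<bar> \<le> exp (- (c * s\<^sup>2)) * ((h * s\<^sup>2)\<^sup>2 / 2)"
        using h by (intro mult_left_mono exp_minus_bounds(4)) auto
      also have "\<dots> = (h / c)\<^sup>2 / 2 * ((c * s\<^sup>2)\<^sup>2 * exp (- (c * s\<^sup>2)))"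
        using c by (simp add: power_mult_distrib power_divide)
      also have "\<dots> \<le> (h / c)\<^sup>2 / 2 * 2" using c h by (intro mult_left_mono exp_minus_bounds(2)) auto
      finally show ?thesis by (simp add: abs_mult)
    qed
    from tensor.norm_coord_mult[OF measurable_gauss_difference b] show ?thesis
      unfolding gauss_mult_difference[OF c h] .
  qed
qed (simp_all add: gauss_mult_add gauss_mult_commute gauss_mult_bounded_vectors_dense norm_square_gauss_mult)

lemma gauss_semigroup_eq: "gauss_semigroup \<tau> a = gaussian.glim a"
  by (simp add: fun_eq_iff gauss_semigroup_def gaussian.glim_def gauss_trunc_def gaussian.gprod_def gauss_mult_def)

lemma C_inf_eq: "gaussian.weights b \<Longrightarrow> C_inf \<tau> b = {gauss_semigroup \<tau> b t u | t u. t > 0}"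
  unfolding C_inf_def gauss_semigroup_eq by (rule gaussian.cspan_glim)

text \<open>The factor \<open>exp (- t * b k * s\<^sup>2)\<close>, brought to the outside, bounds
  the square; positivity of \<open>b k\<close> is essential.\<close>

lemma coord_square_on_core:
  assumes b: "gaussian.weights b" and bpos: "\<And>k. 0 < b k" and t: "0 < t"
  shows "gauss_semigroup \<tau> b t u \<in> coord_mult_dom (\<tau> k) (\<lambda>s. s\<^sup>2)"
    and "coord_mult (\<tau> k) (\<lambda>s. s\<^sup>2) (gauss_semigroup \<tau> b t u) = gaussian.square_mult b t u k"
proof -
  have c: "0 < t * b k" "0 \<le> t * b k" using t bpos[of k] by auto
  have sq: "(\<lambda>s::real. s\<^sup>2) \<in> borel_measurable borel"
    by (rule borel_measurable_continuous_onI) (intro continuous_intros)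
  have "gauss_semigroup \<tau> b t u = gauss_mult k (t * b k) (gaussian.glim (b(k := 0)) t u)"
    unfolding gauss_semigroup_eq using t by (intro gaussian.glim_split_coordinate b) simp
  then have graph: "(gauss_semigroup \<tau> b t u, gaussian.square_mult b t u k) \<in> coord_mult_graph (\<tau> k) (\<lambda>s. s\<^sup>2)"
    using tensor.coord_mult_unbounded[OF sq gauss_bounded[OF c(2)] square_gauss_bounded(2)[OF c(1)]]
    by (simp only: gauss_mult_def square_gauss_mult_def gaussian.square_mult_def)
  then show "gauss_semigroup \<tau> b t u \<in> coord_mult_dom (\<tau> k) (\<lambda>s. s\<^sup>2)"
    unfolding coord_mult_dom_def by blast
  show "coord_mult (\<tau> k) (\<lambda>s. s\<^sup>2) (gauss_semigroup \<tau> b t u) = gaussian.square_mult b t u k"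
    by (rule tensor.coord_mult_eqI[OF sq graph])
qed

lemma generator_eq_closure:
  assumes d: "gaussian.weights d" and b: "gaussian.weights b" and bpos: "\<And>k. 0 < b k"
    and db: "summable (\<lambda>k. d k / b k)"
  shows "(\<forall>f\<in>C_inf \<tau> b. quad_defined \<tau> d f) \<and>
         semibounded_above (C_inf \<tau> b) (\<lambda>f. - quad_mult \<tau> d f) \<and>
         generator_graph (gauss_semigroup \<tau> d) =
           closure (operator_graph (C_inf \<tau> b) (\<lambda>f. - quad_mult \<tau> d f))"
proof (intro conjI)
  interpret U: contraction_semigroup "gauss_semigroup \<tau> d"
    unfolding gauss_semigroup_eq by (rule gaussian.glim_semigroup[OF d])
  note C = C_inf_eq[OF b]
  note core = gaussian.generator_on_core[OF d b bpos db]
  show "\<forall>f\<in>C_inf \<tau> b. quad_defined \<tau> d f"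
    unfolding C quad_defined_def using core(1) by (auto simp: coord_square_on_core[OF b bpos])
  have graph: "(gauss_semigroup \<tau> b t u, - quad_mult \<tau> d (gauss_semigroup \<tau> b t u)) \<in> generator_graph (gauss_semigroup \<tau> d)"
    if "0 < t" for t u
    using core(2)[OF that, of u] unfolding quad_mult_def coord_square_on_core(2)[OF b bpos that]
    by (simp add: gauss_semigroup_eq)
  \<comment> \<open>Semi-boundedness holds with constant 0 and is read off from membership in the
    generator, which is symmetric and non-positive.\<close>
  have "cinner (- quad_mult \<tau> d f) f \<in> \<real> \<and> Re (cinner (- quad_mult \<tau> d f) f) \<le> 0 * (norm f)\<^sup>2"
    if "f \<in> C_inf \<tau> b" for f
  proof -
    have "(f, - quad_mult \<tau> d f) \<in> generator_graph (gauss_semigroup \<tau> d)" using that graph by (auto simp: C)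
    from U.generator_negative[OF _ this] show ?thesis
      by (simp add: gauss_semigroup_eq gaussian.glim_symmetric[OF d])
  qed
  then show "semibounded_above (C_inf \<tau> b) (\<lambda>f. - quad_mult \<tau> d f)"
    unfolding semibounded_above_def by blast
  show "generator_graph (gauss_semigroup \<tau> d) =
           closure (operator_graph (C_inf \<tau> b) (\<lambda>f. - quad_mult \<tau> d f))"
  proof (rule U.generator_graph_core[OF _ _ graph C])
    show "contraction_semigroup (gauss_semigroup \<tau> b)"
      unfolding gauss_semigroup_eq by (rule gaussian.glim_semigroup[OF b])
    show "gauss_semigroup \<tau> b s (gauss_semigroup \<tau> d t f) = gauss_semigroup \<tau> d t (gauss_semigroup \<tau> b s f)"
      if "0 \<le> s" "0 \<le> t" for s t f
      unfolding gauss_semigroup_eq by (rule gaussian.glim_commute[OF b d that])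
  qed
qed

end

section \<open>Nuclear diagonal operators\<close>

text \<open>After exchanging the sums over \<open>k\<close> and \<open>n\<close>, Cauchy-Schwarz and
  Bessel bound the sum over \<open>k\<close> of the \<open>n\<close>-th rank-one term by
  \<open>norm (x n) * norm (y n)\<close>.\<close>

lemma (in hilbert_basis) nuclear_trace_summable:
  assumes "nuclear T"
  shows "summable (\<lambda>k. \<bar>T (e k) \<bullet> e k\<bar>)"
proof -
  obtain x y :: "nat \<Rightarrow> 'a" where xy: "summable (\<lambda>n. norm (x n) * norm (y n))"
    and T: "\<And>z. (\<lambda>n. (z \<bullet> x n) *\<^sub>R y n) sums T z" using assms unfolding nuclear_def by blast
  let ?a = "\<lambda>k n. \<bar>x n \<bullet> e k\<bar> * \<bar>y n \<bullet> e k\<bar>"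
  have a: "?a k n \<le> norm (x n) * norm (y n)" for k n
    using Cauchy_Schwarz_ineq2[of "x n" "e k"] Cauchy_Schwarz_ineq2[of "y n" "e k"] inner_basis[of k k]
    by (intro mult_mono) (auto simp: norm_eq_sqrt_inner)
  have sa: "summable (?a k)" for k
    by (rule summable_comparison_test'[OF xy, where N=0]) (use a in auto)
  have tr: "\<bar>T (e k) \<bullet> e k\<bar> \<le> (\<Sum>n. ?a k n)" for k
  proof -
    have "(\<lambda>n. ((e k \<bullet> x n) *\<^sub>R y n) \<bullet> e k) sums (T (e k) \<bullet> e k)"
      by (intro bounded_linear.sums[OF bounded_linear_inner_left] T)
    then have s: "(\<lambda>n. (x n \<bullet> e k) * (y n \<bullet> e k)) sums (T (e k) \<bullet> e k)" by (simp add: inner_commute)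
    have "\<bar>T (e k) \<bullet> e k\<bar> = \<bar>\<Sum>n. (x n \<bullet> e k) * (y n \<bullet> e k)\<bar>"
      by (simp only: sums_unique[OF s])
    also have "\<dots> \<le> (\<Sum>n. \<bar>(x n \<bullet> e k) * (y n \<bullet> e k)\<bar>)"
      using sa[of k] by (intro summable_rabs) (simp add: abs_mult)
    finally show ?thesis by (simp add: abs_mult)
  qed
  have L2: "L2_set (\<lambda>k. z \<bullet> e k) {..<K} \<le> norm z" for z K
    unfolding L2_set_def using Bessel_finite[of "{..<K}" z] by (simp add: real_sqrt_le_iff' real_le_lsqrt)
  show ?thesis
  proof (rule bounded_imp_summable[of _ "\<Sum>n. norm (x n) * norm (y n)"])
    fix K
    have "(\<Sum>k\<le>K. \<bar>T (e k) \<bullet> e k\<bar>) \<le> (\<Sum>k\<le>K. \<Sum>n. ?a k n)" by (intro sum_mono tr)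
    also have "\<dots> = (\<Sum>n. \<Sum>k\<le>K. ?a k n)" by (intro suminf_sum[symmetric] sa)
    also have "\<dots> \<le> (\<Sum>n. norm (x n) * norm (y n))"
    proof (intro suminf_le xy summable_sum sa)
      fix n
      have "(\<Sum>k<Suc K. ?a k n) \<le> L2_set (\<lambda>k. x n \<bullet> e k) {..<Suc K} * L2_set (\<lambda>k. y n \<bullet> e k) {..<Suc K}"
        by (rule L2_set_mult_ineq)
      also have "\<dots> \<le> norm (x n) * norm (y n)" by (intro mult_mono L2) auto
      finally show "(\<Sum>k\<le>K. ?a k n) \<le> norm (x n) * norm (y n)" by (simp add: lessThan_Suc_atMost)
    qed
    finally show "(\<Sum>k\<le>K. \<bar>T (e k) \<bullet> e k\<bar>) \<le> (\<Sum>n. norm (x n) * norm (y n))" .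
  qed simp
qed

lemma nuclear_scaleR:
  assumes "nuclear T" shows "T (r *\<^sub>R z) = r *\<^sub>R T z"
proof -
  obtain x y where T: "\<And>z. (\<lambda>n. (z \<bullet> x n) *\<^sub>R y n) sums T z" using assms unfolding nuclear_def by blast
  have "(\<lambda>n. ((r *\<^sub>R z) \<bullet> x n) *\<^sub>R y n) sums (r *\<^sub>R T z)"
    using bounded_linear.sums[OF bounded_linear_scaleR_right T, of r z] by simp
  with T show ?thesis by (rule sums_unique2)
qed

theorem theorem6p1:
  fixes e :: "nat \<Rightarrow> 'a::{real_inner, complete_space}"
    and \<iota> :: "('a \<Rightarrow> complex) \<Rightarrow> 'h::complex_hilbert"
    and \<iota>' :: "nat \<Rightarrow> ('a \<Rightarrow> complex) \<Rightarrow> 'g::complex_hilbert"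
    and \<tau> :: "nat \<Rightarrow> (real \<Rightarrow> complex) \<Rightarrow> 'g \<Rightarrow> 'h"
    and D B :: "'a \<Rightarrow> 'a"
    and d b :: "nat \<Rightarrow> real"
  assumes basis: "orthonormal_basis e"
    and H: "l2_completion e UNIV \<iota>"
    and H_compl: "\<And>k. l2_completion e (UNIV - {k}) (\<iota>' k)"
    and splitting: "\<And>k. coord_splitting e k \<iota> (\<iota>' k) (\<tau> k)"
    and D_nuclear: "nuclear D" and D_nonneg: "\<And>x. 0 \<le> x \<bullet> D x"
    and D_diag: "\<And>k. D (e k) = d k *\<^sub>R e k"
    and B_nuclear: "nuclear B" and B_nonneg: "\<And>x. 0 \<le> x \<bullet> B x"
    and B_diag: "\<And>k. B (e k) = b k *\<^sub>R e k" and B_pos: "\<And>k. 0 < b k"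
    and DB_inv_nuclear: "\<exists>T. nuclear T \<and> (\<forall>x. T (B x) = D x)"
  shows "(\<forall>f\<in>C_inf \<tau> b. quad_defined \<tau> d f) \<and>
         semibounded_above (C_inf \<tau> b) (\<lambda>f. - quad_mult \<tau> d f) \<and>
         generator_graph (gauss_semigroup \<tau> d) =
           closure (operator_graph (C_inf \<tau> b) (\<lambda>f. - quad_mult \<tau> d f))"
proof -
  interpret gauss_setting e \<iota> \<iota>' \<tau>
    by unfold_locales (fact basis H splitting)+
  have ee: "e k \<bullet> e k = 1" for k by (simp add: inner_basis)
  have d0: "0 \<le> d k" for k using D_nonneg[of "e k"] by (simp add: D_diag ee)
  have "summable d"
    using nuclear_trace_summable[OF D_nuclear] by (simp add: D_diag ee d0)
  then have d: "gaussian.weights d" using d0 by (simp add: gaussian.weights_def)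
  have "summable b"
    using nuclear_trace_summable[OF B_nuclear] by (simp add: B_diag ee less_imp_le[OF B_pos])
  then have b: "gaussian.weights b" using less_imp_le[OF B_pos] by (simp add: gaussian.weights_def)
  obtain T where T: "nuclear T" "\<And>x. T (B x) = D x" using DB_inv_nuclear by blast
  \<comment> \<open>\<open>T\<close> is the nuclear extension of \<open>D\<close> after the inverse
    of \<open>B\<close>, which is given only on the range of \<open>B\<close>. That range contains
    the basis vectors, so the diagonal of \<open>T\<close> is determined.\<close>
  have "T (e k) = (d k / b k) *\<^sub>R e k" for k
  proof -
    have "b k *\<^sub>R T (e k) = d k *\<^sub>R e k"
      using T(2)[of "e k"] by (simp add: B_diag D_diag nuclear_scaleR[OF T(1)])
    then have "(1 / b k) *\<^sub>R (b k *\<^sub>R T (e k)) = (1 / b k) *\<^sub>R (d k *\<^sub>R e k)" by simp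
    then show ?thesis using B_pos[of k] by simp
  qed
  then have "summable (\<lambda>k. d k / b k)"
    using nuclear_trace_summable[OF T(1)] by (simp add: ee d0 less_imp_le[OF B_pos])
  then show ?thesis by (rule generator_eq_closure[OF d b B_pos])
qed

end
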